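(* Let $\Bbbk$ be an algebraically closed field of characteristic $p>0$, $q=p^r$ with $r\ge 1$, $n\ge 2$, $G=GL_n(\mathbb{F}_q)$ acting tautologically on $\mathfrak{h}=\Bbbk^n$, and let $c$ be a conjugation-invariant function from the set of reflections of $G$ to $\Bbbk$. The characters and Hilbert series of the irreducible modules $L_{0,c}(\mathrm{triv})$ for the rational Cherednik algebra $H_{0,c}(GL_n(\mathbb{F}_q),\mathfrak{h})$ are as follows. (1) If $(q,n)\neq(2,2)$, then for every $c$: $\chi_{L_{0,c}(\mathrm{triv})}(z)=[\mathrm{triv}]$ and $\mathrm{Hilb}_{L_{0,c}(\mathrm{triv})}(z)=1$. (2) If $(q,n)=(2,2)$ and $c=0$: $\chi_{L_{0,c}(\mathrm{triv})}(z)=[\mathrm{triv}]$ and $\mathrm{Hilb}_{L_{0,c}(\mathrm{triv})}(z)=1$. (3) If $(q,n)=(2,2)$ and $c\neq0$: $$\chi_{L_{0,c}(\mathrm{triv})}(z)=[\mathrm{triv}]+[\mathfrak{h}^*]z+([S^2\mathfrak{h}^*]-[\mathrm{triv}])z^2+([S^3\mathfrak{h}^*]-[\mathfrak{h}^*]-[\mathrm{triv}])z^3$$ and $\mathrm{Hilb}_{L_{0,c}(\mathrm{triv})}(z)=1+2z+2z^2+z^3$.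
   Context: Let $\Bbbk$ be an algebraically closed field of characteristic $p>0$, $G$ a finite group, $\mathfrak{h}$ a faithful $n$-dimensional representation of $G$ over $\Bbbk$ (so $G\subseteq GL(\mathfrak{h})$), $\mathfrak{h}^*$ the dual representation, $(g.y,x)=(y,g^{-1}.x)$, and $(\cdot,\cdot)$ the canonical pairing. A reflection is an element $s\in GL(\mathfrak{h})$ such that $1-s$ has rank $1$ on $\mathfrak{h}$; $S$ is the set of reflections in $G$. For $s\in S$ choose $\alpha_s\in\mathfrak{h}^*$, $\alpha_s^\vee\in\mathfrak{h}$ with $s.x=x-(\alpha_s^\vee,x)\alpha_s$ for all $x\in\mathfrak{h}^*$. Let $t\in\Bbbk$ and let $c:S\to\Bbbk$, $s\mapsto c_s$, be conjugation invariant. The rational Cherednik algebra $H_{t,c}(G,\mathfrak{h})$ is the quotient of $\Bbbk G\ltimes T(\mathfrak{h}\oplus\mathfrak{h}^* )$ by the relations $[x,x']=0$, $[y,y']=0$, $[y,x]=(y,x)t-\sum_{s\in S}c_s((1-s).x,y)s$ for $x,x'\in\mathfrak{h}^*$, $y,y'\in\mathfrak{h}$. It is $\mathbb{Z}$-graded by $\deg x=1$, $\deg y=-1$, $\deg g=0$. For an irreducible finite-dimensional $G$-representation $\tau$ over $\Bbbk$, the Verma module is $M_{t,c}(\tau)=M_{t,c}(G,\mathfrak{h},\tau)=H_{t,c}(G,\mathfrak{h})\otimes_{\Bbbk G\ltimes S\mathfrak{h}}\tau$, where $\mathfrak{h}$ acts on $\tau$ by zero. As a graded space it is $S\mathfrak{h}^*\otimes\tau$,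 with $x\in\mathfrak{h}^*$ acting by multiplication, $g\in G$ diagonally, and $y\in\mathfrak{h}$ by the Dunkl operator $D_y=t\partial_y\otimes1-\sum_{s\in S}c_s\frac{(y,\alpha_s)}{\alpha_s}(1-s)\otimes s$. Contravariant form: let $\bar c(s)=c(s^{-1})$. The restricted dual $M^\dagger$ of a graded module $M$ with finite-dimensional pieces has $i$-th graded piece $(M_i)^*$. The isomorphism $H_{t,c}(G,\mathfrak{h})^{opp}\cong H_{t,\bar c}(G,\mathfrak{h}^* )$, identity on $\mathfrak{h},\mathfrak{h}^*$ and $g\mapsto g^{-1}$, makes $M_{t,\bar c}(G,\mathfrak{h}^*,\tau^* )^\dagger$ an $H_{t,c}(G,\mathfrak{h})$-module. Let $\phi:M_{t,c}(G,\mathfrak{h},\tau)\to M_{t,\bar c}(G,\mathfrak{h}^*,\tau^* )^\dagger$ be the unique homomorphism that is the identity on the lowest graded piece $\tau$; equivalently, it is a bilinear form $B:M_{t,c}(G,\mathfrak{h},\tau)\times M_{t,\bar c}(G,\mathfrak{h}^*,\tau^* )\to\Bbbk$. Put $\ker B=\ker\phi$ and $L_{t,c}(\tau)=M_{t,c}(\tau)/\ker B$, a graded module. $\mathrm{triv}$ is the trivial one-dimensional representation of $G$. $K_0(G)$ is the Grothendieck group of finite-dimensional $G$-representations over $\Bbbk$; for a graded module $M=\oplus_iM_i$, $\chi_M(z)=\sum_i[M_i]z^i$ and $\mathrm{Hilb}_M(z)=\sum_i\dim(M_i)z^i$. For $(q,n)=(2,2)$ there is only one conjugacy class of reflections in $G$,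 so $c$ is identified with a single element of $\Bbbk$. *)

theory Defs
  imports
    "HOL-Algebra.QuotRing"
    "HOL-Algebra.Generated_Groups"
    "HOL-Algebra.Free_Abelian_Groups"
    "HOL-Library.Poly_Mapping"
    "Jordan_Normal_Form.DL_Rank"
begin

section \<open>Matrix representations\<close>

text \<open>A representation of \<open>G\<close> on \<open>k\<^sup>d\<close> is a pair \<open>(d, \<sigma>)\<close>; only the values of \<open>\<sigma>\<close> on the
  carrier of \<open>G\<close> matter. Dimension \<open>0\<close> is allowed.\<close>

type_synonym ('g, 'k) mrep = "nat \<times> ('g \<Rightarrow> 'k mat)"

definition is_rep :: "('g, 'b) monoid_scheme \<Rightarrow> ('g, 'k::field) mrep \<Rightarrow> bool" where
  "is_rep G V \<longleftrightarrow>
     (\<forall>g\<in>carrier G. snd V g \<in> carrier_mat (fst V) (fst V)) \<and>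
     snd V \<one>\<^bsub>G\<^esub> = 1\<^sub>m (fst V) \<and>
     (\<forall>g\<in>carrier G. \<forall>h\<in>carrier G. snd V (g \<otimes>\<^bsub>G\<^esub> h) = snd V g * snd V h)"

text \<open>The dual action in the dual basis: \<open>(g y, x) = (y, g\<^sup>-\<^sup>1 x)\<close>, with \<open>(y, x) = y \<bullet> x\<close>.\<close>

definition contra :: "('g, 'b) monoid_scheme \<Rightarrow> ('g \<Rightarrow> 'k mat) \<Rightarrow> 'g \<Rightarrow> 'k mat" where
  "contra G \<sigma> = (\<lambda>g. transpose_mat (\<sigma> (inv\<^bsub>G\<^esub> g)))"

definition dual_rep :: "('g, 'b) monoid_scheme \<Rightarrow> ('g, 'k) mrep \<Rightarrow> ('g, 'k) mrep" where
  "dual_rep G V = (fst V, contra G (snd V))"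

definition triv_rep :: "('g, 'k::field) mrep" where
  "triv_rep = (1, \<lambda>_. 1\<^sub>m 1)"


section \<open>Rational Cherednik algebras\<close>

text \<open>Parameters of \<open>H\<^sub>t\<^sub>,\<^sub>c(G, h)\<close>: the group, the dimension \<open>n\<close> of \<open>h = k\<^sup>n\<close>, the action of \<open>G\<close> on
  \<open>h\<close>, and \<open>t\<close>, \<open>c\<close>. Only the values of \<open>c\<close> on reflections matter.\<close>

record ('g, 'k) rca =
  rca_grp :: "'g monoid"
  rca_dim :: nat
  rca_rep :: "'g \<Rightarrow> 'k mat"
  rca_t :: 'k
  rca_c :: "'g \<Rightarrow> 'k"

definition reflections :: "('g, 'k::field) rca \<Rightarrow> 'g set" where
  "reflections D = {s \<in> carrier (rca_grp D).
     vec_space.rank (rca_dim D) (1\<^sub>m (rca_dim D) - rca_rep D s) = 1}"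

definition conj_invariant :: "('g, 'k::field) rca \<Rightarrow> bool" where
  "conj_invariant D \<longleftrightarrow> (\<forall>g\<in>carrier (rca_grp D). \<forall>s\<in>reflections D.
     rca_c D (g \<otimes>\<^bsub>rca_grp D\<^esub> s \<otimes>\<^bsub>rca_grp D\<^esub> inv\<^bsub>rca_grp D\<^esub> g) = rca_c D s)"

text \<open>The parameters of \<open>H\<^sub>t\<^sub>,\<^sub>c\<^sub>'(G, h\<^sup>*)\<close> with \<open>c'(s) = c(s\<^sup>-\<^sup>1)\<close>.\<close>

definition dual_rca :: "('g, 'k) rca \<Rightarrow> ('g, 'k) rca" where
  "dual_rca D = D\<lparr>rca_rep := contra (rca_grp D) (rca_rep D),
                  rca_c := (\<lambda>s. rca_c D (inv\<^bsub>rca_grp D\<^esub> s))\<rparr>"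

text \<open>The free algebra on \<open>G\<close>, a basis \<open>GX i\<close> of \<open>h\<^sup>*\<close> and the dual basis \<open>GY i\<close> of \<open>h\<close>
  (\<open>i < n\<close>), as the monoid algebra of the free monoid of words.\<close>

datatype 'g gen = GG 'g | GX nat | GY nat

datatype 'a word = Word (letters: "'a list")

instantiation word :: (type) monoid_add
begin
definition "0 = Word []"
definition "u + v = Word (letters u @ letters v)"
instance by standard (auto simp: zero_word_def plus_word_def)
end

type_synonym ('g, 'k) falg = "'g gen word \<Rightarrow>\<^sub>0 'k"

definition gens :: "('g, 'k) rca \<Rightarrow> 'g gen set" where
  "gens D = GG ` carrier (rca_grp D) \<union> GX ` {..<rca_dim D} \<union> GY ` {..<rca_dim D}"

definition free_alg :: "('g, 'k::field) rca \<Rightarrow> ('g, 'k) falg ring" where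
  "free_alg D = \<lparr>carrier = {a. \<forall>w\<in>Poly_Mapping.keys a. set (letters w) \<subseteq> gens D},
     monoid.mult = (*), one = 1, ring.zero = 0, add = (+)\<rparr>"

definition scal :: "'k::field \<Rightarrow> ('g, 'k) falg" where
  "scal a = Poly_Mapping.single 0 a"

definition gel :: "'g \<Rightarrow> ('g, 'k::field) falg" where
  "gel g = Poly_Mapping.single (Word [GG g]) 1"

definition xel :: "'k::field vec \<Rightarrow> ('g, 'k) falg" where
  "xel v = (\<Sum>i<dim_vec v. Poly_Mapping.single (Word [GX i]) (v $ i))"

definition yel :: "'k::field vec \<Rightarrow> ('g, 'k) falg" where
  "yel v = (\<Sum>i<dim_vec v. Poly_Mapping.single (Word [GY i]) (v $ i))"

text \<open>The relations presenting \<open>k G \<ltimes> T(h \<oplus> h\<^sup>*)\<close> as a quotient of the free algebra.\<close>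

definition smash_rels :: "('g, 'k::field) rca \<Rightarrow> ('g, 'k) falg set" where
  "smash_rels D = (let G = rca_grp D; V = carrier_vec (rca_dim D) in
     {gel \<one>\<^bsub>G\<^esub> - 1}
     \<union> {gel (g \<otimes>\<^bsub>G\<^esub> h) - gel g * gel h | g h. g \<in> carrier G \<and> h \<in> carrier G}
     \<union> {gel g * yel y - yel (rca_rep D g *\<^sub>v y) * gel g | g y. g \<in> carrier G \<and> y \<in> V}
     \<union> {gel g * xel x - xel (contra G (rca_rep D) g *\<^sub>v x) * gel g | g x. g \<in> carrier G \<and> x \<in> V})"

definition cherednik_rels :: "('g, 'k::field) rca \<Rightarrow> ('g, 'k) falg set" where
  "cherednik_rels D = (let V = carrier_vec (rca_dim D) in
     {xel x * xel x' - xel x' * xel x | x x'. x \<in> V \<and> x' \<in> V}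
     \<union> {yel y * yel y' - yel y' * yel y | y y'. y \<in> V \<and> y' \<in> V}
     \<union> {(yel y * xel x - xel x * yel y)
          - (scal (rca_t D * (y \<bullet> x))
             - (\<Sum>s\<in>reflections D.
                  scal (rca_c D s * (y \<bullet> (x - contra (rca_grp D) (rca_rep D) s *\<^sub>v x))) * gel s))
        | y x. y \<in> V \<and> x \<in> V})"

definition cherednik_ideal :: "('g, 'k::field) rca \<Rightarrow> ('g, 'k) falg set" where
  "cherednik_ideal D = Idl\<^bsub>free_alg D\<^esub> (smash_rels D \<union> cherednik_rels D)"

definition cherednik_algebra :: "('g, 'k::field) rca \<Rightarrow> ('g, 'k) falg set ring" where
  "cherednik_algebra D = free_alg D Quot cherednik_ideal D"

definition hcl :: "('g, 'k::field) rca \<Rightarrow> ('g, 'k) falg \<Rightarrow> ('g, 'k) falg set" where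
  "hcl D a = cherednik_ideal D +>\<^bsub>free_alg D\<^esub> a"

fun gdeg :: "'g gen \<Rightarrow> int" where
  "gdeg (GG g) = 0"
| "gdeg (GX i) = 1"
| "gdeg (GY i) = -1"

definition H_piece :: "('g, 'k::field) rca \<Rightarrow> int \<Rightarrow> ('g, 'k) falg set set" where
  "H_piece D i = hcl D ` {a \<in> carrier (free_alg D).
     \<forall>w\<in>Poly_Mapping.keys a. sum_list (map gdeg (letters w)) = i}"


section \<open>Verma modules\<close>

text \<open>\<open>M\<^sub>t\<^sub>,\<^sub>c(\<tau>) = H \<otimes> \<tau>\<close> over \<open>k G \<ltimes> S h\<close>, as the quotient of the free abelian group on
  \<open>H \<times> \<tau>\<close> by biadditivity and balancedness; it suffices to balance over the ring generators
  of \<open>k G \<ltimes> S h\<close>, namely scalars, elements of \<open>G\<close> and elements of \<open>h\<close> (acting on \<open>\<tau>\<close> by zero).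
  Modules are written multiplicatively, as quotient groups of the library are.\<close>

type_synonym ('g, 'k) velt = "((('g, 'k) falg set \<times> 'k vec) \<Rightarrow>\<^sub>0 int) set"

definition verma_free :: "('g, 'k::field) rca \<Rightarrow> ('g, 'k) mrep
    \<Rightarrow> ((('g, 'k) falg set \<times> 'k vec) \<Rightarrow>\<^sub>0 int) monoid" where
  "verma_free D \<tau> = free_Abelian_group (carrier (cherednik_algebra D) \<times> carrier_vec (fst \<tau>))"

definition verma_rels :: "('g, 'k::field) rca \<Rightarrow> ('g, 'k) mrep \<Rightarrow> ('g, 'k) velt" where
  "verma_rels D \<tau> =
    (let H = cherednik_algebra D; T = carrier_vec (fst \<tau>) in
     {frag_of (h \<oplus>\<^bsub>H\<^esub> h', v) - frag_of (h, v) - frag_of (h', v)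
        | h h' v. h \<in> carrier H \<and> h' \<in> carrier H \<and> v \<in> T}
     \<union> {frag_of (h, v + v') - frag_of (h, v) - frag_of (h, v')
        | h v v'. h \<in> carrier H \<and> v \<in> T \<and> v' \<in> T}
     \<union> {frag_of (h \<otimes>\<^bsub>H\<^esub> hcl D (scal a), v) - frag_of (h, a \<cdot>\<^sub>v v)
        | h a v. h \<in> carrier H \<and> v \<in> T}
     \<union> {frag_of (h \<otimes>\<^bsub>H\<^esub> hcl D (gel g), v) - frag_of (h, snd \<tau> g *\<^sub>v v)
        | h g v. h \<in> carrier H \<and> g \<in> carrier (rca_grp D) \<and> v \<in> T}
     \<union> {frag_of (h \<otimes>\<^bsub>H\<^esub> hcl D (yel y), v) - frag_of (h, 0\<^sub>v (fst \<tau>))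
        | h y v. h \<in> carrier H \<and> y \<in> carrier_vec (rca_dim D) \<and> v \<in> T})"

definition verma_ker :: "('g, 'k::field) rca \<Rightarrow> ('g, 'k) mrep \<Rightarrow> ('g, 'k) velt" where
  "verma_ker D \<tau> = generate (verma_free D \<tau>) (verma_rels D \<tau>)"

definition verma :: "('g, 'k::field) rca \<Rightarrow> ('g, 'k) mrep \<Rightarrow> ('g, 'k) velt monoid" where
  "verma D \<tau> = verma_free D \<tau> Mod verma_ker D \<tau>"

definition tens :: "('g, 'k::field) rca \<Rightarrow> ('g, 'k) mrep
    \<Rightarrow> ('g, 'k) falg set \<Rightarrow> 'k vec \<Rightarrow> ('g, 'k) velt" where
  "tens D \<tau> h v = verma_ker D \<tau> #>\<^bsub>verma_free D \<tau>\<^esub> frag_of (h, v)"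

text \<open>\<open>u \<cdot> (h \<otimes> v) = u h \<otimes> v\<close>, on cosets.\<close>

definition verma_act :: "('g, 'k::field) rca \<Rightarrow> ('g, 'k) mrep
    \<Rightarrow> ('g, 'k) falg set \<Rightarrow> ('g, 'k) velt \<Rightarrow> ('g, 'k) velt" where
  "verma_act D \<tau> u m = (\<Union>f\<in>m. verma_ker D \<tau> #>\<^bsub>verma_free D \<tau>\<^esub>
      frag_extend (\<lambda>(h, v). frag_of (u \<otimes>\<^bsub>cherednik_algebra D\<^esub> h, v)) f)"

definition verma_piece :: "('g, 'k::field) rca \<Rightarrow> ('g, 'k) mrep \<Rightarrow> int \<Rightarrow> ('g, 'k) velt set" where
  "verma_piece D \<tau> i =
     generate (verma D \<tau>) {tens D \<tau> h v | h v. h \<in> H_piece D i \<and> v \<in> carrier_vec (fst \<tau>)}"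


section \<open>The contravariant form\<close>

definition linear_forms :: "('g, 'k::field) rca \<Rightarrow> ('g, 'k) mrep \<Rightarrow> (('g, 'k) velt \<Rightarrow> 'k) set" where
  "linear_forms D \<tau> = {f \<in> extensional (carrier (verma D \<tau>)).
     (\<forall>m\<in>carrier (verma D \<tau>). \<forall>m'\<in>carrier (verma D \<tau>). f (m \<otimes>\<^bsub>verma D \<tau>\<^esub> m') = f m + f m') \<and>
     (\<forall>a. \<forall>m\<in>carrier (verma D \<tau>). f (verma_act D \<tau> (hcl D (scal a)) m) = a * f m)}"

text \<open>\<open>(M\<^sub>i)\<^sup>*\<close>, each form being extended by zero to the other graded pieces of the Verma module,
  and the restricted dual, which is the sum of these.\<close>

definition restricted_dual_piece ::
    "('g, 'k::field) rca \<Rightarrow> ('g, 'k) mrep \<Rightarrow> int \<Rightarrow> (('g, 'k) velt \<Rightarrow> 'k) set" where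
  "restricted_dual_piece D \<tau> i =
     {f \<in> linear_forms D \<tau>. \<forall>j. j \<noteq> i \<longrightarrow> (\<forall>m\<in>verma_piece D \<tau> j. f m = 0)}"

definition restricted_dual ::
    "('g, 'k::field) rca \<Rightarrow> ('g, 'k) mrep \<Rightarrow> (('g, 'k) velt \<Rightarrow> 'k) set" where
  "restricted_dual D \<tau> =
     {f \<in> linear_forms D \<tau>. finite {i. \<exists>m\<in>verma_piece D \<tau> i. f m \<noteq> 0}}"

text \<open>The anti-isomorphism from \<open>H\<^sub>t\<^sub>,\<^sub>c(G, h)\<close> to \<open>H\<^sub>t\<^sub>,\<^sub>c\<^sub>'(G, h\<^sup>*)\<close>. It is the identity on \<open>h\<close> and
  \<open>h\<^sup>*\<close>; but in the algebra of \<open>h\<^sup>*\<close> the generators \<open>GX i\<close> span \<open>(h\<^sup>*)\<^sup>* = h\<close> and the generators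
  \<open>GY i\<close> span \<open>h\<^sup>*\<close>, whence the exchange of names.\<close>

fun opp_gen :: "('g, 'b) monoid_scheme \<Rightarrow> 'g gen \<Rightarrow> 'g gen" where
  "opp_gen G (GG g) = GG (inv\<^bsub>G\<^esub> g)"
| "opp_gen G (GX i) = GY i"
| "opp_gen G (GY i) = GX i"

definition opp_free :: "('g, 'b) monoid_scheme \<Rightarrow> ('g, 'k::field) falg \<Rightarrow> ('g, 'k) falg" where
  "opp_free G a = (\<Sum>w\<in>Poly_Mapping.keys a.
     Poly_Mapping.single (Word (rev (map (opp_gen G) (letters w)))) (Poly_Mapping.lookup a w))"

definition opp_H :: "('g, 'k::field) rca \<Rightarrow> ('g, 'k) falg set \<Rightarrow> ('g, 'k) falg set" where
  "opp_H D u = (\<Union>a\<in>u. hcl (dual_rca D) (opp_free (rca_grp D) a))"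

abbreviation dual_verma :: "('g, 'k::field) rca \<Rightarrow> ('g, 'k) mrep \<Rightarrow> ('g, 'k) velt monoid" where
  "dual_verma D \<tau> \<equiv> verma (dual_rca D) (dual_rep (rca_grp D) \<tau>)"

text \<open>The action of \<open>H\<^sub>t\<^sub>,\<^sub>c(G, h)\<close> on the restricted dual of \<open>M\<^sub>t\<^sub>,\<^sub>c\<^sub>'(G, h\<^sup>*, \<tau>\<^sup>*)\<close>.\<close>

definition dagger_act :: "('g, 'k::field) rca \<Rightarrow> ('g, 'k) mrep \<Rightarrow> ('g, 'k) falg set
    \<Rightarrow> (('g, 'k) velt \<Rightarrow> 'k) \<Rightarrow> ('g, 'k) velt \<Rightarrow> 'k" where
  "dagger_act D \<tau> u f = (\<lambda>m\<in>carrier (dual_verma D \<tau>).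
     f (verma_act (dual_rca D) (dual_rep (rca_grp D) \<tau>) (opp_H D u) m))"

text \<open>\<open>H\<close>-module homomorphisms \<open>M\<^sub>t\<^sub>,\<^sub>c(G, h, \<tau>) \<rightarrow> M\<^sub>t\<^sub>,\<^sub>c\<^sub>'(G, h\<^sup>*, \<tau>\<^sup>*)\<^sup>\<dagger>\<close> that send \<open>\<tau>\<close> in degree \<open>0\<close>
  identically to \<open>(\<tau>\<^sup>*)\<^sup>* = \<tau>\<close> in degree \<open>0\<close>.\<close>

definition is_contravariant_hom :: "('g, 'k::field) rca \<Rightarrow> ('g, 'k) mrep
    \<Rightarrow> (('g, 'k) velt \<Rightarrow> ('g, 'k) velt \<Rightarrow> 'k) \<Rightarrow> bool" where
  "is_contravariant_hom D \<tau> \<phi> \<longleftrightarrow>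
    (let M = verma D \<tau>; D' = dual_rca D; \<tau>' = dual_rep (rca_grp D) \<tau>; H' = cherednik_algebra D' in
     \<phi> \<in> carrier M \<rightarrow>\<^sub>E restricted_dual D' \<tau>' \<and>
     (\<forall>m\<in>carrier M. \<forall>m'\<in>carrier M.
        \<phi> (m \<otimes>\<^bsub>M\<^esub> m') = (\<lambda>x\<in>carrier (verma D' \<tau>'). \<phi> m x + \<phi> m' x)) \<and>
     (\<forall>u\<in>carrier (cherednik_algebra D). \<forall>m\<in>carrier M.
        \<phi> (verma_act D \<tau> u m) = dagger_act D \<tau> u (\<phi> m)) \<and>
     (\<forall>v\<in>carrier_vec (fst \<tau>).
        \<phi> (tens D \<tau> \<one>\<^bsub>cherednik_algebra D\<^esub> v) \<in> restricted_dual_piece D' \<tau>' 0 \<and>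
        (\<forall>w\<in>carrier_vec (fst \<tau>).
           \<phi> (tens D \<tau> \<one>\<^bsub>cherednik_algebra D\<^esub> v) (tens D' \<tau>' \<one>\<^bsub>H'\<^esub> w) = v \<bullet> w)))"

definition contravariant_hom :: "('g, 'k::field) rca \<Rightarrow> ('g, 'k) mrep
    \<Rightarrow> ('g, 'k) velt \<Rightarrow> ('g, 'k) velt \<Rightarrow> 'k" where
  "contravariant_hom D \<tau> = (THE \<phi>. is_contravariant_hom D \<tau> \<phi>)"

definition ker_B :: "('g, 'k::field) rca \<Rightarrow> ('g, 'k) mrep \<Rightarrow> ('g, 'k) velt set" where
  "ker_B D \<tau> = {m \<in> carrier (verma D \<tau>).
     \<forall>m'\<in>carrier (dual_verma D \<tau>). contravariant_hom D \<tau> m m' = 0}"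

definition L_module :: "('g, 'k::field) rca \<Rightarrow> ('g, 'k) mrep \<Rightarrow> ('g, 'k) velt set monoid" where
  "L_module D \<tau> = verma D \<tau> Mod ker_B D \<tau>"

definition L_act :: "('g, 'k::field) rca \<Rightarrow> ('g, 'k) mrep
    \<Rightarrow> ('g, 'k) falg set \<Rightarrow> ('g, 'k) velt set \<Rightarrow> ('g, 'k) velt set" where
  "L_act D \<tau> u C = (\<Union>m\<in>C. ker_B D \<tau> #>\<^bsub>verma D \<tau>\<^esub> verma_act D \<tau> u m)"


section \<open>The Grothendieck group of finite-dimensional representations\<close>

definition short_exact :: "('g, 'b) monoid_scheme
    \<Rightarrow> ('g, 'k::field) mrep \<Rightarrow> ('g, 'k) mrep \<Rightarrow> ('g, 'k) mrep \<Rightarrow> bool" where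
  "short_exact G U V W \<longleftrightarrow>
    (\<exists>A\<in>carrier_mat (fst V) (fst U). \<exists>B\<in>carrier_mat (fst W) (fst V).
       (\<forall>g\<in>carrier G. snd V g * A = A * snd U g) \<and>
       (\<forall>g\<in>carrier G. snd W g * B = B * snd V g) \<and>
       inj_on (\<lambda>u. A *\<^sub>v u) (carrier_vec (fst U)) \<and>
       (\<lambda>u. A *\<^sub>v u) ` carrier_vec (fst U) = {v \<in> carrier_vec (fst V). B *\<^sub>v v = 0\<^sub>v (fst W)} \<and>
       (\<lambda>v. B *\<^sub>v v) ` carrier_vec (fst V) = carrier_vec (fst W))"

definition K0_free :: "('g, 'b) monoid_scheme \<Rightarrow> (('g, 'k::field) mrep \<Rightarrow>\<^sub>0 int) monoid" where
  "K0_free G = free_Abelian_group {V. is_rep G V}"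

definition K0_rel :: "('g, 'b) monoid_scheme \<Rightarrow> (('g, 'k::field) mrep \<Rightarrow>\<^sub>0 int) set" where
  "K0_rel G = generate (K0_free G)
     {frag_of V - frag_of U - frag_of W
       | U V W. is_rep G U \<and> is_rep G V \<and> is_rep G W \<and> short_exact G U V W}"

definition K0 :: "('g, 'b) monoid_scheme \<Rightarrow> (('g, 'k::field) mrep \<Rightarrow>\<^sub>0 int) set monoid" where
  "K0 G = K0_free G Mod K0_rel G"

definition K0_class ::
    "('g, 'b) monoid_scheme \<Rightarrow> ('g, 'k::field) mrep \<Rightarrow> (('g, 'k) mrep \<Rightarrow>\<^sub>0 int) set" where
  "K0_class G V = K0_rel G #>\<^bsub>K0_free G\<^esub> frag_of V"

text \<open>Representations on arbitrary vector spaces are given a class through their isomorphic matrix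
  representations.\<close>

record ('g, 'k, 'v) grep =
  rep_space :: "'v set"
  rep_plus :: "'v \<Rightarrow> 'v \<Rightarrow> 'v"
  rep_scale :: "'k \<Rightarrow> 'v \<Rightarrow> 'v"
  rep_act :: "'g \<Rightarrow> 'v \<Rightarrow> 'v"

definition is_linear_iso :: "nat \<Rightarrow> ('g, 'k::field, 'v) grep \<Rightarrow> ('k vec \<Rightarrow> 'v) \<Rightarrow> bool" where
  "is_linear_iso d V T \<longleftrightarrow>
     bij_betw T (carrier_vec d) (rep_space V) \<and>
     (\<forall>u\<in>carrier_vec d. \<forall>v\<in>carrier_vec d. T (u + v) = rep_plus V (T u) (T v)) \<and>
     (\<forall>a. \<forall>v\<in>carrier_vec d. T (a \<cdot>\<^sub>v v) = rep_scale V a (T v))"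

definition isomorphic_rep :: "('g, 'b) monoid_scheme
    \<Rightarrow> ('g, 'k::field) mrep \<Rightarrow> ('g, 'k, 'v) grep \<Rightarrow> bool" where
  "isomorphic_rep G W V \<longleftrightarrow> (\<exists>T. is_linear_iso (fst W) V T \<and>
     (\<forall>g\<in>carrier G. \<forall>v\<in>carrier_vec (fst W). T (snd W g *\<^sub>v v) = rep_act V g (T v)))"

text \<open>A union of equal cosets. It is empty, hence not an element of \<open>K\<^sub>0(G)\<close>, if \<open>V\<close> is not a
  finite-dimensional representation.\<close>

definition rep_class :: "('g, 'b) monoid_scheme
    \<Rightarrow> ('g, 'k::field, 'v) grep \<Rightarrow> (('g, 'k) mrep \<Rightarrow>\<^sub>0 int) set" where
  "rep_class G V = (\<Union>W\<in>{W. is_rep G W \<and> isomorphic_rep G W V}. K0_class G W)"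

definition rep_dim :: "('g, 'k::field, 'v) grep \<Rightarrow> nat" where
  "rep_dim V = (THE d. \<exists>T. is_linear_iso d V T)"

text \<open>\<open>S\<^sup>i V\<close> for a representation \<open>V\<close>: homogeneous polynomials of degree \<open>i\<close> in the basis vectors
  of \<open>V\<close>, on which \<open>G\<close> acts by linear substitution.\<close>

definition linear_subst :: "'k::field mat \<Rightarrow> ((nat \<Rightarrow>\<^sub>0 nat) \<Rightarrow>\<^sub>0 'k) \<Rightarrow> ((nat \<Rightarrow>\<^sub>0 nat) \<Rightarrow>\<^sub>0 'k)" where
  "linear_subst A f = (\<Sum>e\<in>Poly_Mapping.keys f.
     Poly_Mapping.single 0 (Poly_Mapping.lookup f e) *
     (\<Prod>j\<in>Poly_Mapping.keys e.
        (\<Sum>l<dim_row A. Poly_Mapping.single (Poly_Mapping.single l 1) (A $$ (l, j)))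
          ^ Poly_Mapping.lookup e j))"

definition sym_power :: "('g, 'k::field) mrep \<Rightarrow> nat \<Rightarrow> ('g, 'k, (nat \<Rightarrow>\<^sub>0 nat) \<Rightarrow>\<^sub>0 'k) grep" where
  "sym_power V i = \<lparr>
     rep_space = {f. \<forall>e\<in>Poly_Mapping.keys f. Poly_Mapping.keys e \<subseteq> {..<fst V} \<and>
                       (\<Sum>j\<in>Poly_Mapping.keys e. Poly_Mapping.lookup e j) = i},
     rep_plus = (+),
     rep_scale = (\<lambda>a f. Poly_Mapping.single 0 a * f),
     rep_act = (\<lambda>g. linear_subst (snd V g))\<rparr>"


section \<open>Characters and Hilbert series\<close>

definition L_piece :: "('g, 'k::field) rca \<Rightarrow> ('g, 'k) mrep \<Rightarrow> int
    \<Rightarrow> ('g, 'k, ('g, 'k) velt set) grep" where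
  "L_piece D \<tau> i = \<lparr>
     rep_space = (\<lambda>m. ker_B D \<tau> #>\<^bsub>verma D \<tau>\<^esub> m) ` verma_piece D \<tau> i,
     rep_plus = monoid.mult (L_module D \<tau>),
     rep_scale = (\<lambda>a. L_act D \<tau> (hcl D (scal a))),
     rep_act = (\<lambda>g. L_act D \<tau> (hcl D (gel g)))\<rparr>"

text \<open>Formal series in \<open>z\<close> are given by their coefficient functions on the integers.\<close>

definition character_L ::
    "('g, 'k::field) rca \<Rightarrow> ('g, 'k) mrep \<Rightarrow> int \<Rightarrow> (('g, 'k) mrep \<Rightarrow>\<^sub>0 int) set" where
  "character_L D \<tau> = (\<lambda>i. rep_class (rca_grp D) (L_piece D \<tau> i))"

definition hilbert_L :: "('g, 'k::field) rca \<Rightarrow> ('g, 'k) mrep \<Rightarrow> int \<Rightarrow> nat" where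
  "hilbert_L D \<tau> = (\<lambda>i. rep_dim (L_piece D \<tau> i))"

text \<open>The polynomial \<open>xs ! 0 + xs ! 1 z + xs ! 2 z\<^sup>2 + \<dots>\<close> with coefficients in an additive group with
  neutral element \<open>e\<close>.\<close>

definition poly_series :: "'a \<Rightarrow> 'a list \<Rightarrow> int \<Rightarrow> 'a" where
  "poly_series e xs i = (if 0 \<le> i \<and> i < int (length xs) then xs ! nat i else e)"


section \<open>The general linear group over a finite field\<close>

text \<open>For \<open>q\<close> a power of the characteristic of the algebraically closed field \<open>k\<close>, the subfield with
  \<open>q\<close> elements consists of the roots of \<open>z\<^sup>q - z\<close>.\<close>

definition GL_Fq :: "nat \<Rightarrow> nat \<Rightarrow> 'k::field mat monoid" where
  "GL_Fq n q = \<lparr>carrier = {A \<in> carrier_mat n n. invertible_mat A \<and>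
       (\<forall>i<n. \<forall>j<n. (A $$ (i, j)) ^ q = A $$ (i, j))},
     monoid.mult = (*), one = 1\<^sub>m n\<rparr>"

definition GL_rca :: "nat \<Rightarrow> nat \<Rightarrow> 'k \<Rightarrow> ('k mat \<Rightarrow> 'k) \<Rightarrow> ('k::field mat, 'k) rca" where
  "GL_rca n q t c = \<lparr>rca_grp = GL_Fq n q, rca_dim = n, rca_rep = (\<lambda>g. g), rca_t = t, rca_c = c\<rparr>"

definition GL_std :: "nat \<Rightarrow> ('k::field mat, 'k) mrep" where
  "GL_std n = (n, \<lambda>g. g)"

end

theory Submission
  imports Defs "HOL-Library.Product_Plus"
begin

text \<open>The module \<open>L(triv)\<close> is the quotient of the Verma module \<open>M(triv)\<close> by \<open>ker B\<close>. The kernel is found by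
  guessing the quotient. Let \<open>V\<close> be a graded module over the Cherednik algebra that is generated by
  a vector \<open>v0\<close> of degree \<open>0\<close> which \<open>G\<close> fixes and \<open>h\<close> annihilates; by the universal property of the
  tensor product, \<open>M(triv)\<close> maps onto \<open>V\<close>. Let \<open>V'\<close> be a space paired nondegenerately with \<open>V\<close>, on which
  the generators of the algebra of \<open>h\<^sup>*\<close> act by the adjoints of the opposite generators. Nondegeneracy
  forces the defining relations to hold on \<open>V'\<close>, so the Verma module of \<open>h\<^sup>*\<close> maps onto \<open>V'\<close>, and the
  pairing pulls back to a contravariant form. There is only one such form
  (\<open>contravariant_hom_unique\<close>): it is determined on \<open>1 \<otimes> \<tau>\<close>, because Verma modules are spanned by
  monomials in \<open>h\<^sup>*\<close> applied to \<open>\<tau>\<close> (\<open>verma_spanned\<close>). Therefore \<open>ker B\<close> is the kernel of \<open>M(triv) \<rightarrow> V\<close>, and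
  \<open>L(triv)\<close> is \<open>V\<close> (\<open>L_piece_isomorphic\<close>).

  Suppose first that \<open>V\<close> is the ground field with \<open>h\<close> and \<open>h\<^sup>*\<close> acting by zero. For \<open>t = 0\<close> the relations
  ask only that \<open>\<Sum>\<^sub>s c\<^sub>s (1 - s)\<close> be zero. The sum over all reflections splits into
  parts that are permuted by conjugation with transvections. If such a permutation preserves the summand
  but raises some other function on the part by \<open>1\<close>, then that part of the sum vanishes
  (\<open>sum_shift_zero\<close>); if it multiplies the summand by a scalar \<open>\<mu> \<noteq> 1\<close>, the part vanishes too. The first argument
  always applies to one part; on the other it needs three distinct indices, and the second argument needs a
  scalar of \<open>F\<^sub>q\<close> other than \<open>0\<close> and \<open>1\<close>, so together they cover every pair \<open>(q, n)\<close> except \<open>(2, 2)\<close> (\<open>sum_entries\<close>).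

  For \<open>(q, n) = (2, 2)\<close> and \<open>c \<noteq> 0\<close> the module is the coinvariant algebra
  \<open>k[x, y] / (x\<^sup>2 + x y + y\<^sup>2, x\<^sup>2 y + x y\<^sup>2)\<close>, whose ideal is generated by the two Dickson invariants. With
  respect to the basis \<open>1, x, y, x\<^sup>2, y\<^sup>2, x\<^sup>2 y\<close> the Dunkl operators are \<open>c\<close> times the transposes of the
  multiplications by \<open>x\<close> and \<open>y\<close>, so the dot product is a pairing of the required kind. The
  graded pieces are \<open>triv\<close>, \<open>h\<^sup>*\<close>, \<open>h\<^sup>*\<close>, \<open>triv\<close>: matrix entries in \<open>F\<^sub>2\<close> are equal to their squares, whence
  \<open>x\<^sup>2\<close> and \<open>y\<^sup>2\<close> transform as \<open>x\<close> and \<open>y\<close> do. Block triangular forms of \<open>S\<^sup>2 h\<^sup>*\<close> and \<open>S\<^sup>3 h\<^sup>*\<close> show that their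
  classes are \<open>[h\<^sup>*] + [triv]\<close> and \<open>[h\<^sup>*] + 2 [triv]\<close>, which gives the characters in the stated form.\<close>

section \<open>The free algebra and its quotient\<close>

lemma letters_plus [simp]: "letters (u + v) = letters u @ letters v"
  by (simp add: plus_word_def)

lemma letters_zero [simp]: "letters 0 = []"
  by (simp add: zero_word_def)

lemma poly_mapping_sum_singles: "(\<Sum>w\<in>Poly_Mapping.keys a. Poly_Mapping.single w (Poly_Mapping.lookup a w)) = a"
  by (rule poly_mapping_eqI)
    (auto simp: lookup_sum lookup_single when_def in_keys_iff)

lemma poly_mapping_induct_on [consumes 1, case_names zero single add]:
  fixes a :: "'a \<Rightarrow>\<^sub>0 'b::comm_monoid_add"
  assumes "Poly_Mapping.keys a \<subseteq> S" and "P 0" and "\<And>w c. w \<in> S \<Longrightarrow> P (Poly_Mapping.single w c)"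
    and "\<And>a b. P a \<Longrightarrow> P b \<Longrightarrow> P (a + b)"
  shows "P a"
proof -
  have "P (\<Sum>w\<in>W. Poly_Mapping.single w (Poly_Mapping.lookup a w))" if "finite W" "W \<subseteq> S" for W
    using that by (induction W) (auto intro: assms)
  from this[of "Poly_Mapping.keys a"] assms(1) show ?thesis
    by (simp add: poly_mapping_sum_singles)
qed

lemma scal_commute: "scal c * a = a * scal c"
  by (rule poly_mapping_induct_on[of a UNIV])
    (auto simp: distrib_left distrib_right scal_def mult_single mult.commute)

lemma free_alg_simps [simp]:
  "a \<otimes>\<^bsub>free_alg D\<^esub> b = a * b" "\<one>\<^bsub>free_alg D\<^esub> = 1" "\<zero>\<^bsub>free_alg D\<^esub> = 0" "a \<oplus>\<^bsub>free_alg D\<^esub> b = a + b"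
  by (simp_all add: free_alg_def)

lemma free_alg_carrier:
  "a \<in> carrier (free_alg D) \<longleftrightarrow> Poly_Mapping.keys a \<subseteq> {w. set (letters w) \<subseteq> gens D}"
  by (auto simp: free_alg_def)

lemma free_alg_closed:
  "1 \<in> carrier (free_alg D)" "0 \<in> carrier (free_alg D)"
  "a \<in> carrier (free_alg D) \<Longrightarrow> b \<in> carrier (free_alg D) \<Longrightarrow> a + b \<in> carrier (free_alg D)"
  "a \<in> carrier (free_alg D) \<Longrightarrow> b \<in> carrier (free_alg D) \<Longrightarrow> a - b \<in> carrier (free_alg D)"
  "a \<in> carrier (free_alg D) \<Longrightarrow> b \<in> carrier (free_alg D) \<Longrightarrow> a * b \<in> carrier (free_alg D)"
  "a \<in> carrier (free_alg D) \<Longrightarrow> - a \<in> carrier (free_alg D)"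
  "scal c \<in> carrier (free_alg D)"
  "g \<in> carrier (rca_grp D) \<Longrightarrow> gel g \<in> carrier (free_alg D)"
  "set (letters w) \<subseteq> gens D \<Longrightarrow> Poly_Mapping.single w c \<in> carrier (free_alg D)"
proof goal_cases
  case 3 then show ?case using keys_add[of a b] by (force simp: free_alg_carrier)
next
  case 4 then show ?case using keys_diff[of a b] by (force simp: free_alg_carrier)
next
  case 5 then show ?case using keys_mult[of a b] by (force simp: free_alg_carrier)
qed (auto simp: free_alg_carrier scal_def gel_def gens_def)

lemma free_alg_closed_sum:
  "(\<And>i. i \<in> J \<Longrightarrow> f i \<in> carrier (free_alg D)) \<Longrightarrow> sum f J \<in> carrier (free_alg D)"
  by (induction J rule: infinite_finite_induct) (auto intro: free_alg_closed)

lemma free_alg_closed_xel: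
  assumes "v \<in> carrier_vec (rca_dim D)"
  shows "xel v \<in> carrier (free_alg D)" "yel v \<in> carrier (free_alg D)"
  unfolding xel_def yel_def using assms
  by (auto intro!: free_alg_closed_sum free_alg_closed simp: gens_def)

lemma ring_free_alg: "ring (free_alg D)"
proof (rule ringI)
  show "abelian_group (free_alg D)"
  proof (rule abelian_groupI)
    fix x assume "x \<in> carrier (free_alg D)"
    then show "\<exists>y\<in>carrier (free_alg D). y \<oplus>\<^bsub>free_alg D\<^esub> x = \<zero>\<^bsub>free_alg D\<^esub>"
      by (intro bexI[of _ "-x"]) (auto intro: free_alg_closed)
  qed (auto intro: free_alg_closed simp: algebra_simps)
  show "Group.monoid (free_alg D)"
    by (rule monoidI) (auto intro: free_alg_closed simp: algebra_simps)
qed (auto simp: algebra_simps)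

lemma minus_free_alg:
  assumes "a \<in> carrier (free_alg D)"
  shows "\<ominus>\<^bsub>free_alg D\<^esub> a = - a"
proof -
  interpret ring "free_alg D" by (rule ring_free_alg)
  show ?thesis using assms
    by (intro minus_equality) (auto intro: free_alg_closed)
qed

text \<open>Ideals generated in a ring behave well only for subsets of its carrier, so the relations must be written
  in the generators of \<open>gens D\<close> alone.\<close>

lemma rels_closed:
  assumes "group (rca_grp D)" "is_rep (rca_grp D) (rca_dim D, rca_rep D)"
  shows "smash_rels D \<union> cherednik_rels D \<subseteq> carrier (free_alg D)"
proof -
  interpret group "rca_grp D" by fact
  have R: "rca_rep D g \<in> carrier_mat (rca_dim D) (rca_dim D)" if "g \<in> carrier (rca_grp D)" for g
    using assms(2) that by (auto simp: is_rep_def)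
  have C: "contra (rca_grp D) (rca_rep D) g \<in> carrier_mat (rca_dim D) (rca_dim D)"
    if "g \<in> carrier (rca_grp D)" for g
    using R[OF inv_closed[OF that]] by (auto simp: contra_def)
  have S: "reflections D \<subseteq> carrier (rca_grp D)" by (auto simp: reflections_def)
  show ?thesis
    unfolding smash_rels_def cherednik_rels_def Let_def using S
    by (auto intro!: free_alg_closed free_alg_closed_sum free_alg_closed_xel mult_mat_vec_carrier R C)
qed

subsection \<open>Words acting by linear operators\<close>

text \<open>An assignment of operators to all possible letters makes the free algebra act without
  reference to a group or a dimension; the same carrier then serves both an algebra and its dual.\<close>

locale linear_operators = vector_space scale
  for scale :: "'k::field \<Rightarrow> 'v::ab_group_add \<Rightarrow> 'v" +
  fixes opr :: "'g gen \<Rightarrow> 'v \<Rightarrow> 'v"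
  assumes opr_add: "opr l (x + y) = opr l x + opr l y"
    and opr_scale: "opr l (scale r x) = scale r (opr l x)"
begin

definition word_act :: "'g gen word \<Rightarrow> 'v \<Rightarrow> 'v" where
  "word_act w = foldr opr (letters w)"

definition alg_act :: "('g, 'k) falg \<Rightarrow> 'v \<Rightarrow> 'v" where
  "alg_act a x = (\<Sum>w\<in>Poly_Mapping.keys a. scale (Poly_Mapping.lookup a w) (word_act w x))"

lemma word_act_add: "word_act w (x + y) = word_act w x + word_act w y"
proof -
  have "foldr opr ls (x + y) = foldr opr ls x + foldr opr ls y" for ls
    by (induction ls) (auto simp: opr_add)
  then show ?thesis by (simp add: word_act_def)
qed

lemma word_act_scale: "word_act w (scale r x) = scale r (word_act w x)"
proof -
  have "foldr opr ls (scale r x) = scale r (foldr opr ls x)" for ls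
    by (induction ls) (auto simp: opr_scale)
  then show ?thesis by (simp add: word_act_def)
qed

lemma word_act_plus [simp]: "word_act (u + w) x = word_act u (word_act w x)"
  by (simp add: word_act_def)

lemma word_act_zero [simp]: "word_act 0 x = x"
  by (simp add: word_act_def)

lemma alg_act_superset:
  assumes "finite W" "Poly_Mapping.keys a \<subseteq> W"
  shows "alg_act a x = (\<Sum>w\<in>W. scale (Poly_Mapping.lookup a w) (word_act w x))"
  unfolding alg_act_def using assms
  by (intro sum.mono_neutral_left) (auto simp: in_keys_iff)

lemma alg_act_single [simp]: "alg_act (Poly_Mapping.single w c) x = scale c (word_act w x)"
  by (subst alg_act_superset[of "{w}"]) auto

lemma alg_act_zero [simp]: "alg_act 0 x = 0"
  by (simp add: alg_act_def)

lemma alg_act_add [simp]: "alg_act (a + b) x = alg_act a x + alg_act b x"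
proof -
  let ?W = "Poly_Mapping.keys a \<union> Poly_Mapping.keys b"
  show ?thesis
    using keys_add[of a b]
    by (simp add: alg_act_superset[of ?W] lookup_add scale_left_distrib sum.distrib)
qed

lemma alg_act_minus [simp]: "alg_act (- a) x = - alg_act a x"
  using alg_act_add[of a "-a" x] by (simp add: eq_neg_iff_add_eq_0 add.commute)

lemma alg_act_diff [simp]: "alg_act (a - b) x = alg_act a x - alg_act b x"
  using alg_act_add[of a "-b" x] by simp

lemma alg_act_sum [simp]: "alg_act (sum f J) x = (\<Sum>i\<in>J. alg_act (f i) x)"
  by (induction J rule: infinite_finite_induct) auto

lemma alg_act_add_right [simp]: "alg_act a (x + y) = alg_act a x + alg_act a y"
  by (simp add: alg_act_def word_act_add scale_right_distrib sum.distrib)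

lemma alg_act_scale_right [simp]: "alg_act a (scale r x) = scale r (alg_act a x)"
  by (simp add: alg_act_def word_act_scale scale_sum_right mult.commute)

lemma alg_act_zero_right [simp]: "alg_act a 0 = 0"
  using alg_act_add_right[of a 0 0] by simp

lemma alg_act_mult [simp]: "alg_act (a * b) x = alg_act a (alg_act b x)"
proof (rule poly_mapping_induct_on[of a UNIV])
  fix w c
  show "alg_act (Poly_Mapping.single w c * b) x = alg_act (Poly_Mapping.single w c) (alg_act b x)"
  proof (rule poly_mapping_induct_on[of b UNIV])
    fix w' c'
    show "alg_act (Poly_Mapping.single w c * Poly_Mapping.single w' c') x =
        alg_act (Poly_Mapping.single w c) (alg_act (Poly_Mapping.single w' c') x)"
      by (simp add: mult_single word_act_scale)
  qed (auto simp: distrib_left word_act_add scale_right_distrib)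
qed (auto simp: distrib_right)

lemma alg_act_one [simp]: "alg_act 1 x = x"
  by (simp flip: single_one)

lemma alg_act_scal [simp]: "alg_act (scal c) x = scale c x"
  by (simp add: scal_def)

lemma alg_act_gel [simp]: "alg_act (gel g) x = opr (GG g) x"
  by (simp add: gel_def word_act_def)

lemma alg_act_xel [simp]: "alg_act (xel v) x = (\<Sum>i<dim_vec v. scale (v $ i) (opr (GX i) x))"
  by (simp add: xel_def word_act_def)

lemma alg_act_yel [simp]: "alg_act (yel v) x = (\<Sum>i<dim_vec v. scale (v $ i) (opr (GY i) x))"
  by (simp add: yel_def word_act_def)

end

subsection \<open>The presented algebra\<close>

locale rational_cherednik =
  fixes D :: "('g, 'k::field) rca"
  assumes group_D: "group (rca_grp D)"
    and rep_D: "is_rep (rca_grp D) (rca_dim D, rca_rep D)"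
begin

abbreviation "F \<equiv> free_alg D"
abbreviation "H \<equiv> cherednik_algebra D"

lemma ideal_I: "ideal (cherednik_ideal D) F"
  unfolding cherednik_ideal_def
  by (rule ring.genideal_ideal[OF ring_free_alg rels_closed[OF group_D rep_D]])

lemma rels_in_I: "r \<in> smash_rels D \<union> cherednik_rels D \<Longrightarrow> r \<in> cherednik_ideal D"
  unfolding cherednik_ideal_def
  using ring.genideal_self[OF ring_free_alg rels_closed[OF group_D rep_D]] by blast

lemma I_minimal:
  assumes "ideal J F" "smash_rels D \<union> cherednik_rels D \<subseteq> J"
  shows "cherednik_ideal D \<subseteq> J"
  unfolding cherednik_ideal_def by (rule ring.genideal_minimal[OF ring_free_alg assms])

lemma ring_H: "ring H"
  unfolding cherednik_algebra_def by (rule ideal.quotient_is_ring[OF ideal_I])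

lemma hcl_hom: "hcl D \<in> Ring.ring_hom F H"
  unfolding cherednik_algebra_def hcl_def[abs_def] by (rule ideal.rcos_ring_hom[OF ideal_I])

lemma hcl_closed: "a \<in> carrier F \<Longrightarrow> hcl D a \<in> carrier H"
  using hcl_hom by (rule ring_hom_closed)

lemma hcl_add: "a \<in> carrier F \<Longrightarrow> b \<in> carrier F \<Longrightarrow> hcl D (a + b) = hcl D a \<oplus>\<^bsub>H\<^esub> hcl D b"
  using ring_hom_add[OF hcl_hom] by simp

lemma hcl_mult: "a \<in> carrier F \<Longrightarrow> b \<in> carrier F \<Longrightarrow> hcl D (a * b) = hcl D a \<otimes>\<^bsub>H\<^esub> hcl D b"
  using ring_hom_mult[OF hcl_hom] by simp

lemma hcl_one: "hcl D 1 = \<one>\<^bsub>H\<^esub>"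
  using ring_hom_one[OF hcl_hom] by simp

lemma carrier_H: "carrier H = hcl D ` carrier F"
  by (auto simp: cherednik_algebra_def FactRing_simps hcl_def a_r_coset_def)

lemma carrier_HE:
  assumes "u \<in> carrier H"
  obtains a where "a \<in> carrier F" "u = hcl D a"
  using assms by (auto simp: carrier_H)

lemma I_closed: "a \<in> cherednik_ideal D \<Longrightarrow> a \<in> carrier F"
  using ideal.Icarr[OF ideal_I] .

lemma hcl_eq_set:
  assumes "a \<in> carrier F"
  shows "hcl D a = {b \<in> carrier F. b - a \<in> cherednik_ideal D}"
proof -
  interpret ring F by (rule ring_free_alg)
  interpret ideal "cherednik_ideal D" F by (rule ideal_I)
  have "b \<in> hcl D a \<longleftrightarrow> b \<in> carrier F \<and> b - a \<in> cherednik_ideal D" for b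
  proof
    assume "b \<in> hcl D a"
    then obtain h where "h \<in> cherednik_ideal D" "b = h + a"
      by (auto simp: hcl_def a_r_coset_def')
    then show "b \<in> carrier F \<and> b - a \<in> cherednik_ideal D"
      using assms I_closed by (auto intro: free_alg_closed)
  next
    assume "b \<in> carrier F \<and> b - a \<in> cherednik_ideal D"
    then show "b \<in> hcl D a"
      by (auto simp: hcl_def a_r_coset_def' intro!: bexI[of _ "b - a"])
  qed
  then show ?thesis by auto
qed

lemma I_zero: "0 \<in> cherednik_ideal D"
  and I_add: "a \<in> cherednik_ideal D \<Longrightarrow> b \<in> cherednik_ideal D \<Longrightarrow> a + b \<in> cherednik_ideal D"
  and I_minus: "a \<in> cherednik_ideal D \<Longrightarrow> - a \<in> cherednik_ideal D"
proof -
  interpret ring F by (rule ring_free_alg)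
  interpret ideal "cherednik_ideal D" F by (rule ideal_I)
  show "0 \<in> cherednik_ideal D" using zero_closed by simp
  show "a + b \<in> cherednik_ideal D" if "a \<in> cherednik_ideal D" "b \<in> cherednik_ideal D"
    using a_closed[OF that] by simp
  show "- a \<in> cherednik_ideal D" if "a \<in> cherednik_ideal D"
    using a_inv_closed[OF that] minus_free_alg[OF I_closed[OF that]] by simp
qed

lemma hcl_eq_iff:
  assumes "a \<in> carrier F" "b \<in> carrier F"
  shows "hcl D a = hcl D b \<longleftrightarrow> a - b \<in> cherednik_ideal D"
proof
  have "a \<in> hcl D a" using assms I_zero by (simp add: hcl_eq_set)
  moreover assume "hcl D a = hcl D b"
  ultimately show "a - b \<in> cherednik_ideal D" using assms by (simp add: hcl_eq_set)
next
  assume *: "a - b \<in> cherednik_ideal D"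
  have "c - a \<in> cherednik_ideal D \<longleftrightarrow> c - b \<in> cherednik_ideal D" for c
    using I_add[OF _ *, of "c - a"] I_add[OF _ I_minus[OF *], of "c - b"] by auto
  then show "hcl D a = hcl D b" using assms by (simp add: hcl_eq_set)
qed

end

section \<open>Verma modules\<close>

locale verma_module = rational_cherednik D for D :: "('g, 'k::field) rca" +
  fixes \<tau> :: "('g, 'k) mrep"
  assumes rep_tau: "is_rep (rca_grp D) \<tau>"
begin

abbreviation "T \<equiv> carrier_vec (fst \<tau>)"
abbreviation "Fr \<equiv> verma_free D \<tau>"
abbreviation "K \<equiv> verma_ker D \<tau>"
abbreviation "M \<equiv> verma D \<tau>"

definition cls :: "((('g, 'k) falg set \<times> 'k vec) \<Rightarrow>\<^sub>0 int) \<Rightarrow> ('g, 'k) velt" where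
  "cls f = K #>\<^bsub>Fr\<^esub> f"

lemma tau_closed: "g \<in> carrier (rca_grp D) \<Longrightarrow> v \<in> T \<Longrightarrow> snd \<tau> g *\<^sub>v v \<in> T"
  using rep_tau by (auto simp: is_rep_def intro!: mult_mat_vec_carrier)

lemma comm_group_Fr: "comm_group Fr"
  by (simp add: verma_free_def abelian_free_Abelian_group)

lemma group_Fr: "group Fr"
  by (simp add: verma_free_def)

lemma Fr_simps: "f \<in> carrier Fr \<longleftrightarrow> Poly_Mapping.keys f \<subseteq> carrier H \<times> T"
  "\<one>\<^bsub>Fr\<^esub> = 0" "f \<otimes>\<^bsub>Fr\<^esub> f' = f + f'"
  by (simp_all add: verma_free_def)

lemma inv_Fr: "f \<in> carrier Fr \<Longrightarrow> inv\<^bsub>Fr\<^esub> f = - f"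
  by (simp add: verma_free_def)

lemma Fr_closed:
  "0 \<in> carrier Fr" "f \<in> carrier Fr \<Longrightarrow> f' \<in> carrier Fr \<Longrightarrow> f + f' \<in> carrier Fr"
  "f \<in> carrier Fr \<Longrightarrow> f' \<in> carrier Fr \<Longrightarrow> f - f' \<in> carrier Fr"
  "f \<in> carrier Fr \<Longrightarrow> - f \<in> carrier Fr"
  "h \<in> carrier H \<Longrightarrow> v \<in> T \<Longrightarrow> frag_of (h, v) \<in> carrier Fr"
  using keys_add[of f f'] keys_diff[of f f'] by (auto simp: Fr_simps)

lemma H_closed:
  "h \<in> carrier H \<Longrightarrow> h' \<in> carrier H \<Longrightarrow> h \<oplus>\<^bsub>H\<^esub> h' \<in> carrier H"
  "h \<in> carrier H \<Longrightarrow> h' \<in> carrier H \<Longrightarrow> h \<otimes>\<^bsub>H\<^esub> h' \<in> carrier H"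
  "\<one>\<^bsub>H\<^esub> \<in> carrier H"
  "hcl D (scal c) \<in> carrier H"
  "g \<in> carrier (rca_grp D) \<Longrightarrow> hcl D (gel g) \<in> carrier H"
  "y \<in> carrier_vec (rca_dim D) \<Longrightarrow> hcl D (yel y) \<in> carrier H"
  "y \<in> carrier_vec (rca_dim D) \<Longrightarrow> hcl D (xel y) \<in> carrier H"
proof -
  interpret ring H by (rule ring_H)
  show "h \<in> carrier H \<Longrightarrow> h' \<in> carrier H \<Longrightarrow> h \<oplus>\<^bsub>H\<^esub> h' \<in> carrier H"
    "h \<in> carrier H \<Longrightarrow> h' \<in> carrier H \<Longrightarrow> h \<otimes>\<^bsub>H\<^esub> h' \<in> carrier H"
    "\<one>\<^bsub>H\<^esub> \<in> carrier H" by auto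
qed (auto intro!: hcl_closed free_alg_closed free_alg_closed_xel)

lemma verma_rels_closed: "verma_rels D \<tau> \<subseteq> carrier Fr"
  unfolding verma_rels_def Let_def
  by (auto intro!: Fr_closed H_closed tau_closed)

lemma subgroup_K: "subgroup K Fr"
  unfolding verma_ker_def by (rule group.generate_is_subgroup[OF group_Fr verma_rels_closed])

lemma normal_K: "K \<lhd> Fr"
  by (rule group.normalI[OF group_Fr subgroup_K])
    (auto simp: r_coset_def l_coset_def Fr_simps add.commute)

lemma K_closed: "k \<in> K \<Longrightarrow> k \<in> carrier Fr"
  using subgroup.subset[OF subgroup_K] by auto

lemma K_ops: "0 \<in> K" "k \<in> K \<Longrightarrow> k' \<in> K \<Longrightarrow> k + k' \<in> K" "k \<in> K \<Longrightarrow> - k \<in> K"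
  using subgroup.one_closed[OF subgroup_K] subgroup.m_closed[OF subgroup_K]
    subgroup.m_inv_closed[OF subgroup_K] K_closed by (simp_all add: Fr_simps flip: inv_Fr)

lemma K_rel: "r \<in> verma_rels D \<tau> \<Longrightarrow> r \<in> K"
  unfolding verma_ker_def by (rule generate.incl)

lemma comm_group_M: "comm_group M"
  unfolding verma_def by (rule comm_group.abelian_FactGroup[OF comm_group_Fr subgroup_K])

lemma group_M: "group M"
  using comm_group_M by (simp add: comm_group_def)

lemma carrier_M: "carrier M = cls ` carrier Fr"
  by (simp add: verma_def carrier_FactGroup cls_def[abs_def])

lemma cls_closed: "f \<in> carrier Fr \<Longrightarrow> cls f \<in> carrier M"
  by (simp add: carrier_M)

lemma cls_add: "f \<in> carrier Fr \<Longrightarrow> f' \<in> carrier Fr \<Longrightarrow> cls (f + f') = cls f \<otimes>\<^bsub>M\<^esub> cls f'"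
  using normal.rcos_sum[OF normal_K, of f f'] by (simp add: cls_def verma_def Fr_simps)

lemma cls_zero: "cls 0 = \<one>\<^bsub>M\<^esub>"
  using group.coset_mult_one[OF group_Fr subgroup.subset[OF subgroup_K]]
  by (simp add: cls_def verma_def Fr_simps)

lemma cls_eq_set:
  assumes "f \<in> carrier Fr"
  shows "cls f = {f' \<in> carrier Fr. f' - f \<in> K}"
  unfolding cls_def r_coset_def using assms K_closed
  by (auto simp: Fr_simps(2,3) intro: Fr_closed)

lemma cls_eqI:
  assumes "f \<in> carrier Fr" "f' \<in> carrier Fr" "f - f' \<in> K"
  shows "cls f = cls f'"
proof -
  have "g - f \<in> K \<longleftrightarrow> g - f' \<in> K" for g
    using K_ops(2)[OF _ assms(3), of "g - f"] K_ops(2)[OF _ K_ops(3)[OF assms(3)], of "g - f'"] by auto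
  then show ?thesis using assms by (simp add: cls_eq_set)
qed

lemma tens_cls: "tens D \<tau> h v = cls (frag_of (h, v))"
  by (simp add: tens_def cls_def)

lemma tens_closed: "h \<in> carrier H \<Longrightarrow> v \<in> T \<Longrightarrow> tens D \<tau> h v \<in> carrier M"
  by (simp add: tens_cls cls_closed Fr_closed)

lemma tens_eqI:
  assumes "frag_of (h, v) - frag_of (h', v') \<in> verma_rels D \<tau>"
    "h \<in> carrier H" "v \<in> T" "h' \<in> carrier H" "v' \<in> T"
  shows "tens D \<tau> h v = tens D \<tau> h' v'"
  unfolding tens_cls by (rule cls_eqI) (use assms in \<open>auto intro!: Fr_closed K_rel\<close>)

lemma tens_addI:
  assumes "frag_of (h, v) - frag_of (h', v') - frag_of (h'', v'') \<in> verma_rels D \<tau>"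
    "h \<in> carrier H" "v \<in> T" "h' \<in> carrier H" "v' \<in> T" "h'' \<in> carrier H" "v'' \<in> T"
  shows "tens D \<tau> h v = tens D \<tau> h' v' \<otimes>\<^bsub>M\<^esub> tens D \<tau> h'' v''"
proof -
  have "cls (frag_of (h, v)) = cls (frag_of (h', v') + frag_of (h'', v''))"
    by (rule cls_eqI) (use assms in \<open>auto intro!: Fr_closed K_rel simp: diff_diff_eq\<close>)
  then show ?thesis using assms by (simp add: tens_cls cls_add Fr_closed)
qed

lemma tens_add_left:
  assumes "h \<in> carrier H" "h' \<in> carrier H" "v \<in> T"
  shows "tens D \<tau> (h \<oplus>\<^bsub>H\<^esub> h') v = tens D \<tau> h v \<otimes>\<^bsub>M\<^esub> tens D \<tau> h' v"
  by (rule tens_addI, unfold verma_rels_def Let_def, use assms in blast)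
    (use assms in \<open>auto intro: H_closed\<close>)

lemma tens_add_right:
  assumes "h \<in> carrier H" "v \<in> T" "v' \<in> T"
  shows "tens D \<tau> h (v + v') = tens D \<tau> h v \<otimes>\<^bsub>M\<^esub> tens D \<tau> h v'"
  by (rule tens_addI, unfold verma_rels_def Let_def, use assms in blast)
    (use assms in \<open>auto intro: H_closed\<close>)

lemma tens_scal:
  assumes "h \<in> carrier H" "v \<in> T"
  shows "tens D \<tau> (h \<otimes>\<^bsub>H\<^esub> hcl D (scal a)) v = tens D \<tau> h (a \<cdot>\<^sub>v v)"
  by (rule tens_eqI, unfold verma_rels_def Let_def, use assms in blast)
    (use assms in \<open>auto intro: H_closed\<close>)

lemma tens_gel:
  assumes "h \<in> carrier H" "v \<in> T" "g \<in> carrier (rca_grp D)"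
  shows "tens D \<tau> (h \<otimes>\<^bsub>H\<^esub> hcl D (gel g)) v = tens D \<tau> h (snd \<tau> g *\<^sub>v v)"
  by (rule tens_eqI, unfold verma_rels_def Let_def, use assms in blast)
    (use assms in \<open>auto intro: H_closed tau_closed\<close>)

lemma tens_yel:
  assumes "h \<in> carrier H" "v \<in> T" "y \<in> carrier_vec (rca_dim D)"
  shows "tens D \<tau> (h \<otimes>\<^bsub>H\<^esub> hcl D (yel y)) v = tens D \<tau> h (0\<^sub>v (fst \<tau>))"
  by (rule tens_eqI, unfold verma_rels_def Let_def, use assms in blast)
    (use assms in \<open>auto intro: H_closed\<close>)

lemma tens_zero:
  assumes "h \<in> carrier H"
  shows "tens D \<tau> h (0\<^sub>v (fst \<tau>)) = \<one>\<^bsub>M\<^esub>"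
proof -
  interpret group M by (rule group_M)
  have "tens D \<tau> h (0\<^sub>v (fst \<tau>)) \<otimes>\<^bsub>M\<^esub> tens D \<tau> h (0\<^sub>v (fst \<tau>)) = tens D \<tau> h (0\<^sub>v (fst \<tau>))"
    using tens_add_right[OF assms, of "0\<^sub>v (fst \<tau>)" "0\<^sub>v (fst \<tau>)"] by simp
  then show ?thesis using tens_closed[OF assms, of "0\<^sub>v (fst \<tau>)"] by simp
qed

lemma cls_minus_frag:
  assumes "h \<in> carrier H" "v \<in> T"
  shows "cls (- frag_of (h, v)) = tens D \<tau> h (- v)"
proof -
  interpret group M by (rule group_M)
  have f: "frag_of (h, v) \<in> carrier Fr" using assms by (rule Fr_closed)
  have 1: "cls (- frag_of (h, v)) \<otimes>\<^bsub>M\<^esub> tens D \<tau> h v = \<one>\<^bsub>M\<^esub>"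
    using cls_add[OF Fr_closed(4)[OF f] f] by (simp add: tens_cls cls_zero)
  have "tens D \<tau> h (- v) \<otimes>\<^bsub>M\<^esub> tens D \<tau> h v = tens D \<tau> h (- v + v)"
    using tens_add_right[of h "- v" v] assms by simp
  also have "- v + v = 0\<^sub>v (fst \<tau>)" using assms by auto
  finally have 2: "tens D \<tau> h (- v) \<otimes>\<^bsub>M\<^esub> tens D \<tau> h v = \<one>\<^bsub>M\<^esub>" using assms by (simp add: tens_zero)
  from 1 2 show ?thesis using assms f
    by (metis cls_closed Fr_closed(4) tens_closed inv_equality uminus_carrier_vec)
qed

text \<open>Sums of tensors suffice, without differences, because \<open>- (h \<otimes> v) = h \<otimes> (- v)\<close>.\<close>

lemma verma_induct [consumes 1, case_names tens add]:
  assumes m: "m \<in> carrier M"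
    and tens: "\<And>h v. h \<in> carrier H \<Longrightarrow> v \<in> T \<Longrightarrow> P (tens D \<tau> h v)"
    and add: "\<And>m m'. m \<in> carrier M \<Longrightarrow> m' \<in> carrier M \<Longrightarrow> P m \<Longrightarrow> P m' \<Longrightarrow> P (m \<otimes>\<^bsub>M\<^esub> m')"
  shows "P m"
proof -
  obtain f where f: "f \<in> carrier Fr" "m = cls f" using m by (auto simp: carrier_M)
  have "Poly_Mapping.keys f \<subseteq> carrier H \<times> T" using f by (simp add: Fr_simps)
  then have "P (cls f) \<and> P (cls (- f))"
  proof (rule free_Abelian_group_induct)
    show "P (cls 0) \<and> P (cls (- 0))"
      using tens[of "\<one>\<^bsub>H\<^esub>" "0\<^sub>v (fst \<tau>)"] by (simp add: tens_zero H_closed cls_zero)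
  next
    fix x y :: "(('g, 'k) falg set \<times> 'k vec) \<Rightarrow>\<^sub>0 int"
    assume *: "Poly_Mapping.keys x \<subseteq> carrier H \<times> T" "Poly_Mapping.keys y \<subseteq> carrier H \<times> T"
      "P (cls x) \<and> P (cls (- x))" "P (cls y) \<and> P (cls (- y))"
    then have c: "x \<in> carrier Fr" "y \<in> carrier Fr" "-x \<in> carrier Fr" "-y \<in> carrier Fr"
      by (auto simp: Fr_simps)
    have "cls (x - y) = cls x \<otimes>\<^bsub>M\<^esub> cls (- y)" "cls (- (x - y)) = cls (- x) \<otimes>\<^bsub>M\<^esub> cls y"
      using c cls_add[of x "-y"] cls_add[of "-x" y] by simp_all
    then show "P (cls (x - y)) \<and> P (cls (- (x - y)))"
      using * c by (auto intro!: add cls_closed)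
  next
    fix a :: "('g, 'k) falg set \<times> 'k vec" assume "a \<in> carrier H \<times> T"
    then show "P (cls (frag_of a)) \<and> P (cls (- frag_of a))"
      using tens by (cases a) (auto simp: cls_minus_frag simp flip: tens_cls)
  qed
  then show ?thesis using f by simp
qed

text \<open>A map that respects the five kinds of relations extends to the free abelian group, kills the subgroup
  which the relations generate, and so descends to the quotient. This is how all maps out of a Verma module arise.\<close>

lemma verma_universal:
  fixes f :: "('g, 'k) falg set \<Rightarrow> 'k vec \<Rightarrow> 'w::ab_group_add"
  assumes "\<And>h h' v. h \<in> carrier H \<Longrightarrow> h' \<in> carrier H \<Longrightarrow> v \<in> T \<Longrightarrow> f (h \<oplus>\<^bsub>H\<^esub> h') v = f h v + f h' v"
    and "\<And>h v v'. h \<in> carrier H \<Longrightarrow> v \<in> T \<Longrightarrow> v' \<in> T \<Longrightarrow> f h (v + v') = f h v + f h v'"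
    and "\<And>h v a. h \<in> carrier H \<Longrightarrow> v \<in> T \<Longrightarrow> f (h \<otimes>\<^bsub>H\<^esub> hcl D (scal a)) v = f h (a \<cdot>\<^sub>v v)"
    and "\<And>h v g. h \<in> carrier H \<Longrightarrow> v \<in> T \<Longrightarrow> g \<in> carrier (rca_grp D) \<Longrightarrow>
        f (h \<otimes>\<^bsub>H\<^esub> hcl D (gel g)) v = f h (snd \<tau> g *\<^sub>v v)"
    and "\<And>h v y. h \<in> carrier H \<Longrightarrow> v \<in> T \<Longrightarrow> y \<in> carrier_vec (rca_dim D) \<Longrightarrow>
        f (h \<otimes>\<^bsub>H\<^esub> hcl D (yel y)) v = f h (0\<^sub>v (fst \<tau>))"
  obtains \<Phi> where "\<And>m m'. m \<in> carrier M \<Longrightarrow> m' \<in> carrier M \<Longrightarrow> \<Phi> (m \<otimes>\<^bsub>M\<^esub> m') = \<Phi> m + \<Phi> m'"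
    and "\<And>h v. h \<in> carrier H \<Longrightarrow> v \<in> T \<Longrightarrow> \<Phi> (tens D \<tau> h v) = f h v"
proof -
  let ?W = "\<lparr>carrier = UNIV, monoid.mult = (+), one = 0\<rparr> :: 'w monoid"
  have "\<exists>y. y + x = 0" for x :: 'w by (rule exI[of _ "-x"]) simp
  then interpret W: comm_group ?W
    by (intro comm_groupI) (auto simp: add_ac)
  obtain \<phi> where \<phi>: "\<phi> \<in> hom (free_Abelian_group (carrier H \<times> T)) ?W"
    and of: "\<And>x. x \<in> carrier H \<times> T \<Longrightarrow> \<phi> (frag_of x) = (case x of (h, v) \<Rightarrow> f h v)"
    by (rule W.free_Abelian_group_universal[of "\<lambda>(h, v). f h v" "carrier H \<times> T"]) auto
  have hom: "\<phi> \<in> hom Fr ?W" using \<phi> by (simp add: verma_free_def)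
  have add: "\<phi> (x + y) = \<phi> x + \<phi> y" if "x \<in> carrier Fr" "y \<in> carrier Fr" for x y
    using hom_mult[OF hom that] by (simp add: Fr_simps)
  have zero: "\<phi> 0 = 0" using add[OF Fr_closed(1) Fr_closed(1)] by simp
  have minus: "\<phi> (- y) = - \<phi> y" if "y \<in> carrier Fr" for y
    using add[OF that Fr_closed(4)[OF that]] zero by (simp add: eq_neg_iff_add_eq_0 add.commute)
  have diff: "\<phi> (x - y) = \<phi> x - \<phi> y" if "x \<in> carrier Fr" "y \<in> carrier Fr" for x y
    using add[OF that(1) Fr_closed(4)[OF that(2)]] minus[OF that(2)] by simp
  have frag: "\<phi> (frag_of (h, v)) = f h v" if "h \<in> carrier H" "v \<in> T" for h v
    using of[of "(h, v)"] that by simp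
  have rel: "\<phi> r = 0" if "r \<in> verma_rels D \<tau>" for r
    using that assms unfolding verma_rels_def Let_def
    by (auto simp: diff frag Fr_closed H_closed tau_closed)
  have ker: "\<phi> k = 0" if "k \<in> K" for k
    using that unfolding verma_ker_def
  proof (induction rule: generate.induct)
    case one then show ?case by (simp add: zero Fr_simps)
  next
    case (incl h) then show ?case by (rule rel)
  next
    case (inv h)
    then show ?case using verma_rels_closed by (auto simp: inv_Fr minus rel)
  next
    case (eng h1 h2)
    then show ?case using K_closed by (simp add: verma_ker_def add Fr_simps(3))
  qed
  have wd: "\<phi> x = \<phi> y" if "x \<in> carrier Fr" "y \<in> carrier Fr" "K #>\<^bsub>Fr\<^esub> x = K #>\<^bsub>Fr\<^esub> y" for x y
  proof -
    have "x \<in> cls x" using that(1) K_ops(1) by (simp add: cls_eq_set)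
    then have "x \<in> cls y" using that(3) by (simp add: cls_def)
    then have "x - y \<in> K" using that by (simp add: cls_eq_set)
    then show ?thesis using ker[of "x - y"] diff[OF that(1,2)] by simp
  qed
  obtain \<Phi> where \<Phi>: "\<Phi> \<in> hom (Fr Mod K) ?W" "\<And>x. x \<in> carrier Fr \<Longrightarrow> \<Phi> (K #>\<^bsub>Fr\<^esub> x) = \<phi> x"
    using FactGroup_universal[OF hom normal_K wd] by blast
  show thesis
  proof (rule that)
    show "\<Phi> (m \<otimes>\<^bsub>M\<^esub> m') = \<Phi> m + \<Phi> m'" if "m \<in> carrier M" "m' \<in> carrier M" for m m'
      using hom_mult[OF \<Phi>(1)] that by (simp add: verma_def)
    show "\<Phi> (tens D \<tau> h v) = f h v" if "h \<in> carrier H" "v \<in> T" for h v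
      using that by (simp add: tens_def \<Phi>(2) Fr_closed frag)
  qed
qed

subsection \<open>The action\<close>

definition left_mult :: "('g, 'k) falg set \<Rightarrow> ((('g, 'k) falg set \<times> 'k vec) \<Rightarrow>\<^sub>0 int)
    \<Rightarrow> ((('g, 'k) falg set \<times> 'k vec) \<Rightarrow>\<^sub>0 int)" where
  "left_mult u = frag_extend (\<lambda>(h, v). frag_of (u \<otimes>\<^bsub>H\<^esub> h, v))"

lemma left_mult_simps [simp]:
  "left_mult u (frag_of (h, v)) = frag_of (u \<otimes>\<^bsub>H\<^esub> h, v)" "left_mult u (x + y) = left_mult u x + left_mult u y"
  "left_mult u (x - y) = left_mult u x - left_mult u y" "left_mult u (- x) = - left_mult u x"
  "left_mult u 0 = 0"
  by (simp_all add: left_mult_def frag_extend_add frag_extend_diff frag_extend_minus)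

lemma left_mult_closed:
  assumes "u \<in> carrier H" "f \<in> carrier Fr"
  shows "left_mult u f \<in> carrier Fr"
  using assms keys_frag_extend[of "\<lambda>(h, v). frag_of (u \<otimes>\<^bsub>H\<^esub> h, v)" f] H_closed(2)[OF assms(1)]
  by (fastforce simp: Fr_simps left_mult_def split: prod.splits)

text \<open>By distributivity and associativity, left multiplication by \<open>u\<close> turns each relation into the relation of
  the same kind with \<open>u h\<close> in place of \<open>h\<close>. It follows that \<open>verma_act\<close>, a union of cosets, is a single coset.\<close>

lemma left_mult_rel:
  assumes "u \<in> carrier H" "r \<in> verma_rels D \<tau>"
  shows "left_mult u r \<in> verma_rels D \<tau>"
proof -
  interpret ring H by (rule ring_H)
  show ?thesis
    using assms(2)[unfolded verma_rels_def Let_def]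
  proof (elim UnE CollectE exE conjE)
    fix h h' v assume *: "r = frag_of (h \<oplus>\<^bsub>H\<^esub> h', v) - frag_of (h, v) - frag_of (h', v)"
      "h \<in> carrier H" "h' \<in> carrier H" "v \<in> T"
    have "left_mult u r = frag_of (u \<otimes>\<^bsub>H\<^esub> h \<oplus>\<^bsub>H\<^esub> u \<otimes>\<^bsub>H\<^esub> h', v) - frag_of (u \<otimes>\<^bsub>H\<^esub> h, v) - frag_of (u \<otimes>\<^bsub>H\<^esub> h', v)"
      using * assms(1) by (simp add: r_distr)
    moreover have "u \<otimes>\<^bsub>H\<^esub> h \<in> carrier H" "u \<otimes>\<^bsub>H\<^esub> h' \<in> carrier H" using * assms(1) by auto
    ultimately show ?thesis using * unfolding verma_rels_def Let_def by blast
  next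
    fix h v v' assume *: "r = frag_of (h, v + v') - frag_of (h, v) - frag_of (h, v')"
      "h \<in> carrier H" "v \<in> T" "v' \<in> T"
    then have "left_mult u r = frag_of (u \<otimes>\<^bsub>H\<^esub> h, v + v') - frag_of (u \<otimes>\<^bsub>H\<^esub> h, v) - frag_of (u \<otimes>\<^bsub>H\<^esub> h, v')"
      by simp
    moreover have "u \<otimes>\<^bsub>H\<^esub> h \<in> carrier H" using * assms(1) by auto
    ultimately show ?thesis using * unfolding verma_rels_def Let_def by blast
  next
    fix h a v assume *: "r = frag_of (h \<otimes>\<^bsub>H\<^esub> hcl D (scal a), v) - frag_of (h, a \<cdot>\<^sub>v v)"
      "h \<in> carrier H" "v \<in> T"
    then have "left_mult u r = frag_of (u \<otimes>\<^bsub>H\<^esub> h \<otimes>\<^bsub>H\<^esub> hcl D (scal a), v) - frag_of (u \<otimes>\<^bsub>H\<^esub> h, a \<cdot>\<^sub>v v)"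
      using assms(1) by (simp add: m_assoc H_closed)
    moreover have "u \<otimes>\<^bsub>H\<^esub> h \<in> carrier H" using * assms(1) by auto
    ultimately show ?thesis using * unfolding verma_rels_def Let_def by blast
  next
    fix h g v assume *: "r = frag_of (h \<otimes>\<^bsub>H\<^esub> hcl D (gel g), v) - frag_of (h, snd \<tau> g *\<^sub>v v)"
      "h \<in> carrier H" "g \<in> carrier (rca_grp D)" "v \<in> T"
    then have "left_mult u r = frag_of (u \<otimes>\<^bsub>H\<^esub> h \<otimes>\<^bsub>H\<^esub> hcl D (gel g), v) - frag_of (u \<otimes>\<^bsub>H\<^esub> h, snd \<tau> g *\<^sub>v v)"
      using assms(1) by (simp add: m_assoc H_closed)
    moreover have "u \<otimes>\<^bsub>H\<^esub> h \<in> carrier H" using * assms(1) by auto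
    ultimately show ?thesis using * unfolding verma_rels_def Let_def by blast
  next
    fix h y v assume *: "r = frag_of (h \<otimes>\<^bsub>H\<^esub> hcl D (yel y), v) - frag_of (h, 0\<^sub>v (fst \<tau>))"
      "h \<in> carrier H" "y \<in> carrier_vec (rca_dim D)" "v \<in> T"
    then have "left_mult u r = frag_of (u \<otimes>\<^bsub>H\<^esub> h \<otimes>\<^bsub>H\<^esub> hcl D (yel y), v) - frag_of (u \<otimes>\<^bsub>H\<^esub> h, 0\<^sub>v (fst \<tau>))"
      using assms(1) by (simp add: m_assoc H_closed)
    moreover have "u \<otimes>\<^bsub>H\<^esub> h \<in> carrier H" using * assms(1) by auto
    ultimately show ?thesis using * unfolding verma_rels_def Let_def by blast
  qed
qed

lemma left_mult_ker:
  assumes "u \<in> carrier H" "k \<in> K"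
  shows "left_mult u k \<in> K"
  using assms(2) unfolding verma_ker_def
proof (induction rule: generate.induct)
  case one then show ?case using K_ops(1) by (simp add: verma_ker_def Fr_simps)
next
  case (incl h) then show ?case using left_mult_rel[OF assms(1)] by (intro generate.incl)
next
  case (inv h)
  then show ?case using verma_rels_closed K_ops(3)[OF K_rel[OF left_mult_rel[OF assms(1)]], of h]
    by (auto simp: inv_Fr verma_ker_def subset_iff)
next
  case (eng h1 h2) then show ?case using K_ops(2) by (simp add: verma_ker_def Fr_simps(3))
qed

lemma verma_act_cls:
  assumes u: "u \<in> carrier H" and f: "f \<in> carrier Fr"
  shows "verma_act D \<tau> u (cls f) = cls (left_mult u f)"
proof -
  have "cls (left_mult u f') = cls (left_mult u f)" if "f' \<in> cls f" for f'
    using that left_mult_ker[OF u, of "f' - f"]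
    by (intro cls_eqI left_mult_closed[OF u] f) (auto simp: cls_eq_set[OF f])
  moreover have "f \<in> cls f" using f K_ops(1) by (simp add: cls_eq_set)
  ultimately show ?thesis
    unfolding verma_act_def cls_def[symmetric] left_mult_def[symmetric] by blast
qed

lemma verma_act_tens:
  "u \<in> carrier H \<Longrightarrow> h \<in> carrier H \<Longrightarrow> v \<in> T \<Longrightarrow> verma_act D \<tau> u (tens D \<tau> h v) = tens D \<tau> (u \<otimes>\<^bsub>H\<^esub> h) v"
  by (simp add: tens_cls verma_act_cls Fr_closed)

lemma verma_act_closed: "u \<in> carrier H \<Longrightarrow> m \<in> carrier M \<Longrightarrow> verma_act D \<tau> u m \<in> carrier M"
  by (auto simp: carrier_M verma_act_cls left_mult_closed)

lemma verma_act_add: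
  "u \<in> carrier H \<Longrightarrow> m \<in> carrier M \<Longrightarrow> m' \<in> carrier M \<Longrightarrow>
    verma_act D \<tau> u (m \<otimes>\<^bsub>M\<^esub> m') = verma_act D \<tau> u m \<otimes>\<^bsub>M\<^esub> verma_act D \<tau> u m'"
  by (auto simp: carrier_M verma_act_cls left_mult_closed Fr_closed simp flip: cls_add)

lemma verma_act_mult:
  assumes "u \<in> carrier H" "u' \<in> carrier H" "m \<in> carrier M"
  shows "verma_act D \<tau> (u \<otimes>\<^bsub>H\<^esub> u') m = verma_act D \<tau> u (verma_act D \<tau> u' m)"
  using assms(3)
proof (induction rule: verma_induct)
  interpret ring H by (rule ring_H)
  case (tens h v) then show ?case using assms by (simp add: verma_act_tens m_assoc)
qed (use assms in \<open>simp add: verma_act_add verma_act_closed H_closed\<close>)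

lemma verma_act_plus:
  assumes "u \<in> carrier H" "u' \<in> carrier H" "m \<in> carrier M"
  shows "verma_act D \<tau> (u \<oplus>\<^bsub>H\<^esub> u') m = verma_act D \<tau> u m \<otimes>\<^bsub>M\<^esub> verma_act D \<tau> u' m"
  using assms(3)
proof (induction rule: verma_induct)
  interpret ring H by (rule ring_H)
  case (tens h v) then show ?case using assms by (simp add: verma_act_tens l_distr tens_add_left)
next
  interpret comm_group M by (rule comm_group_M)
  case (add m m') then show ?case
    using assms by (simp add: verma_act_add verma_act_closed H_closed m_ac)
qed

lemma tens_eq_act:
  assumes "h \<in> carrier H" "v \<in> T"
  shows "tens D \<tau> h v = verma_act D \<tau> h (tens D \<tau> \<one>\<^bsub>H\<^esub> v)"
proof -
  interpret ring H by (rule ring_H)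
  show ?thesis using assms by (simp add: verma_act_tens)
qed

subsection \<open>Spanning by monomials\<close>

definition xmon :: "nat list \<Rightarrow> ('g, 'k) falg" where
  "xmon ls = Poly_Mapping.single (Word (map GX ls)) 1"

text \<open>The sums of elements \<open>x\<^sub>i\<^sub>1 \<cdots> x\<^sub>i\<^sub>k \<otimes> v\<close>. They turn out to be the whole Verma module; this is the easy half
  of the Poincare-Birkhoff-Witt theorem.\<close>

inductive_set xspan :: "('g, 'k) velt set" where
  xmon: "set ls \<subseteq> {..<rca_dim D} \<Longrightarrow> v \<in> T \<Longrightarrow> tens D \<tau> (hcl D (xmon ls)) v \<in> xspan"
| add: "m \<in> xspan \<Longrightarrow> m' \<in> xspan \<Longrightarrow> m \<otimes>\<^bsub>M\<^esub> m' \<in> xspan"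

definition xstable :: "('g, 'k) falg set" where
  "xstable = {a \<in> carrier F. \<forall>m\<in>xspan. verma_act D \<tau> (hcl D a) m \<in> xspan}"

lemma xmon_closed: "set ls \<subseteq> {..<rca_dim D} \<Longrightarrow> xmon ls \<in> carrier F"
  by (fastforce simp: xmon_def gens_def intro!: free_alg_closed)

lemma xspan_closed: "m \<in> xspan \<Longrightarrow> m \<in> carrier M"
  by (induction rule: xspan.induct)
    (auto intro!: tens_closed hcl_closed xmon_closed monoid.m_closed[OF group.is_monoid[OF group_M]])

lemma xstableI:
  assumes "a \<in> carrier F" and
    "\<And>ls v. set ls \<subseteq> {..<rca_dim D} \<Longrightarrow> v \<in> T \<Longrightarrow> tens D \<tau> (hcl D (a * xmon ls)) v \<in> xspan"
  shows "a \<in> xstable"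
proof -
  have "verma_act D \<tau> (hcl D a) m \<in> xspan" if "m \<in> xspan" for m
    using that
  proof (induction rule: xspan.induct)
    case (xmon ls v)
    then show ?case using assms by (simp add: verma_act_tens hcl_closed xmon_closed flip: hcl_mult)
  next
    case (add m m')
    then show ?case using assms by (simp add: verma_act_add hcl_closed xspan_closed xspan.add)
  qed
  then show ?thesis using assms by (simp add: xstable_def)
qed

lemma xstableD:
  assumes "a \<in> xstable" "b \<in> carrier F" "v \<in> T" "tens D \<tau> (hcl D b) v \<in> xspan"
  shows "tens D \<tau> (hcl D (a * b)) v \<in> xspan"
proof -
  have "verma_act D \<tau> (hcl D a) (tens D \<tau> (hcl D b) v) \<in> xspan" "a \<in> carrier F"
    using assms by (auto simp: xstable_def)
  then show ?thesis using assms by (simp add: verma_act_tens hcl_closed hcl_mult)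
qed

lemma xstable_add: "a \<in> xstable \<Longrightarrow> b \<in> xstable \<Longrightarrow> a + b \<in> xstable"
  by (auto simp: xstable_def verma_act_plus hcl_closed hcl_add xspan_closed xspan.add intro: free_alg_closed)

lemma xstable_mult: "a \<in> xstable \<Longrightarrow> b \<in> xstable \<Longrightarrow> a * b \<in> xstable"
  by (auto simp: xstable_def verma_act_mult hcl_closed hcl_mult xspan_closed intro: free_alg_closed)

lemma scal_xstable: "scal c \<in> xstable"
proof (rule xstableI)
  fix ls and v :: "'k vec" assume *: "set ls \<subseteq> {..<rca_dim D}" "v \<in> T"
  have "tens D \<tau> (hcl D (scal c * xmon ls)) v = tens D \<tau> (hcl D (xmon ls)) (c \<cdot>\<^sub>v v)"
    using * by (simp add: scal_commute hcl_mult xmon_closed free_alg_closed hcl_closed tens_scal)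
  then show "tens D \<tau> (hcl D (scal c * xmon ls)) v \<in> xspan"
    using * by (auto intro: xspan.xmon)
qed (rule free_alg_closed)

lemma xstable_sum: "(\<And>i. i \<in> J \<Longrightarrow> f i \<in> xstable) \<Longrightarrow> sum f J \<in> xstable"
proof (induction J rule: infinite_finite_induct)
  case empty
  have "scal 0 \<in> xstable" by (rule scal_xstable)
  then show ?case by (simp add: scal_def)
next
  case (infinite J)
  have "scal 0 \<in> xstable" by (rule scal_xstable)
  then show ?case using infinite by (simp add: scal_def)
qed (auto intro: xstable_add)

lemma GX_xstable:
  assumes "i < rca_dim D"
  shows "Poly_Mapping.single (Word [GX i]) 1 \<in> xstable"
proof (rule xstableI)
  fix ls and v :: "'k vec" assume *: "set ls \<subseteq> {..<rca_dim D}" "v \<in> T"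
  have "Poly_Mapping.single (Word [GX i]) 1 * xmon ls = xmon (i # ls)"
    by (simp add: xmon_def mult_single plus_word_def)
  moreover have "tens D \<tau> (hcl D (xmon (i # ls))) v \<in> xspan"
    using * assms by (intro xspan.xmon) auto
  ultimately show "tens D \<tau> (hcl D (Poly_Mapping.single (Word [GX i]) 1 * xmon ls)) v \<in> xspan"
    by simp
qed (use assms in \<open>auto intro!: free_alg_closed simp: gens_def\<close>)

lemma single_scal: "Poly_Mapping.single w c = scal c * Poly_Mapping.single w 1"
  by (simp add: scal_def mult_single)

lemma xel_xstable: "x \<in> carrier_vec (rca_dim D) \<Longrightarrow> xel x \<in> xstable"
  unfolding xel_def
  by (intro xstable_sum, subst single_scal) (auto intro: xstable_mult scal_xstable GX_xstable)

lemma xel_unit: "i < rca_dim D \<Longrightarrow> xel (unit_vec (rca_dim D) i) = Poly_Mapping.single (Word [GX i]) 1"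
  unfolding xel_def by (subst sum.mono_neutral_right[of _ "{i}"]) auto

lemma yel_unit: "i < rca_dim D \<Longrightarrow> yel (unit_vec (rca_dim D) i) = Poly_Mapping.single (Word [GY i]) 1"
  unfolding yel_def by (subst sum.mono_neutral_right[of _ "{i}"]) auto

lemma xmon_Cons: "i < rca_dim D \<Longrightarrow> xmon (i # ls) = xel (unit_vec (rca_dim D) i) * xmon ls"
  by (simp add: xel_unit) (simp add: xmon_def mult_single plus_word_def)

lemma xmon_Nil: "xmon [] = 1"
  by (simp add: xmon_def flip: zero_word_def)

lemma hcl_rel_eq:
  assumes "a - b \<in> smash_rels D \<union> cherednik_rels D" "a \<in> carrier F" "b \<in> carrier F"
  shows "hcl D a = hcl D b"
  using assms by (simp add: hcl_eq_iff rels_in_I)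

lemma contra_closed:
  "g \<in> carrier (rca_grp D) \<Longrightarrow> x \<in> carrier_vec (rca_dim D) \<Longrightarrow>
    contra (rca_grp D) (rca_rep D) g *\<^sub>v x \<in> carrier_vec (rca_dim D)"
  using rep_D group.inv_closed[OF group_D]
  by (auto simp: contra_def is_rep_def intro!: mult_mat_vec_carrier)

text \<open>A group element moves to the right past each \<open>x\<close>, which it transforms linearly, until it meets \<open>\<tau>\<close>.\<close>

lemma gel_xstable:
  assumes g: "g \<in> carrier (rca_grp D)"
  shows "gel g \<in> xstable"
proof (rule xstableI)
  fix ls and v :: "'k vec" assume "set ls \<subseteq> {..<rca_dim D}" and v: "v \<in> T"
  then show "tens D \<tau> (hcl D (gel g * xmon ls)) v \<in> xspan"
  proof (induction ls)
    case Nil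
    have "tens D \<tau> (hcl D (gel g)) v = tens D \<tau> \<one>\<^bsub>H\<^esub> (snd \<tau> g *\<^sub>v v)"
      using tens_gel[of "\<one>\<^bsub>H\<^esub>" v g] g v ring.ring_simprules(12)[OF ring_H, of "hcl D (gel g)"] by (simp add: H_closed)
    then show ?case using xspan.xmon[of "[]" "snd \<tau> g *\<^sub>v v"] g v
      by (simp add: xmon_Nil tau_closed hcl_one)
  next
    case (Cons i ls)
    let ?e = "unit_vec (rca_dim D) i" let ?x = "contra (rca_grp D) (rca_rep D) g *\<^sub>v ?e"
    have *: "xel ?x \<in> carrier F" "xel ?e \<in> carrier F" "gel g \<in> carrier F" "xmon ls \<in> carrier F"
      using g Cons.prems by (auto intro!: free_alg_closed free_alg_closed_xel contra_closed xmon_closed)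
    have "gel g * xel ?e - xel ?x * gel g \<in> smash_rels D"
      using g unfolding smash_rels_def Let_def by (auto intro!: exI[of _ g] exI[of _ ?e])
    then have "hcl D (gel g * xel ?e) = hcl D (xel ?x * gel g)"
      using * by (intro hcl_rel_eq) (auto intro: free_alg_closed)
    then have "hcl D (gel g * xmon (i # ls)) = hcl D (xel ?x * (gel g * xmon ls))"
      using Cons.prems * by (simp add: xmon_Cons hcl_mult free_alg_closed flip: mult.assoc)
    moreover have "tens D \<tau> (hcl D (xel ?x * (gel g * xmon ls))) v \<in> xspan"
      by (rule xstableD[OF xel_xstable])
        (use Cons * g v in \<open>auto intro: free_alg_closed contra_closed\<close>)
    ultimately show ?case by simp
  qed
qed (use g in \<open>rule free_alg_closed\<close>)

text \<open>Moving \<open>y\<close> past one \<open>x\<close> costs the commutator \<open>[y, x]\<close>, a combination of group elements, which are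
  already known to be stable; in the end \<open>y\<close> meets \<open>\<tau>\<close> and gives zero.\<close>

lemma yel_xstable:
  assumes y: "y \<in> carrier_vec (rca_dim D)"
  shows "yel y \<in> xstable"
proof (rule xstableI)
  fix ls and v :: "'k vec" assume "set ls \<subseteq> {..<rca_dim D}" and v: "v \<in> T"
  then show "tens D \<tau> (hcl D (yel y * xmon ls)) v \<in> xspan"
  proof (induction ls)
    case Nil
    have "tens D \<tau> (hcl D (yel y)) v = tens D \<tau> \<one>\<^bsub>H\<^esub> (0\<^sub>v (fst \<tau>))"
      using tens_yel[of "\<one>\<^bsub>H\<^esub>" v y] y v ring.ring_simprules(12)[OF ring_H, of "hcl D (yel y)"] by (simp add: H_closed)
    then show ?case using xspan.xmon[of "[]" "0\<^sub>v (fst \<tau>)"] by (simp add: xmon_Nil hcl_one)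
  next
    case (Cons i ls)
    let ?e = "unit_vec (rca_dim D) i"
    let ?k = "\<lambda>s. rca_c D s * (y \<bullet> (?e - contra (rca_grp D) (rca_rep D) s *\<^sub>v ?e))"
    let ?z = "scal (rca_t D * (y \<bullet> ?e)) - (\<Sum>s\<in>reflections D. scal (?k s) * gel s)"
    have refl: "reflections D \<subseteq> carrier (rca_grp D)" by (auto simp: reflections_def)
    have sneg: "- scal c = scal (- c)" for c :: 'k by (simp add: scal_def single_uminus)
    have z: "?z = scal (rca_t D * (y \<bullet> ?e)) + (\<Sum>s\<in>reflections D. scal (- ?k s) * gel s)"
      by (simp add: sum_negf flip: sneg)
    have zs: "?z \<in> xstable" unfolding z
      using refl by (intro xstable_add xstable_sum xstable_mult scal_xstable gel_xstable) auto
    then have zF: "?z \<in> carrier F" by (simp add: xstable_def)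
    have *: "yel y \<in> carrier F" "xel ?e \<in> carrier F" "xmon ls \<in> carrier F"
      using y Cons.prems by (auto intro!: free_alg_closed free_alg_closed_xel xmon_closed)
    have "yel y * xel ?e - xel ?e * yel y - ?z \<in> cherednik_rels D"
      unfolding cherednik_rels_def Let_def using y unit_vec_carrier[of "rca_dim D" i] by blast
    then have "hcl D (yel y * xel ?e) = hcl D (xel ?e * yel y + ?z)"
      using * zF by (intro hcl_rel_eq) (auto intro: free_alg_closed simp: diff_diff_eq)
    then have "hcl D (yel y * xmon (i # ls)) = hcl D ((xel ?e * yel y + ?z) * xmon ls)"
      using Cons.prems * zF by (simp add: xmon_Cons hcl_mult free_alg_closed flip: mult.assoc)
    also have "\<dots> = hcl D (xel ?e * (yel y * xmon ls)) \<oplus>\<^bsub>H\<^esub> hcl D (?z * xmon ls)"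
      using * zF by (simp add: distrib_right mult.assoc hcl_add free_alg_closed)
    finally have "tens D \<tau> (hcl D (yel y * xmon (i # ls))) v =
        tens D \<tau> (hcl D (xel ?e * (yel y * xmon ls))) v \<otimes>\<^bsub>M\<^esub> tens D \<tau> (hcl D (?z * xmon ls)) v"
      using * zF v by (simp add: tens_add_left hcl_closed free_alg_closed)
    moreover have "tens D \<tau> (hcl D (xel ?e * (yel y * xmon ls))) v \<in> xspan"
      by (rule xstableD[OF xel_xstable]) (use Cons * v in \<open>auto intro: free_alg_closed\<close>)
    moreover have "tens D \<tau> (hcl D (?z * xmon ls)) v \<in> xspan"
      using Cons * by (intro xstableD zs xspan.xmon) (auto intro: free_alg_closed)
    ultimately show ?case by (simp add: xspan.add)
  qed
qed (use y in \<open>rule free_alg_closed_xel\<close>)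

lemma all_xstable:
  assumes "a \<in> carrier F"
  shows "a \<in> xstable"
  using assms[unfolded free_alg_carrier]
proof (induction rule: poly_mapping_induct_on)
  case zero
  have "scal 0 \<in> xstable" by (rule scal_xstable)
  then show ?case by (simp add: scal_def)
next
  case (single w c)
  have gen: "Poly_Mapping.single (Word [l]) 1 \<in> xstable" if "l \<in> gens D" for l
  proof (cases l)
    case (GG g) then show ?thesis using gel_xstable[of g] that by (auto simp: gens_def gel_def)
  next
    case (GX i) then show ?thesis using GX_xstable[of i] that by (auto simp: gens_def)
  next
    case (GY i) then show ?thesis
      using yel_xstable[of "unit_vec (rca_dim D) i"] that by (auto simp: gens_def yel_unit)
  qed
  have "set ls \<subseteq> gens D \<Longrightarrow> Poly_Mapping.single (Word ls) 1 \<in> xstable" for ls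
  proof (induction ls)
    case Nil
    have "scal 1 \<in> xstable" by (rule scal_xstable)
    then show ?case by (simp add: scal_def zero_word_def)
  next
    case (Cons l ls)
    have "Poly_Mapping.single (Word (l # ls)) (1::'k) =
        Poly_Mapping.single (Word [l]) 1 * Poly_Mapping.single (Word ls) 1"
      by (simp add: mult_single plus_word_def)
    then show ?case using Cons gen by (simp add: xstable_mult)
  qed
  from this[of "letters w"] show ?case
    using single by (subst single_scal) (auto intro: xstable_mult scal_xstable)
next
  case (add a b)
  then show ?case by (rule xstable_add)
qed

theorem verma_spanned: "carrier M = xspan"
proof
  show "xspan \<subseteq> carrier M" using xspan_closed by auto
  show "carrier M \<subseteq> xspan"
  proof
    fix m assume "m \<in> carrier M"
    then show "m \<in> xspan"
    proof (induction rule: verma_induct)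
      case (tens h v)
      then obtain a where "a \<in> carrier F" "h = hcl D a" by (auto elim: carrier_HE)
      moreover have "tens D \<tau> (hcl D (a * xmon [])) v \<in> xspan"
        using tens \<open>a \<in> carrier F\<close> xspan.xmon[of "[]" v]
        by (intro xstableD all_xstable) (auto intro: xmon_closed)
      ultimately show ?case by (simp add: xmon_Nil)
    qed (rule xspan.add)
  qed
qed

end

section \<open>Matrices of rank one\<close>

text \<open>Rank at most one, in the form that is used to compute with reflections.\<close>

definition outer_product_form :: "nat \<Rightarrow> 'k::field mat \<Rightarrow> bool" where
  "outer_product_form n A \<longleftrightarrow> (\<exists>f g. \<forall>i<n. \<forall>j<n. A $$ (i, j) = f i * g j)"

lemma outer_product_formI:
  "(\<And>i j. i < n \<Longrightarrow> j < n \<Longrightarrow> A $$ (i, j) = f i * g j) \<Longrightarrow> outer_product_form n A"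
  unfolding outer_product_form_def by auto

lemma (in vec_space) independent_colsI:
  assumes "set cs \<subseteq> carrier_vec n" "distinct cs"
    and "\<And>v. v \<in> carrier_vec (length cs) \<Longrightarrow> mat_of_cols n cs *\<^sub>v v = 0\<^sub>v n \<Longrightarrow> v = 0\<^sub>v (length cs)"
  shows "lin_indpt (set cs)"
proof
  assume "lin_dep (set cs)"
  moreover have "cols (mat_of_cols n cs) = cs" using assms(1) by (rule cols_mat_of_cols)
  ultimately show False
    using lin_depE[of "mat_of_cols n cs" "length cs"] assms by (metis mat_of_cols_carrier(1))
qed

text \<open>If the rank is one, any two columns are dependent, so all columns are multiples of a column through a
  nonzero entry. For the converse, such a column is an independent set by itself.\<close>

lemma rank_eq_1_iff:
  assumes A: "A \<in> carrier_mat n n"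
  shows "vec_space.rank n A = 1 \<longleftrightarrow> A \<noteq> 0\<^sub>m n n \<and> outer_product_form n A"
proof -
  interpret vec_space "TYPE('a)" n .
  have nonzero: "\<exists>i<n. \<exists>j<n. A $$ (i, j) \<noteq> 0" if "A \<noteq> 0\<^sub>m n n"
    using that A by (auto simp: mat_eq_iff)
  show ?thesis
  proof
    assume r: "rank A = 1"
    then have "A \<noteq> 0\<^sub>m n n" using rank_0I[of n] by auto
    then obtain i0 j0 where ij0: "i0 < n" "j0 < n" "A $$ (i0, j0) \<noteq> 0" using nonzero by blast
    have "A $$ (i, j) * A $$ (i0, j0) = A $$ (i, j0) * A $$ (i0, j)" if "i < n" "j < n" for i j
    proof (cases "col A j = col A j0")
      case True
      then have "A $$ (i', j) = A $$ (i', j0)" if "i' < n" for i'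
        using A that \<open>j < n\<close> ij0 by (metis carrier_matD index_col)
      then show ?thesis using ij0 that by simp
    next
      case False
      let ?cs = "[col A j, col A j0]"
      have cs: "set ?cs \<subseteq> carrier_vec n" "distinct ?cs" "set ?cs \<subseteq> set (cols A)"
        using A False ij0 that by (auto simp: cols_def)
      have "\<not> lin_indpt (set ?cs)"
        using rank_ge_card_indpt[OF A cs(3)] r False by auto
      then obtain v where v: "v \<in> carrier_vec 2" "mat_of_cols n ?cs *\<^sub>v v = 0\<^sub>v n" "v \<noteq> 0\<^sub>v 2"
        using independent_colsI[OF cs(1,2)] by (auto simp: numeral_2_eq_2)
      have e: "A $$ (i', j) * v $ 0 + A $$ (i', j0) * v $ 1 = 0" if "i' < n" for i'
      proof -
        have "(mat_of_cols n ?cs *\<^sub>v v) $ i' = 0" using v that by simp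
        then show ?thesis using that v(1) \<open>j < n\<close> ij0 A
          by (auto simp: mult_mat_vec_def scalar_prod_def mat_of_cols_def numeral_2_eq_2)
      qed
      have "v $ 0 \<noteq> 0"
      proof
        assume "v $ 0 = 0"
        then have "v $ 1 = 0" using e[OF ij0(1)] ij0 by simp
        with \<open>v $ 0 = 0\<close> v(1,3) show False by (auto simp: vec_eq_iff less_2_cases_iff)
      qed
      moreover have "v $ 0 * (A $$ (i, j) * A $$ (i0, j0) - A $$ (i, j0) * A $$ (i0, j)) =
          (A $$ (i, j) * v $ 0 + A $$ (i, j0) * v $ 1) * A $$ (i0, j0) -
          A $$ (i, j0) * (A $$ (i0, j) * v $ 0 + A $$ (i0, j0) * v $ 1)"
        by (simp add: algebra_simps)
      then have "v $ 0 * (A $$ (i, j) * A $$ (i0, j0) - A $$ (i, j0) * A $$ (i0, j)) = 0"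
        using e[OF that(1)] e[OF ij0(1)] by simp
      ultimately show ?thesis by simp
    qed
    then have "A $$ (i, j) = A $$ (i, j0) * (A $$ (i0, j) / A $$ (i0, j0))" if "i < n" "j < n" for i j
      using that ij0 by (simp add: nonzero_eq_divide_eq)
    then have "outer_product_form n A" by (rule outer_product_formI)
    then show "A \<noteq> 0\<^sub>m n n \<and> outer_product_form n A"
      using \<open>A \<noteq> 0\<^sub>m n n\<close> by simp
  next
    assume *: "A \<noteq> 0\<^sub>m n n \<and> outer_product_form n A"
    then obtain f g where "\<forall>i<n. \<forall>j<n. A $$ (i, j) = f i * g j" unfolding outer_product_form_def by blast
    then have "rank A \<le> 1" using A by (intro rank_le_1_product_entries) auto
    moreover obtain i0 j0 where ij0: "i0 < n" "j0 < n" "A $$ (i0, j0) \<noteq> 0" using nonzero * by blast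
    have "lin_indpt (set [col A j0])"
    proof (rule independent_colsI)
      fix v :: "'a vec" assume v: "v \<in> carrier_vec (length [col A j0])" "mat_of_cols n [col A j0] *\<^sub>v v = 0\<^sub>v n"
      have "(mat_of_cols n [col A j0] *\<^sub>v v) $ i0 = 0" using v ij0 by simp
      then have "A $$ (i0, j0) * v $ 0 = 0" using v ij0 A
        by (auto simp: mult_mat_vec_def scalar_prod_def mat_of_cols_def)
      then show "v = 0\<^sub>v (length [col A j0])" using ij0 v by (auto simp: vec_eq_iff)
    qed (use A ij0 in auto)
    then have "1 \<le> rank A"
      using rank_ge_card_indpt[OF A, of "set [col A j0]"] A ij0 by (auto simp: cols_def)
    ultimately show "rank A = 1" by simp
  qed
qed

lemma outer_product_form_mult:
  assumes "outer_product_form n A" "A \<in> carrier_mat n n" "P \<in> carrier_mat n n"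
  shows "outer_product_form n (P * A)" "outer_product_form n (A * P)"
proof -
  obtain f g where fg: "\<And>i j. i < n \<Longrightarrow> j < n \<Longrightarrow> A $$ (i, j) = f i * g j"
    using assms(1) unfolding outer_product_form_def by blast
  have "(P * A) $$ (i, j) = (\<Sum>l<n. P $$ (i, l) * f l) * g j" if "i < n" "j < n" for i j
    using that assms fg by (simp add: scalar_prod_def sum_distrib_right atLeast0LessThan mult.assoc)
  then show "outer_product_form n (P * A)" by (rule outer_product_formI)
  have "(A * P) $$ (i, j) = f i * (\<Sum>l<n. g l * P $$ (l, j))" if "i < n" "j < n" for i j
    using that assms fg by (simp add: scalar_prod_def sum_distrib_left atLeast0LessThan mult.assoc)
  then show "outer_product_form n (A * P)" by (rule outer_product_formI)
qed

lemma outer_product_form_transpose: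
  assumes "outer_product_form n A" "A \<in> carrier_mat n n"
  shows "outer_product_form n A\<^sup>T"
proof -
  obtain f g where fg: "\<And>i j. i < n \<Longrightarrow> j < n \<Longrightarrow> A $$ (i, j) = f i * g j"
    using assms(1) unfolding outer_product_form_def by blast
  then show ?thesis using assms(2) by (intro outer_product_formI[of _ _ g f]) auto
qed

section \<open>The dual parameters and the opposite algebra\<close>

lemma is_rep_contra:
  assumes G: "group G" and "is_rep G (d, \<sigma>)"
  shows "is_rep G (d, contra G \<sigma>)"
proof -
  interpret group G by (rule G)
  have c: "\<sigma> g \<in> carrier_mat d d" if "g \<in> carrier G" for g using assms(2) that by (auto simp: is_rep_def)
  show ?thesis
    using assms(2) c by (auto simp: is_rep_def contra_def inv_mult_group transpose_mult[of _ d d _ d])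
qed

lemma contra_contra:
  assumes "group G" "g \<in> carrier G"
  shows "contra G (contra G \<sigma>) g = \<sigma> g"
  using assms by (simp add: contra_def group.inv_inv)

lemma dual_rca_simps [simp]:
  "rca_grp (dual_rca D) = rca_grp D" "rca_dim (dual_rca D) = rca_dim D" "rca_t (dual_rca D) = rca_t D"
  "rca_rep (dual_rca D) = contra (rca_grp D) (rca_rep D)"
  "rca_c (dual_rca D) = (\<lambda>s. rca_c D (inv\<^bsub>rca_grp D\<^esub> s))"
  by (simp_all add: dual_rca_def)

lemma free_alg_dual [simp]: "free_alg (dual_rca D) = free_alg D"
  by (simp add: free_alg_def gens_def)

definition opp_word :: "('g, 'b) monoid_scheme \<Rightarrow> 'g gen word \<Rightarrow> 'g gen word" where
  "opp_word G w = Word (rev (map (opp_gen G) (letters w)))"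

lemma opp_free_superset:
  assumes "finite W" "Poly_Mapping.keys a \<subseteq> W"
  shows "opp_free G a = (\<Sum>w\<in>W. Poly_Mapping.single (opp_word G w) (Poly_Mapping.lookup a w))"
  unfolding opp_free_def opp_word_def using assms
  by (intro sum.mono_neutral_left) (auto simp: in_keys_iff)

lemma opp_free_single [simp]: "opp_free G (Poly_Mapping.single w c) = Poly_Mapping.single (opp_word G w) c"
  by (subst opp_free_superset[of "{w}"]) auto

lemma opp_free_zero [simp]: "opp_free G 0 = 0"
  by (simp add: opp_free_def)

lemma opp_free_add [simp]: "opp_free G (a + b) = opp_free G a + opp_free G b"
proof -
  let ?W = "Poly_Mapping.keys a \<union> Poly_Mapping.keys b"
  show ?thesis
    using keys_add[of a b]
    by (simp add: opp_free_superset[of ?W] lookup_add single_add sum.distrib)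
qed

lemma opp_free_minus [simp]: "opp_free G (- a) = - opp_free G a"
  using opp_free_add[of G a "-a"] by (simp add: eq_neg_iff_add_eq_0 add.commute)

lemma opp_free_diff [simp]: "opp_free G (a - b) = opp_free G a - opp_free G b"
  using opp_free_add[of G a "-b"] by simp

lemma opp_free_sum [simp]: "opp_free G (sum f J) = (\<Sum>i\<in>J. opp_free G (f i))"
  by (induction J rule: infinite_finite_induct) auto

lemma opp_word_plus: "opp_word G (u + w) = opp_word G w + opp_word G u"
  by (simp add: opp_word_def plus_word_def)

lemma opp_free_mult [simp]: "opp_free G (a * b) = opp_free G b * opp_free G a"
proof (rule poly_mapping_induct_on[of a UNIV])
  fix w c
  show "opp_free G (Poly_Mapping.single w c * b) = opp_free G b * opp_free G (Poly_Mapping.single w c)"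
  proof (rule poly_mapping_induct_on[of b UNIV])
    fix w' c'
    show "opp_free G (Poly_Mapping.single w c * Poly_Mapping.single w' c') =
        opp_free G (Poly_Mapping.single w' c') * opp_free G (Poly_Mapping.single w c)"
      by (simp add: mult_single opp_word_plus mult.commute)
  qed (auto simp: distrib_left distrib_right)
qed (auto simp: distrib_left distrib_right)

lemma opp_free_gens [simp]:
  "opp_free G 1 = 1" "opp_free G (scal c) = scal c" "opp_free G (gel g) = gel (inv\<^bsub>G\<^esub> g)"
  "opp_free G (xel v) = yel v" "opp_free G (yel v) = xel v"
  by (simp_all add: scal_def gel_def xel_def yel_def opp_word_def zero_word_def flip: single_one)

lemma smash_relI:
  "gel \<one>\<^bsub>rca_grp D\<^esub> - 1 \<in> smash_rels D"
  "g \<in> carrier (rca_grp D) \<Longrightarrow> h \<in> carrier (rca_grp D) \<Longrightarrow>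
    gel (g \<otimes>\<^bsub>rca_grp D\<^esub> h) - gel g * gel h \<in> smash_rels D"
  "g \<in> carrier (rca_grp D) \<Longrightarrow> y \<in> carrier_vec (rca_dim D) \<Longrightarrow>
    gel g * yel y - yel (rca_rep D g *\<^sub>v y) * gel g \<in> smash_rels D"
  "g \<in> carrier (rca_grp D) \<Longrightarrow> x \<in> carrier_vec (rca_dim D) \<Longrightarrow>
    gel g * xel x - xel (contra (rca_grp D) (rca_rep D) g *\<^sub>v x) * gel g \<in> smash_rels D"
  unfolding smash_rels_def Let_def by blast+

lemma cherednik_relI:
  "x \<in> carrier_vec (rca_dim D) \<Longrightarrow> x' \<in> carrier_vec (rca_dim D) \<Longrightarrow>
    xel x * xel x' - xel x' * xel x \<in> cherednik_rels D"
  "y \<in> carrier_vec (rca_dim D) \<Longrightarrow> y' \<in> carrier_vec (rca_dim D) \<Longrightarrow>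
    yel y * yel y' - yel y' * yel y \<in> cherednik_rels D"
  "y \<in> carrier_vec (rca_dim D) \<Longrightarrow> x \<in> carrier_vec (rca_dim D) \<Longrightarrow>
    yel y * xel x - xel x * yel y - (scal (rca_t D * (y \<bullet> x)) -
      (\<Sum>s\<in>reflections D. scal (rca_c D s * (y \<bullet> (x - contra (rca_grp D) (rca_rep D) s *\<^sub>v x))) * gel s))
      \<in> cherednik_rels D"
  unfolding cherednik_rels_def Let_def by blast+

lemma idealI_free_alg:
  assumes "J \<subseteq> carrier (free_alg D)" "0 \<in> J" "\<And>a b. a \<in> J \<Longrightarrow> b \<in> J \<Longrightarrow> a + b \<in> J"
    "\<And>a. a \<in> J \<Longrightarrow> - a \<in> J"
    "\<And>a b. a \<in> J \<Longrightarrow> b \<in> carrier (free_alg D) \<Longrightarrow> a * b \<in> J"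
    "\<And>a b. a \<in> J \<Longrightarrow> b \<in> carrier (free_alg D) \<Longrightarrow> b * a \<in> J"
  shows "ideal J (free_alg D)"
proof (rule idealI)
  interpret ring "free_alg D" by (rule ring_free_alg)
  show "ring (free_alg D)" by (rule ring_free_alg)
  have "\<ominus>\<^bsub>free_alg D\<^esub> a \<in> J" if "a \<in> J" for a
    using assms that by (auto simp: minus_free_alg)
  then show "subgroup J (add_monoid (free_alg D))"
    using assms by (intro add.subgroupI) (auto simp: a_inv_def)
qed (use assms in auto)

context rational_cherednik
begin

lemma rep_closed: "g \<in> carrier (rca_grp D) \<Longrightarrow> rca_rep D g \<in> carrier_mat (rca_dim D) (rca_dim D)"
  using rep_D by (auto simp: is_rep_def)

lemma rep_mult: "g \<in> carrier (rca_grp D) \<Longrightarrow> h \<in> carrier (rca_grp D) \<Longrightarrow>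
    rca_rep D (g \<otimes>\<^bsub>rca_grp D\<^esub> h) = rca_rep D g * rca_rep D h"
  using rep_D by (auto simp: is_rep_def)

lemma rep_one: "rca_rep D \<one>\<^bsub>rca_grp D\<^esub> = 1\<^sub>m (rca_dim D)"
  using rep_D by (auto simp: is_rep_def)

lemma rep_inv:
  assumes "g \<in> carrier (rca_grp D)"
  shows "rca_rep D (inv\<^bsub>rca_grp D\<^esub> g) * rca_rep D g = 1\<^sub>m (rca_dim D)"
    "rca_rep D g * rca_rep D (inv\<^bsub>rca_grp D\<^esub> g) = 1\<^sub>m (rca_dim D)"
proof -
  interpret group "rca_grp D" by (rule group_D)
  show "rca_rep D (inv\<^bsub>rca_grp D\<^esub> g) * rca_rep D g = 1\<^sub>m (rca_dim D)"
    "rca_rep D g * rca_rep D (inv\<^bsub>rca_grp D\<^esub> g) = 1\<^sub>m (rca_dim D)"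
    using assms by (simp_all add: rep_one flip: rep_mult)
qed

lemma dual_rational_cherednik: "rational_cherednik (dual_rca D)"
  using group_D is_rep_contra[OF group_D rep_D] by (simp add: rational_cherednik_def)

lemma reflections_iff:
  "s \<in> reflections D \<longleftrightarrow> s \<in> carrier (rca_grp D) \<and> 1\<^sub>m (rca_dim D) \<noteq> rca_rep D s \<and>
    outer_product_form (rca_dim D) (1\<^sub>m (rca_dim D) - rca_rep D s)"
proof (cases "s \<in> carrier (rca_grp D)")
  case True
  let ?n = "rca_dim D" let ?A = "1\<^sub>m ?n - rca_rep D s"
  have A: "?A \<in> carrier_mat ?n ?n" using rep_closed[OF True] by (simp add: minus_carrier_mat)
  have z: "?A = 0\<^sub>m ?n ?n \<longleftrightarrow> 1\<^sub>m ?n = rca_rep D s"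
    using rep_closed[OF True] by (auto simp: mat_eq_iff)
  show ?thesis using True unfolding reflections_def mem_Collect_eq rank_eq_1_iff[OF A] z by blast
qed (simp add: reflections_def)

lemma reflections_closed: "s \<in> reflections D \<Longrightarrow> s \<in> carrier (rca_grp D)"
  by (simp add: reflections_def)

text \<open>\<open>1 - s\<^sup>-\<^sup>1 = - s\<^sup>-\<^sup>1 (1 - s)\<close> has the same rank as \<open>1 - s\<close>.\<close>

lemma reflections_inv:
  assumes "s \<in> reflections D"
  shows "inv\<^bsub>rca_grp D\<^esub> s \<in> reflections D"
proof -
  interpret group "rca_grp D" by (rule group_D)
  let ?n = "rca_dim D" let ?S = "rca_rep D s" let ?R = "rca_rep D (inv\<^bsub>rca_grp D\<^esub> s)"
  have s: "s \<in> carrier (rca_grp D)" using assms by (rule reflections_closed)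
  have c: "?S \<in> carrier_mat ?n ?n" "?R \<in> carrier_mat ?n ?n" "- ?R \<in> carrier_mat ?n ?n"
      "1\<^sub>m ?n - ?S \<in> carrier_mat ?n ?n"
    using rep_closed s by (simp_all add: minus_carrier_mat)
  have "?S * ?R = 1\<^sub>m ?n" using rep_inv s by simp
  have "(- ?R) * (1\<^sub>m ?n - ?S) = (- ?R) * 1\<^sub>m ?n - (- ?R) * ?S"
    by (rule mult_minus_distrib_mat[OF c(3) one_carrier_mat c(1)])
  also have "(- ?R) * 1\<^sub>m ?n = - ?R" by (rule right_mult_one_mat[OF c(3)])
  also have "(- ?R) * ?S = - 1\<^sub>m ?n"
    using uminus_mult_left_mat[of ?R ?S] c rep_inv[OF s] by simp
  also have "- ?R - - 1\<^sub>m ?n = 1\<^sub>m ?n - ?R"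
    using c(2) by (intro eq_matI) auto
  finally have "1\<^sub>m ?n - ?R = (- ?R) * (1\<^sub>m ?n - ?S)" ..
  moreover have "outer_product_form ?n ((- ?R) * (1\<^sub>m ?n - ?S))"
    using assms c by (intro outer_product_form_mult) (auto simp: reflections_iff)
  moreover have "1\<^sub>m ?n \<noteq> ?R"
  proof
    assume "1\<^sub>m ?n = ?R"
    then have "?S * 1\<^sub>m ?n = 1\<^sub>m ?n" using \<open>?S * ?R = 1\<^sub>m ?n\<close> by simp
    then show False using right_mult_one_mat[OF c(1)] assms by (simp add: reflections_iff)
  qed
  ultimately show ?thesis using s by (simp add: reflections_iff)
qed

lemma reflections_dual: "reflections (dual_rca D) = reflections D"
proof -
  interpret group "rca_grp D" by (rule group_D)
  interpret D': rational_cherednik "dual_rca D" by (rule dual_rational_cherednik)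
  let ?n = "rca_dim D"
  have tr: "1\<^sub>m ?n - contra (rca_grp D) (rca_rep D) s = (1\<^sub>m ?n - rca_rep D (inv\<^bsub>rca_grp D\<^esub> s))\<^sup>T"
    if "s \<in> carrier (rca_grp D)" for s
    using rep_closed[of "inv\<^bsub>rca_grp D\<^esub> s"] that by (auto simp: contra_def)
  have tn: "1\<^sub>m ?n = contra (rca_grp D) (rca_rep D) s \<longleftrightarrow> 1\<^sub>m ?n = rca_rep D (inv\<^bsub>rca_grp D\<^esub> s)" for s
    by (metis contra_def transpose_transpose transpose_one)
  have "s \<in> reflections (dual_rca D) \<longleftrightarrow> inv\<^bsub>rca_grp D\<^esub> s \<in> reflections D" if s: "s \<in> carrier (rca_grp D)" for s
  proof -
    have c: "1\<^sub>m ?n - rca_rep D (inv\<^bsub>rca_grp D\<^esub> s) \<in> carrier_mat ?n ?n"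
      using rep_closed[of "inv\<^bsub>rca_grp D\<^esub> s"] s by (simp add: minus_carrier_mat)
    have "outer_product_form ?n (1\<^sub>m ?n - contra (rca_grp D) (rca_rep D) s) \<longleftrightarrow>
        outer_product_form ?n (1\<^sub>m ?n - rca_rep D (inv\<^bsub>rca_grp D\<^esub> s))"
      unfolding tr[OF s] using outer_product_form_transpose[of ?n] c
      by (metis transpose_carrier_mat transpose_transpose)
    then show ?thesis using s tn by (simp add: reflections_iff D'.reflections_iff)
  qed
  then show ?thesis
    using reflections_inv reflections_closed D'.reflections_closed
    by (metis dual_rca_simps(1) inv_inv subsetI subset_antisym)
qed

lemma contra_inv_mult:
  assumes "g \<in> carrier (rca_grp D)" "x \<in> carrier_vec (rca_dim D)"
  shows "rca_rep D (inv\<^bsub>rca_grp D\<^esub> g) *\<^sub>v (rca_rep D g *\<^sub>v x) = x"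
  using rep_closed[OF assms(1)] rep_closed[OF group.inv_closed[OF group_D assms(1)]] assms
  by (simp add: rep_inv flip: assoc_mult_mat_vec)

text \<open>By invariance of the canonical pairing, \<open>(y, x - s x) = (x, y - s\<^sup>-\<^sup>1 y)\<close>. This identity turns the commutator relation
  of \<open>h\<close> into that of \<open>h\<^sup>*\<close>.\<close>

lemma pairing_contra:
  assumes y: "y \<in> carrier_vec (rca_dim D)" and x: "x \<in> carrier_vec (rca_dim D)" and s: "s \<in> carrier (rca_grp D)"
  shows "y \<bullet> (x - contra (rca_grp D) (rca_rep D) s *\<^sub>v x) = x \<bullet> (y - rca_rep D (inv\<^bsub>rca_grp D\<^esub> s) *\<^sub>v y)"
proof -
  interpret group "rca_grp D" by (rule group_D)
  let ?n = "rca_dim D" let ?C = "contra (rca_grp D) (rca_rep D)" let ?R = "rca_rep D (inv\<^bsub>rca_grp D\<^esub> s)"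
  have R: "?R \<in> carrier_mat ?n ?n" using rep_closed s by simp
  have C: "?C s *\<^sub>v x \<in> carrier_vec ?n" using R x by (auto simp: contra_def intro!: mult_mat_vec_carrier)
  have "y \<bullet> (?C s *\<^sub>v x) = (?R *\<^sub>v y) \<bullet> x"
    using transpose_vec_mult_scalar[OF R y x] comm_scalar_prod[OF y C]
      comm_scalar_prod[OF mult_mat_vec_carrier[OF R y] x]
    by (simp add: contra_def)
  then show ?thesis
    using x y C R
    by (simp add: scalar_prod_minus_distrib[of _ ?n] comm_scalar_prod[of y ?n x] comm_scalar_prod[of "?R *\<^sub>v y" ?n x])
qed

text \<open>The anti-automorphism reverses products and inverts group elements. The commutator \<open>[y, x]\<close> becomes
  \<open>[x, y]\<close>, and substituting \<open>s\<^sup>-\<^sup>1\<close> for \<open>s\<close> in the sum over the reflections replaces \<open>c\<close> by \<open>c(s\<^sup>-\<^sup>1)\<close>; the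
  other relations are exchanged in pairs.\<close>

lemma opp_rels:
  assumes "r \<in> smash_rels D \<union> cherednik_rels D"
  shows "opp_free (rca_grp D) r \<in> cherednik_ideal (dual_rca D)"
proof -
  interpret group "rca_grp D" by (rule group_D)
  interpret D': rational_cherednik "dual_rca D" by (rule dual_rational_cherednik)
  let ?G = "rca_grp D" let ?n = "rca_dim D" let ?C = "contra ?G (rca_rep D)"
  have rel': "u \<in> cherednik_ideal (dual_rca D)" if "u \<in> smash_rels (dual_rca D) \<union> cherednik_rels (dual_rca D)" for u
    using that by (rule D'.rels_in_I)
  have C_closed: "?C g *\<^sub>v x \<in> carrier_vec ?n" "rca_rep D g *\<^sub>v x \<in> carrier_vec ?n"
    if "g \<in> carrier ?G" "x \<in> carrier_vec ?n" for g x
    using rep_closed D'.rep_closed that by (auto intro!: mult_mat_vec_carrier)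
  show ?thesis
    using assms unfolding smash_rels_def cherednik_rels_def Let_def
  proof (elim UnE CollectE exE conjE insertE emptyE)
    assume "r = gel \<one>\<^bsub>?G\<^esub> - 1"
    then show ?thesis using smash_relI(1)[of "dual_rca D"] by (intro rel') simp
  next
    fix g h assume *: "r = gel (g \<otimes>\<^bsub>?G\<^esub> h) - gel g * gel h" "g \<in> carrier ?G" "h \<in> carrier ?G"
    then have "opp_free ?G r = gel (inv\<^bsub>?G\<^esub> h \<otimes>\<^bsub>?G\<^esub> inv\<^bsub>?G\<^esub> g) - gel (inv\<^bsub>?G\<^esub> h) * gel (inv\<^bsub>?G\<^esub> g)"
      by (simp add: inv_mult_group)
    then show ?thesis
      using smash_relI(2)[of "inv\<^bsub>?G\<^esub> h" "dual_rca D" "inv\<^bsub>?G\<^esub> g"] * by (intro rel') simp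
  next
    fix g y assume *: "r = gel g * yel y - yel (rca_rep D g *\<^sub>v y) * gel g" "g \<in> carrier ?G" "y \<in> carrier_vec ?n"
    let ?z = "rca_rep D g *\<^sub>v y"
    have "- opp_free ?G r = gel (inv\<^bsub>?G\<^esub> g) * xel ?z - xel (contra ?G ?C (inv\<^bsub>?G\<^esub> g) *\<^sub>v ?z) * gel (inv\<^bsub>?G\<^esub> g)"
      using * by (simp add: contra_contra[OF group_D] contra_inv_mult)
    also have "\<dots> \<in> cherednik_ideal (dual_rca D)"
      using smash_relI(4)[of "inv\<^bsub>?G\<^esub> g" "dual_rca D" ?z] * C_closed by (intro rel') simp
    finally show ?thesis using D'.I_minus[of "- opp_free ?G r"] by simp
  next
    fix g x assume *: "r = gel g * xel x - xel (?C g *\<^sub>v x) * gel g" "g \<in> carrier ?G" "x \<in> carrier_vec ?n"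
    let ?z = "?C g *\<^sub>v x"
    have "- opp_free ?G r = gel (inv\<^bsub>?G\<^esub> g) * yel ?z - yel (?C (inv\<^bsub>?G\<^esub> g) *\<^sub>v ?z) * gel (inv\<^bsub>?G\<^esub> g)"
      using * D'.contra_inv_mult[of g x] by simp
    also have "\<dots> \<in> cherednik_ideal (dual_rca D)"
      using smash_relI(3)[of "inv\<^bsub>?G\<^esub> g" "dual_rca D" ?z] * C_closed by (intro rel') simp
    finally show ?thesis using D'.I_minus[of "- opp_free ?G r"] by simp
  next
    fix x x' assume *: "r = xel x * xel x' - xel x' * xel x" "x \<in> carrier_vec ?n" "x' \<in> carrier_vec ?n"
    then show ?thesis using cherednik_relI(2)[of x' "dual_rca D" x] by (intro rel') simp
  next
    fix x x' assume *: "r = yel x * yel x' - yel x' * yel x" "x \<in> carrier_vec ?n" "x' \<in> carrier_vec ?n"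
    then show ?thesis using cherednik_relI(1)[of x' "dual_rca D" x] by (intro rel') simp
  next
    fix y x
    assume *: "r = yel y * xel x - xel x * yel y - (scal (rca_t D * (y \<bullet> x)) -
        (\<Sum>s\<in>reflections D. scal (rca_c D s * (y \<bullet> (x - ?C s *\<^sub>v x))) * gel s))"
      "y \<in> carrier_vec ?n" "x \<in> carrier_vec ?n"
    have "(\<Sum>s\<in>reflections D. scal (rca_c D s * (y \<bullet> (x - ?C s *\<^sub>v x))) * gel (inv\<^bsub>?G\<^esub> s)) =
        (\<Sum>s\<in>reflections D. scal (rca_c D (inv\<^bsub>?G\<^esub> s) * (x \<bullet> (y - contra ?G ?C s *\<^sub>v y))) * gel s)"
      by (rule sum.reindex_bij_witness[of _ "\<lambda>s. inv\<^bsub>?G\<^esub> s" "\<lambda>s. inv\<^bsub>?G\<^esub> s"])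
        (auto simp: reflections_closed reflections_inv pairing_contra[OF *(2,3)] contra_contra[OF group_D])
    then have "opp_free ?G r = yel x * xel y - xel y * yel x - (scal (rca_t D * (x \<bullet> y)) -
        (\<Sum>s\<in>reflections D. scal (rca_c D (inv\<^bsub>?G\<^esub> s) * (x \<bullet> (y - contra ?G ?C s *\<^sub>v y))) * gel s))"
      using * by (simp add: comm_scalar_prod[of y ?n x] scal_commute)
    then show ?thesis using *(2,3) cherednik_relI(3)[of x "dual_rca D" y]
      by (intro rel') (simp add: reflections_dual)
  qed
qed

lemma opp_word_closed:
  assumes "set (letters w) \<subseteq> gens D"
  shows "set (letters (opp_word (rca_grp D) w)) \<subseteq> gens D"
    "opp_word (rca_grp D) (opp_word (rca_grp D) w) = w"
proof -
  interpret group "rca_grp D" by (rule group_D)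
  have 1: "opp_gen (rca_grp D) l \<in> gens D \<and> opp_gen (rca_grp D) (opp_gen (rca_grp D) l) = l" if "l \<in> gens D" for l
    using that by (auto simp: gens_def)
  then show "set (letters (opp_word (rca_grp D) w)) \<subseteq> gens D"
    using assms by (auto simp: opp_word_def)
  have "map (opp_gen (rca_grp D) \<circ> opp_gen (rca_grp D)) (letters w) = letters w"
    using 1 assms by (intro map_idI) auto
  then show "opp_word (rca_grp D) (opp_word (rca_grp D) w) = w"
    by (cases w) (simp add: opp_word_def rev_map)
qed

lemma opp_free_closed: "a \<in> carrier F \<Longrightarrow> opp_free (rca_grp D) a \<in> carrier F"
  unfolding free_alg_carrier[of a]
  by (induction rule: poly_mapping_induct_on) (auto intro!: free_alg_closed opp_word_closed(1))

lemma opp_free_opp_free: "a \<in> carrier F \<Longrightarrow> opp_free (rca_grp D) (opp_free (rca_grp D) a) = a"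
  unfolding free_alg_carrier[of a]
  by (induction rule: poly_mapping_induct_on) (auto simp: opp_word_closed(2))

lemma opp_ideal:
  assumes "a \<in> cherednik_ideal D"
  shows "opp_free (rca_grp D) a \<in> cherednik_ideal (dual_rca D)"
proof -
  interpret D': rational_cherednik "dual_rca D" by (rule dual_rational_cherednik)
  let ?J = "{a \<in> carrier F. opp_free (rca_grp D) a \<in> cherednik_ideal (dual_rca D)}"
  have "ideal ?J F"
  proof (rule idealI_free_alg)
    fix a b assume "a \<in> ?J" and b: "b \<in> carrier F"
    then have *: "a \<in> carrier F" "opp_free (rca_grp D) a \<in> cherednik_ideal (dual_rca D)"
      "opp_free (rca_grp D) b \<in> carrier (free_alg (dual_rca D))"
      by (auto intro: opp_free_closed)
    show "a * b \<in> ?J" "b * a \<in> ?J"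
      using ideal.I_l_closed[OF D'.ideal_I *(2,3)] ideal.I_r_closed[OF D'.ideal_I *(2,3)] *(1) b
      by (auto intro: free_alg_closed)
  qed (auto intro: free_alg_closed D'.I_add D'.I_minus D'.I_zero)
  moreover have "smash_rels D \<union> cherednik_rels D \<subseteq> ?J"
    using rels_closed[OF group_D rep_D] opp_rels by blast
  ultimately show ?thesis using I_minimal assms by blast
qed

lemma opp_H_hcl:
  assumes "a \<in> carrier F"
  shows "opp_H D (hcl D a) = hcl (dual_rca D) (opp_free (rca_grp D) a)"
proof -
  interpret D': rational_cherednik "dual_rca D" by (rule dual_rational_cherednik)
  have "hcl (dual_rca D) (opp_free (rca_grp D) b) = hcl (dual_rca D) (opp_free (rca_grp D) a)"
    if "b \<in> hcl D a" for b
    using that assms opp_ideal[of "b - a"]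
    by (subst D'.hcl_eq_iff) (auto simp: hcl_eq_set opp_free_closed)
  moreover have "a \<in> hcl D a" using assms I_zero by (simp add: hcl_eq_set)
  ultimately show ?thesis unfolding opp_H_def by blast
qed

lemma double_dual_ideal: "cherednik_ideal (dual_rca (dual_rca D)) = cherednik_ideal D"
proof -
  interpret group "rca_grp D" by (rule group_D)
  interpret D': rational_cherednik "dual_rca D" by (rule dual_rational_cherednik)
  let ?G = "rca_grp D" let ?C = "contra ?G (rca_rep D)"
  have rep: "contra ?G ?C g = rca_rep D g" "contra ?G (contra ?G ?C) g = ?C g" if "g \<in> carrier ?G" for g
    using that by (simp_all add: contra_contra[OF group_D])
  have refl: "reflections (dual_rca (dual_rca D)) = reflections D"
    by (simp add: D'.reflections_dual reflections_dual)
  have "smash_rels (dual_rca (dual_rca D)) = smash_rels D"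
    unfolding smash_rels_def Let_def
    by (intro arg_cong2[where f="(\<union>)"] Collect_cong ex_cong1) (simp_all add: rep cong: rev_conj_cong)
  moreover have "(\<Sum>s\<in>reflections D. scal (rca_c D (inv\<^bsub>?G\<^esub> (inv\<^bsub>?G\<^esub> s)) * (y \<bullet> (x - contra ?G (contra ?G ?C) s *\<^sub>v x))) * gel s) =
      (\<Sum>s\<in>reflections D. scal (rca_c D s * (y \<bullet> (x - ?C s *\<^sub>v x))) * gel s)" for x y
    by (intro sum.cong) (simp_all add: rep reflections_closed)
  then have "cherednik_rels (dual_rca (dual_rca D)) = cherednik_rels D"
    unfolding cherednik_rels_def Let_def by (simp add: refl)
  ultimately show ?thesis unfolding cherednik_ideal_def by simp
qed

end

section \<open>The contravariant form is unique\<close>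

lemma linear_forms_add:
  "f \<in> linear_forms D \<tau> \<Longrightarrow> m \<in> carrier (verma D \<tau>) \<Longrightarrow> m' \<in> carrier (verma D \<tau>) \<Longrightarrow>
    f (m \<otimes>\<^bsub>verma D \<tau>\<^esub> m') = f m + f m'"
  by (simp add: linear_forms_def)

lemma restricted_dual_piece_zero:
  "f \<in> restricted_dual_piece D \<tau> i \<Longrightarrow> j \<noteq> i \<Longrightarrow> m \<in> verma_piece D \<tau> j \<Longrightarrow> f m = 0"
  by (simp add: restricted_dual_piece_def)

context verma_module
begin

lemma dual_verma_module: "verma_module (dual_rca D) (dual_rep (rca_grp D) \<tau>)"
  using is_rep_contra[OF group_D, of "fst \<tau>" "snd \<tau>"] rep_tau dual_rational_cherednik
  by (simp add: verma_module_def verma_module_axioms_def dual_rep_def)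

lemma xmon_piece:
  assumes "set ls \<subseteq> {..<rca_dim D}" "v \<in> T"
  shows "tens D \<tau> (hcl D (xmon ls)) v \<in> verma_piece D \<tau> (int (length ls))"
proof -
  have "sum_list (map gdeg (map GX ls)) = int (length ls)" by (induction ls) auto
  then have "hcl D (xmon ls) \<in> H_piece D (int (length ls))"
    using xmon_closed[OF assms(1)] unfolding H_piece_def by (auto simp: xmon_def comp_def)
  then show ?thesis unfolding verma_piece_def using assms(2) by (auto intro!: generate.incl)
qed

text \<open>A homomorphism is determined by its values on \<open>1 \<otimes> \<tau>\<close>. Such a value is a form of degree \<open>0\<close>: it vanishes
  on all monomials of positive length in \<open>h\<close> applied to \<open>\<tau>\<^sup>*\<close>, and on \<open>1 \<otimes> \<tau>\<^sup>*\<close> it is prescribed. These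
  monomials span the Verma module, so nothing is left to choose.\<close>

lemma contravariant_hom_unique:
  assumes \<phi>: "is_contravariant_hom D \<tau> \<phi>" and \<psi>: "is_contravariant_hom D \<tau> \<psi>"
  shows "\<phi> = \<psi>"
proof -
  interpret D': verma_module "dual_rca D" "dual_rep (rca_grp D) \<tau>" by (rule dual_verma_module)
  let ?R = "restricted_dual (dual_rca D) (dual_rep (rca_grp D) \<tau>)"
  note \<phi>' = \<phi>[unfolded is_contravariant_hom_def Let_def] and \<psi>' = \<psi>[unfolded is_contravariant_hom_def Let_def]
  have T': "D'.T = T" by (simp add: dual_rep_def)
  have base: "\<phi> (tens D \<tau> \<one>\<^bsub>H\<^esub> v) = \<psi> (tens D \<tau> \<one>\<^bsub>H\<^esub> v)" if v: "v \<in> T" for v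
  proof -
    let ?f = "\<phi> (tens D \<tau> \<one>\<^bsub>H\<^esub> v)" and ?g = "\<psi> (tens D \<tau> \<one>\<^bsub>H\<^esub> v)"
    have f: "?f \<in> restricted_dual_piece (dual_rca D) (dual_rep (rca_grp D) \<tau>) 0"
      "\<And>w. w \<in> T \<Longrightarrow> ?f (tens (dual_rca D) (dual_rep (rca_grp D) \<tau>) \<one>\<^bsub>D'.H\<^esub> w) = v \<bullet> w"
      using \<phi>' v by auto
    have g: "?g \<in> restricted_dual_piece (dual_rca D) (dual_rep (rca_grp D) \<tau>) 0"
      "\<And>w. w \<in> T \<Longrightarrow> ?g (tens (dual_rca D) (dual_rep (rca_grp D) \<tau>) \<one>\<^bsub>D'.H\<^esub> w) = v \<bullet> w"
      using \<psi>' v by auto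
    have fg: "?f \<in> linear_forms (dual_rca D) (dual_rep (rca_grp D) \<tau>)"
      "?g \<in> linear_forms (dual_rca D) (dual_rep (rca_grp D) \<tau>)"
      using f(1) g(1) by (auto simp: restricted_dual_piece_def)
    show ?thesis
    proof (rule extensionalityI[of _ "carrier D'.M"])
      show "?f \<in> extensional (carrier D'.M)" "?g \<in> extensional (carrier D'.M)"
        using fg by (auto simp: linear_forms_def)
      fix m assume "m \<in> carrier D'.M"
      then have "m \<in> D'.xspan" by (simp add: D'.verma_spanned)
      then show "?f m = ?g m"
      proof (induction rule: D'.xspan.induct)
        case (xmon ls w)
        show ?case
        proof (cases ls)
          case Nil
          then show ?thesis using f(2) g(2) xmon by (simp add: D'.xmon_Nil D'.hcl_one T')
        next
          case (Cons l ls')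
          then have "int (length ls) \<noteq> 0" by simp
          then show ?thesis
            using restricted_dual_piece_zero[OF f(1) _ D'.xmon_piece[OF xmon]]
              restricted_dual_piece_zero[OF g(1) _ D'.xmon_piece[OF xmon]] by simp
        qed
      next
        case (add m m')
        then show ?case
          using linear_forms_add[OF fg(1)] linear_forms_add[OF fg(2)] D'.xspan_closed by simp
      qed
    qed
  qed
  have eq: "\<phi> m = \<psi> m" if "m \<in> carrier M" for m
    using that
  proof (induction rule: verma_induct)
    case (tens h v)
    have "\<phi> (verma_act D \<tau> h (tens D \<tau> \<one>\<^bsub>H\<^esub> v)) = \<psi> (verma_act D \<tau> h (tens D \<tau> \<one>\<^bsub>H\<^esub> v))"
      using \<phi>' \<psi>' tens base[OF tens(2)] tens_closed[OF H_closed(3) tens(2)] by simp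
    then show ?case using tens by (simp flip: tens_eq_act)
  next
    case (add m m')
    then show ?case using \<phi>' \<psi>' by simp
  qed
  have "\<phi> \<in> carrier M \<rightarrow>\<^sub>E ?R" "\<psi> \<in> carrier M \<rightarrow>\<^sub>E ?R" using \<phi>' \<psi>' by simp_all
  then show ?thesis by (rule PiE_ext) (rule eq)
qed

lemma contravariant_hom_eq: "is_contravariant_hom D \<tau> \<phi> \<Longrightarrow> contravariant_hom D \<tau> = \<phi>"
  unfolding contravariant_hom_def by (rule the_equality) (auto intro: contravariant_hom_unique)

end

section \<open>Realizing the irreducible module\<close>

lemma is_rep_triv: "is_rep G triv_rep"
  by (simp add: is_rep_def triv_rep_def)

lemma triv_rep_simps [simp]: "fst triv_rep = 1" "snd triv_rep g = 1\<^sub>m 1"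
  by (simp_all add: triv_rep_def)

lemma dual_rep_triv [simp]: "dual_rep G triv_rep = triv_rep"
  by (simp add: dual_rep_def triv_rep_def contra_def)

definition homogeneous :: "('g, 'k::field) rca \<Rightarrow> int \<Rightarrow> ('g, 'k) falg set" where
  "homogeneous D i =
    {a \<in> carrier (free_alg D). \<forall>w\<in>Poly_Mapping.keys a. sum_list (map gdeg (letters w)) = i}"

lemma homogeneous_zero: "0 \<in> homogeneous D i"
  by (simp add: homogeneous_def free_alg_closed)

lemma homogeneous_single:
  "set (letters w) \<subseteq> gens D \<Longrightarrow> sum_list (map gdeg (letters w)) = i \<Longrightarrow>
    Poly_Mapping.single w a \<in> homogeneous D i"
  by (simp add: homogeneous_def free_alg_closed)

lemma homogeneous_single_if:
  assumes "set (letters w) \<subseteq> gens D" "a \<noteq> 0 \<Longrightarrow> sum_list (map gdeg (letters w)) = i"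
  shows "Poly_Mapping.single w a \<in> homogeneous D i"
  using assms by (cases "a = 0") (auto simp: homogeneous_zero intro: homogeneous_single)

lemma homogeneous_add: "a \<in> homogeneous D i \<Longrightarrow> b \<in> homogeneous D i \<Longrightarrow> a + b \<in> homogeneous D i"
  using keys_add[of a b] by (auto simp: homogeneous_def free_alg_closed)

text \<open>Operators on a graded space \<open>V\<close> with a vector \<open>v0\<close> that behaves like the generator of \<open>M(triv)\<close>. The
  defining relations of the algebra are kept apart, because for the dual space they follow from nondegeneracy.\<close>

locale graded_operators = rational_cherednik D + linear_operators scale opr
  for D :: "('g, 'k::field) rca" and scale :: "'k \<Rightarrow> 'v::ab_group_add \<Rightarrow> 'v"
    and opr :: "'g gen \<Rightarrow> 'v \<Rightarrow> 'v" +
  fixes v0 :: 'v and V :: "int \<Rightarrow> 'v set"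
  assumes gel_v0: "g \<in> carrier (rca_grp D) \<Longrightarrow> opr (GG g) v0 = v0"
    and yel_v0: "i < rca_dim D \<Longrightarrow> opr (GY i) v0 = 0"
    and V_zero: "0 \<in> V j"
    and V_add: "x \<in> V j \<Longrightarrow> y \<in> V j \<Longrightarrow> x + y \<in> V j"
    and V_scale: "x \<in> V j \<Longrightarrow> scale a x \<in> V j"
    and V_opr: "l \<in> gens D \<Longrightarrow> x \<in> V j \<Longrightarrow> opr l x \<in> V (j + gdeg l)"
    and V_v0: "v0 \<in> V 0"
begin

lemma V_sum: "(\<And>i. i \<in> J \<Longrightarrow> f i \<in> V j) \<Longrightarrow> sum f J \<in> V j"
  by (induction J rule: infinite_finite_induct) (auto intro: V_zero V_add)

lemma V_minus: "x \<in> V j \<Longrightarrow> - x \<in> V j"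
  using V_scale[of x j "-1"] by simp

lemma homogeneous_act:
  assumes "a \<in> homogeneous D i" "x \<in> V j"
  shows "alg_act a x \<in> V (j + i)"
proof -
  have word: "set ls \<subseteq> gens D \<Longrightarrow> foldr opr ls x \<in> V (j + sum_list (map gdeg ls))" for ls
  proof (induction ls)
    case Nil then show ?case using assms by simp
  next
    case (Cons l ls)
    then show ?case using V_opr[of l "foldr opr ls x" "j + sum_list (map gdeg ls)"] by (simp add: add_ac)
  qed
  have "word_act w x \<in> V (j + i)" if "w \<in> Poly_Mapping.keys a" for w
  proof -
    have "set (letters w) \<subseteq> gens D" "sum_list (map gdeg (letters w)) = i"
      using assms that by (auto simp: homogeneous_def free_alg_carrier)
    then show ?thesis using word[of "letters w"] by (simp add: word_act_def)
  qed
  then show ?thesis unfolding alg_act_def by (intro V_sum V_scale)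
qed

end

locale cherednik_module = graded_operators D scale opr v0 V
  for D :: "('g, 'k::field) rca" and scale :: "'k \<Rightarrow> 'v::ab_group_add \<Rightarrow> 'v"
    and opr :: "'g gen \<Rightarrow> 'v \<Rightarrow> 'v" and v0 V +
  assumes rel_zero: "r \<in> smash_rels D \<union> cherednik_rels D \<Longrightarrow> alg_act r x = 0"
begin

sublocale triv: verma_module D triv_rep
  by unfold_locales (rule is_rep_triv)

lemma ideal_act_zero:
  assumes "a \<in> cherednik_ideal D"
  shows "alg_act a x = 0"
proof -
  have "ideal {a \<in> carrier F. \<forall>x. alg_act a x = 0} F"
    by (rule idealI_free_alg) (auto intro: free_alg_closed)
  moreover have "smash_rels D \<union> cherednik_rels D \<subseteq> {a \<in> carrier F. \<forall>x. alg_act a x = 0}"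
    using rels_closed[OF group_D rep_D] rel_zero by blast
  ultimately show ?thesis using I_minimal assms by blast
qed

definition hact :: "('g, 'k) falg set \<Rightarrow> 'v \<Rightarrow> 'v" where
  "hact u = alg_act (SOME a. a \<in> carrier F \<and> u = hcl D a)"

lemma hact_hcl [simp]:
  assumes "a \<in> carrier F"
  shows "hact (hcl D a) x = alg_act a x"
proof -
  let ?b = "SOME b. b \<in> carrier F \<and> hcl D a = hcl D b"
  have "?b \<in> carrier F \<and> hcl D a = hcl D ?b"
    by (rule someI[of _ a]) (simp add: assms)
  then have "a - ?b \<in> cherednik_ideal D" using assms hcl_eq_iff by blast
  then have "alg_act (a - ?b) x = 0" by (rule ideal_act_zero)
  then show ?thesis by (simp add: hact_def)
qed

lemma hact_add_right: "u \<in> carrier H \<Longrightarrow> hact u (x + y) = hact u x + hact u y"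
  and hact_scale: "u \<in> carrier H \<Longrightarrow> hact u (scale a x) = scale a (hact u x)"
  and hact_add: "u \<in> carrier H \<Longrightarrow> u' \<in> carrier H \<Longrightarrow> hact (u \<oplus>\<^bsub>H\<^esub> u') x = hact u x + hact u' x"
  and hact_mult: "u \<in> carrier H \<Longrightarrow> u' \<in> carrier H \<Longrightarrow> hact (u \<otimes>\<^bsub>H\<^esub> u') x = hact u (hact u' x)"
  by (auto elim!: carrier_HE simp: free_alg_closed simp flip: hcl_add hcl_mult)

lemma hact_one [simp]: "hact \<one>\<^bsub>H\<^esub> x = x"
  using hact_hcl[OF free_alg_closed(1)] by (simp add: hcl_one)

lemma alg_act_yel_v0:
  assumes "y \<in> carrier_vec (rca_dim D)"
  shows "alg_act (yel y) v0 = 0"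
  using assms by (auto simp: yel_v0 intro!: sum.neutral)

definition is_realization :: "(('g, 'k) velt \<Rightarrow> 'v) \<Rightarrow> bool" where
  "is_realization \<Phi> \<longleftrightarrow>
    (\<forall>m\<in>carrier triv.M. \<forall>m'\<in>carrier triv.M. \<Phi> (m \<otimes>\<^bsub>triv.M\<^esub> m') = \<Phi> m + \<Phi> m') \<and>
    (\<forall>h\<in>carrier H. \<forall>v\<in>carrier_vec 1. \<Phi> (tens D triv_rep h v) = scale (v $ 0) (hact h v0))"

definition realize :: "('g, 'k) velt \<Rightarrow> 'v" where
  "realize = (SOME \<Phi>. is_realization \<Phi>)"

text \<open>The map \<open>h \<otimes> a \<mapsto> a h v0\<close> is balanced because \<open>G\<close> fixes \<open>v0\<close> and \<open>h\<close> annihilates it.\<close>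

lemma is_realization_realize: "is_realization realize"
proof -
  have "\<exists>\<Phi>. is_realization \<Phi>"
  proof (rule triv.verma_universal[of "\<lambda>h v. scale (v $ 0) (hact h v0)"], goal_cases)
    case (1 h h' v)
    then show ?case by (simp add: hact_add scale_right_distrib)
  next
    case (2 h v v')
    then show ?case by (simp add: scale_left_distrib)
  next
    case (3 h v a)
    then show ?case by (simp add: hact_mult triv.H_closed free_alg_closed hact_scale mult.commute)
  next
    case (4 h v g)
    then show ?case by (simp add: hact_mult triv.H_closed free_alg_closed gel_v0)
  next
    case (5 h v y)
    then have "hact h 0 = 0" using hact_scale[of h 0 v0] by simp
    then show ?case using 5
      by (simp add: hact_mult triv.H_closed free_alg_closed_xel alg_act_yel_v0 del: alg_act_yel)
  next
    case (6 \<Phi>)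
    then show ?case unfolding is_realization_def by (intro exI[of _ \<Phi>]) simp
  qed
  then show ?thesis unfolding realize_def by (rule someI_ex)
qed

lemma realize_add: "m \<in> carrier triv.M \<Longrightarrow> m' \<in> carrier triv.M \<Longrightarrow>
    realize (m \<otimes>\<^bsub>triv.M\<^esub> m') = realize m + realize m'"
  and realize_tens: "h \<in> carrier H \<Longrightarrow> v \<in> carrier_vec 1 \<Longrightarrow>
    realize (tens D triv_rep h v) = scale (v $ 0) (hact h v0)"
  using is_realization_realize by (auto simp: is_realization_def)

lemma realize_one: "realize \<one>\<^bsub>triv.M\<^esub> = 0"
proof -
  interpret group triv.M by (rule triv.group_M)
  show ?thesis using realize_add[of "\<one>\<^bsub>triv.M\<^esub>" "\<one>\<^bsub>triv.M\<^esub>"] by simp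
qed

lemma realize_inv:
  assumes "m \<in> carrier triv.M"
  shows "realize (inv\<^bsub>triv.M\<^esub> m) = - realize m"
proof -
  interpret group triv.M by (rule triv.group_M)
  show ?thesis using realize_add[of m "inv\<^bsub>triv.M\<^esub> m"] assms realize_one
    by (simp add: eq_neg_iff_add_eq_0 add.commute)
qed

lemma realize_act:
  assumes "u \<in> carrier H" "m \<in> carrier triv.M"
  shows "realize (verma_act D triv_rep u m) = hact u (realize m)"
  using assms(2)
proof (induction rule: triv.verma_induct)
  case (tens h v)
  then show ?case using assms(1)
    by (simp add: triv.verma_act_tens realize_tens triv.H_closed hact_mult hact_scale)
next
  case (add m m')
  then show ?case using assms(1)
    by (simp add: triv.verma_act_add realize_add triv.verma_act_closed hact_add_right)
qed

lemma H_piece_homogeneous: "H_piece D i = hcl D ` homogeneous D i"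
  by (simp add: H_piece_def homogeneous_def)

lemma homogeneous_closed: "a \<in> homogeneous D i \<Longrightarrow> a \<in> carrier F"
  by (simp add: homogeneous_def)

lemma verma_piece_closed: "m \<in> verma_piece D triv_rep i \<Longrightarrow> m \<in> carrier triv.M"
  unfolding verma_piece_def
  by (rule group.generate_in_carrier[OF triv.group_M])
    (auto simp: H_piece_homogeneous intro!: triv.tens_closed hcl_closed homogeneous_closed)

lemma realize_piece:
  assumes "m \<in> verma_piece D triv_rep i"
  shows "realize m \<in> V i"
  using assms unfolding verma_piece_def
proof (induction rule: generate.induct)
  case one then show ?case by (simp add: realize_one V_zero)
next
  have *: "realize h \<in> V i \<and> h \<in> carrier triv.M"
    if "h \<in> {tens D triv_rep h v |h v. h \<in> H_piece D i \<and> v \<in> carrier_vec (fst triv_rep)}" for h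
  proof -
    obtain a v where "a \<in> homogeneous D i" "v \<in> carrier_vec 1" "h = tens D triv_rep (hcl D a) v"
      using \<open>h \<in> _\<close> by (auto simp: H_piece_homogeneous)
    then show ?thesis using homogeneous_act[OF _ V_v0, of a i] homogeneous_closed[of a i]
      by (auto simp: realize_tens hcl_closed V_scale intro!: triv.tens_closed)
  qed
  { case (incl h) then show ?case using * by blast }
  { case (inv h) then show ?case using * by (simp add: realize_inv V_minus) }
next
  case (eng h1 h2)
  then show ?case using verma_piece_closed[unfolded verma_piece_def]
    by (auto simp: realize_add V_add)
qed

end

text \<open>A module \<open>V\<close> together with a space \<open>V'\<close> on which generators act by the adjoints of their opposites. Generation of
  \<open>V\<close> is required degree by degree, since the graded pieces of the Verma module must map onto those of
  \<open>V\<close>; for \<open>V'\<close> it is enough that every vector is reached.\<close>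

locale contravariant_pair =
  cherednik_module D scale opr v0 V + P: graded_operators "dual_rca D" scale' opr' e0 V'
  for D :: "('g, 'k::field) rca"
    and scale :: "'k \<Rightarrow> 'v::ab_group_add \<Rightarrow> 'v" and opr :: "'g gen \<Rightarrow> 'v \<Rightarrow> 'v" and v0 V
    and scale' :: "'k \<Rightarrow> 'w::ab_group_add \<Rightarrow> 'w" and opr' :: "'g gen \<Rightarrow> 'w \<Rightarrow> 'w" and e0 V' +
  fixes pair :: "'w \<Rightarrow> 'v \<Rightarrow> 'k"
  assumes pair_add_left: "pair (f + f') x = pair f x + pair f' x"
    and pair_add_right: "pair f (x + x') = pair f x + pair f x'"
    and pair_scale_left: "pair (scale' a f) x = a * pair f x"
    and pair_scale_right: "pair f (scale a x) = a * pair f x"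
    and pair_adjoint: "l \<in> gens D \<Longrightarrow> pair (opr' l f) x = pair f (opr (opp_gen (rca_grp D) l) x)"
    and pair_nondegenerate_left: "(\<And>x. pair f x = 0) \<Longrightarrow> f = 0"
    and pair_nondegenerate_right: "(\<And>f. pair f x = 0) \<Longrightarrow> x = 0"
    and pair_graded: "i \<noteq> j \<Longrightarrow> f \<in> V' i \<Longrightarrow> x \<in> V j \<Longrightarrow> pair f x = 0"
    and pair_v0: "pair e0 v0 = 1"
    and V_finite: "\<exists>J. finite J \<and> (\<forall>x. \<exists>f. (\<forall>j\<in>J. f j \<in> V j) \<and> x = (\<Sum>j\<in>J. f j))"
    and V_generated: "x \<in> V i \<Longrightarrow> \<exists>a\<in>homogeneous D i. alg_act a v0 = x"
    and V'_generated: "\<exists>a\<in>carrier (free_alg D). P.alg_act a e0 = f"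
begin

lemma pair_zero [simp]: "pair 0 x = 0" "pair f 0 = 0"
  using pair_scale_left[of 0 0 x] pair_scale_right[of f 0 0] by simp_all

lemma pair_sum_right: "pair f (sum h J) = (\<Sum>j\<in>J. pair f (h j))"
  by (induction J rule: infinite_finite_induct) (auto simp: pair_add_right)

lemma pair_alg_act:
  assumes "b \<in> carrier F"
  shows "pair (P.alg_act b f) x = pair f (alg_act (opp_free (rca_grp D) b) x)"
  using assms unfolding free_alg_carrier
proof (induction rule: poly_mapping_induct_on)
  case (single w c)
  have "pair (foldr opr' ls f) x = pair f (foldr opr (rev (map (opp_gen (rca_grp D)) ls)) x)"
    if "set ls \<subseteq> gens D" for ls
    using that by (induction ls arbitrary: x) (auto simp: pair_adjoint)
  then show ?case using single
    by (simp add: pair_scale_left pair_scale_right P.word_act_def word_act_def opp_word_def)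
qed (auto simp: pair_add_left pair_add_right)

text \<open>A relation of the dual algebra acts on \<open>V'\<close> by the adjoint of a relation that is zero on \<open>V\<close>.\<close>

sublocale P: cherednik_module "dual_rca D" scale' opr' e0 V'
proof unfold_locales
  fix r f assume r: "r \<in> smash_rels (dual_rca D) \<union> cherednik_rels (dual_rca D)"
  have "r \<in> carrier F"
    using rels_closed[OF P.group_D P.rep_D] r by auto
  moreover have "opp_free (rca_grp D) r \<in> cherednik_ideal D"
    using P.opp_rels[OF r] double_dual_ideal by simp
  ultimately show "P.alg_act r f = 0"
    by (intro pair_nondegenerate_left) (simp add: pair_alg_act ideal_act_zero)
qed

definition form :: "('g, 'k) velt \<Rightarrow> ('g, 'k) velt \<Rightarrow> 'k" where
  "form = (\<lambda>m\<in>carrier triv.M. \<lambda>m'\<in>carrier P.triv.M. pair (P.realize m') (realize m))"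

lemma realize_surj_piece:
  assumes "x \<in> V i"
  shows "\<exists>m\<in>verma_piece D triv_rep i. realize m = x"
proof -
  obtain a where a: "a \<in> homogeneous D i" "alg_act a v0 = x" using V_generated[OF assms] by blast
  then have "realize (tens D triv_rep (hcl D a) (unit_vec 1 0)) = x"
    using homogeneous_closed[OF a(1)] by (simp add: realize_tens hcl_closed)
  moreover have "hcl D a \<in> H_piece D i" "unit_vec 1 0 \<in> carrier_vec (fst triv_rep)"
    using a by (simp_all add: H_piece_homogeneous)
  then have "tens D triv_rep (hcl D a) (unit_vec 1 0) \<in> verma_piece D triv_rep i"
    unfolding verma_piece_def by (intro generate.incl) blast
  ultimately show ?thesis by blast
qed

lemma realize_surj: "\<exists>m\<in>carrier triv.M. realize m = x"
proof -
  interpret group triv.M by (rule triv.group_M)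
  obtain J f where J: "finite J" "\<forall>j\<in>J. f j \<in> V j" "x = (\<Sum>j\<in>J. f j)" using V_finite by metis
  have "\<exists>m\<in>carrier triv.M. realize m = (\<Sum>j\<in>J'. f j)" if "finite J'" "J' \<subseteq> J" for J'
    using that
  proof (induction J')
    case empty
    then show ?case using realize_one by (intro bexI[of _ "\<one>\<^bsub>triv.M\<^esub>"]) auto
  next
    case (insert j J')
    then obtain m where m: "m \<in> carrier triv.M" "realize m = (\<Sum>j\<in>J'. f j)" by auto
    obtain m' where m': "m' \<in> carrier triv.M" "realize m' = f j"
      using realize_surj_piece[of "f j" j] J insert.prems verma_piece_closed by blast
    show ?case using insert m m'
      by (intro bexI[of _ "m' \<otimes>\<^bsub>triv.M\<^esub> m"]) (auto simp: realize_add)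
  qed
  then show ?thesis using J by auto
qed

lemma P_realize_surj: "\<exists>m\<in>carrier P.triv.M. P.realize m = f"
proof -
  obtain a where a: "a \<in> carrier F" "P.alg_act a e0 = f" using V'_generated by blast
  then have "P.realize (tens (dual_rca D) triv_rep (hcl (dual_rca D) a) (unit_vec 1 0)) = f"
    by (simp add: P.realize_tens P.hcl_closed)
  moreover have "tens (dual_rca D) triv_rep (hcl (dual_rca D) a) (unit_vec 1 0) \<in> carrier P.triv.M"
    using a by (auto intro!: P.triv.tens_closed P.hcl_closed)
  ultimately show ?thesis by blast
qed

lemma is_contravariant_hom_form: "is_contravariant_hom D triv_rep form"
proof -
  interpret M: group triv.M by (rule triv.group_M)
  interpret M': group P.triv.M by (rule P.triv.group_M)
  have linear: "form m \<in> linear_forms (dual_rca D) triv_rep" if "m \<in> carrier triv.M" for m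
    using that unfolding linear_forms_def
    by (auto simp: form_def P.realize_add pair_add_left P.triv.verma_act_closed P.triv.H_closed
        P.realize_act free_alg_closed pair_scale_left)
  have restricted: "form m \<in> restricted_dual (dual_rca D) triv_rep" if m: "m \<in> carrier triv.M" for m
  proof -
    obtain J f where J: "finite J" "\<forall>j\<in>J. f j \<in> V j" "realize m = (\<Sum>j\<in>J. f j)" using V_finite by metis
    have "form m m' = 0" if "i \<notin> J" "m' \<in> verma_piece (dual_rca D) triv_rep i" for i m'
    proof -
      have "pair (P.realize m') (f j) = 0" if "j \<in> J" for j
        using pair_graded[of i j] \<open>i \<notin> J\<close> that J(2) P.realize_piece[OF \<open>m' \<in> _\<close>] by blast
      then show ?thesis using m P.verma_piece_closed[OF \<open>m' \<in> _\<close>] J(3)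
        by (simp add: form_def pair_sum_right)
    qed
    then have "{i. \<exists>m'\<in>verma_piece (dual_rca D) triv_rep i. form m m' \<noteq> 0} \<subseteq> J" by blast
    then show ?thesis using linear[OF m] J(1) finite_subset unfolding restricted_dual_def by blast
  qed
  have dagger: "form (verma_act D triv_rep u m) = dagger_act D triv_rep u (form m)"
    if u: "u \<in> carrier H" and m: "m \<in> carrier triv.M" for u m
  proof -
    obtain a where a: "a \<in> carrier F" "u = hcl D a" using u by (rule carrier_HE)
    then have "opp_free (rca_grp D) a \<in> carrier F" by (simp add: opp_free_closed)
    then show ?thesis using a u m unfolding dagger_act_def dual_rep_triv
      by (auto simp: form_def opp_H_hcl realize_act P.realize_act triv.verma_act_closed P.hcl_closed
          P.triv.verma_act_closed pair_alg_act opp_free_opp_free fun_eq_iff)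
  qed
  have base: "form (tens D triv_rep \<one>\<^bsub>H\<^esub> v) \<in> restricted_dual_piece (dual_rca D) triv_rep 0"
    "form (tens D triv_rep \<one>\<^bsub>H\<^esub> v) (tens (dual_rca D) triv_rep \<one>\<^bsub>P.H\<^esub> w) = v \<bullet> w"
    if v: "v \<in> carrier_vec 1" and w: "w \<in> carrier_vec 1" for v w
  proof -
    have t: "tens D triv_rep \<one>\<^bsub>H\<^esub> v \<in> carrier triv.M" "realize (tens D triv_rep \<one>\<^bsub>H\<^esub> v) = scale (v $ 0) v0"
      using v by (simp_all add: triv.tens_closed triv.H_closed realize_tens)
    have t': "tens (dual_rca D) triv_rep \<one>\<^bsub>P.H\<^esub> w \<in> carrier P.triv.M"
      "P.realize (tens (dual_rca D) triv_rep \<one>\<^bsub>P.H\<^esub> w) = scale' (w $ 0) e0"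
      using w by (simp_all add: P.triv.tens_closed P.triv.H_closed P.realize_tens)
    show "form (tens D triv_rep \<one>\<^bsub>H\<^esub> v) (tens (dual_rca D) triv_rep \<one>\<^bsub>P.H\<^esub> w) = v \<bullet> w"
      using t t' v w by (simp add: form_def pair_scale_left pair_scale_right pair_v0 scalar_prod_def)
    have "form (tens D triv_rep \<one>\<^bsub>H\<^esub> v) m' = 0"
      if "j \<noteq> 0" "m' \<in> verma_piece (dual_rca D) triv_rep j" for j m'
      using t pair_graded[OF that(1) P.realize_piece[OF that(2)] V_v0] P.verma_piece_closed[OF that(2)]
      by (simp add: form_def pair_scale_right)
    then show "form (tens D triv_rep \<one>\<^bsub>H\<^esub> v) \<in> restricted_dual_piece (dual_rca D) triv_rep 0"
      using linear[OF t(1)] by (auto simp: restricted_dual_piece_def)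
  qed
  have add: "form (m \<otimes>\<^bsub>triv.M\<^esub> m') = (\<lambda>x\<in>carrier P.triv.M. form m x + form m' x)"
    if "m \<in> carrier triv.M" "m' \<in> carrier triv.M" for m m'
    using that by (auto simp: form_def realize_add pair_add_right fun_eq_iff)
  have ext: "form \<in> carrier triv.M \<rightarrow>\<^sub>E restricted_dual (dual_rca D) triv_rep"
    using restricted by (auto simp: form_def PiE_iff)
  show ?thesis
    unfolding is_contravariant_hom_def Let_def dual_rep_triv triv_rep_simps
    by (intro conjI ballI ext add dagger base(1)[OF _ unit_vec_carrier[of 1 0]] base(2))
qed

text \<open>The contravariant form is the pullback of the pairing. As the dual Verma module covers all of \<open>V'\<close> and the pairing is
  nondegenerate, an element is in the radical exactly when its image in \<open>V\<close> is zero.\<close>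

lemma ker_B_eq: "ker_B D triv_rep = {m \<in> carrier triv.M. realize m = 0}"
proof -
  have "contravariant_hom D triv_rep = form"
    by (rule triv.contravariant_hom_eq[OF is_contravariant_hom_form])
  moreover have "realize m = 0" if "m \<in> carrier triv.M" "\<forall>m'\<in>carrier P.triv.M. form m m' = 0" for m
  proof (rule pair_nondegenerate_right)
    fix f show "pair f (realize m) = 0"
      using P_realize_surj[of f] that by (auto simp: form_def)
  qed
  ultimately show ?thesis unfolding ker_B_def by (auto simp: form_def)
qed

text \<open>The cosets of \<open>ker_B\<close> are the fibres of \<open>realize\<close>, so \<open>fibre\<close> is the isomorphism from \<open>V\<close> to \<open>L(triv)\<close>.\<close>

definition fibre :: "'v \<Rightarrow> ('g, 'k) velt set" where
  "fibre x = {m \<in> carrier triv.M. realize m = x}"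

lemma fibre_inject: "fibre x = fibre y \<longleftrightarrow> x = y"
  using realize_surj[of x] unfolding fibre_def by auto

lemma coset_ker_B:
  assumes m: "m \<in> carrier triv.M"
  shows "ker_B D triv_rep #>\<^bsub>triv.M\<^esub> m = fibre (realize m)"
proof -
  interpret group triv.M by (rule triv.group_M)
  have "m' \<in> ker_B D triv_rep #>\<^bsub>triv.M\<^esub> m" if "m' \<in> fibre (realize m)" for m'
  proof -
    have "m' \<otimes>\<^bsub>triv.M\<^esub> inv\<^bsub>triv.M\<^esub> m \<in> ker_B D triv_rep"
      using that m by (auto simp: ker_B_eq fibre_def realize_add realize_inv)
    moreover have "m' = m' \<otimes>\<^bsub>triv.M\<^esub> inv\<^bsub>triv.M\<^esub> m \<otimes>\<^bsub>triv.M\<^esub> m"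
      using that m by (auto simp: fibre_def m_assoc)
    ultimately show ?thesis unfolding r_coset_def by blast
  qed
  then show ?thesis using m by (auto simp: r_coset_def ker_B_eq fibre_def realize_add)
qed

lemma fibre_add: "fibre x \<otimes>\<^bsub>L_module D triv_rep\<^esub> fibre y = fibre (x + y)"
proof -
  interpret group triv.M by (rule triv.group_M)
  have "m \<in> fibre x <#>\<^bsub>triv.M\<^esub> fibre y" if m: "m \<in> fibre (x + y)" for m
  proof -
    obtain b where b: "b \<in> carrier triv.M" "realize b = y" using realize_surj by blast
    have "m \<otimes>\<^bsub>triv.M\<^esub> inv\<^bsub>triv.M\<^esub> b \<in> fibre x" "b \<in> fibre y"
      using b m by (auto simp: fibre_def realize_add realize_inv)
    moreover have "m = m \<otimes>\<^bsub>triv.M\<^esub> inv\<^bsub>triv.M\<^esub> b \<otimes>\<^bsub>triv.M\<^esub> b"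
      using b m by (auto simp: fibre_def m_assoc)
    ultimately show ?thesis unfolding set_mult_def by blast
  qed
  then show ?thesis by (auto simp: L_module_def set_mult_def fibre_def realize_add)
qed

lemma fibre_act:
  assumes "a \<in> carrier F"
  shows "L_act D triv_rep (hcl D a) (fibre x) = fibre (alg_act a x)"
proof -
  have "ker_B D triv_rep #>\<^bsub>triv.M\<^esub> verma_act D triv_rep (hcl D a) m = fibre (alg_act a x)"
    if "m \<in> fibre x" for m
    using that assms
    by (auto simp: fibre_def coset_ker_B triv.verma_act_closed hcl_closed realize_act)
  moreover have "fibre x \<noteq> {}" using realize_surj[of x] by (auto simp: fibre_def)
  ultimately show ?thesis unfolding L_act_def by auto
qed

lemma L_piece_space: "rep_space (L_piece D triv_rep i) = fibre ` V i"
proof -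
  have "rep_space (L_piece D triv_rep i) = (\<lambda>m. fibre (realize m)) ` verma_piece D triv_rep i"
    unfolding L_piece_def using verma_piece_closed by (auto simp: coset_ker_B intro!: image_cong)
  moreover have "realize ` verma_piece D triv_rep i = V i"
    using realize_surj_piece realize_piece by blast
  ultimately show ?thesis by (metis image_image)
qed

theorem L_piece_isomorphic:
  assumes bij: "bij_betw \<psi> (carrier_vec d) (V i)"
    and add: "\<And>u v. u \<in> carrier_vec d \<Longrightarrow> v \<in> carrier_vec d \<Longrightarrow> \<psi> (u + v) = \<psi> u + \<psi> v"
    and scale: "\<And>a v. v \<in> carrier_vec d \<Longrightarrow> \<psi> (a \<cdot>\<^sub>v v) = scale a (\<psi> v)"
  shows "is_linear_iso d (L_piece D triv_rep i) (\<lambda>v. fibre (\<psi> v))"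
    and "(\<And>g v. g \<in> carrier (rca_grp D) \<Longrightarrow> v \<in> carrier_vec d \<Longrightarrow> \<psi> (W g *\<^sub>v v) = opr (GG g) (\<psi> v)) \<Longrightarrow>
      isomorphic_rep (rca_grp D) (d, W) (L_piece D triv_rep i)"
proof -
  have "inj_on fibre (V i)" by (auto simp: inj_on_def fibre_inject)
  then have "bij_betw (fibre \<circ> \<psi>) (carrier_vec d) (fibre ` V i)"
    using bij by (intro bij_betw_trans[OF bij]) (auto simp: bij_betw_def)
  then have "bij_betw (\<lambda>v. fibre (\<psi> v)) (carrier_vec d) (rep_space (L_piece D triv_rep i))"
    by (simp add: L_piece_space comp_def)
  then show iso: "is_linear_iso d (L_piece D triv_rep i) (\<lambda>v. fibre (\<psi> v))"
    unfolding is_linear_iso_def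
    by (simp add: add scale L_piece_def fibre_add fibre_act free_alg_closed)
  assume "\<And>g v. g \<in> carrier (rca_grp D) \<Longrightarrow> v \<in> carrier_vec d \<Longrightarrow> \<psi> (W g *\<^sub>v v) = opr (GG g) (\<psi> v)"
  then show "isomorphic_rep (rca_grp D) (d, W) (L_piece D triv_rep i)"
    unfolding isomorphic_rep_def using iso
    by (intro exI[of _ "\<lambda>v. fibre (\<psi> v)"]) (auto simp: L_piece_def fibre_act free_alg_closed)
qed

end

section \<open>The Grothendieck group\<close>

context
  fixes G :: "('g, 'b) monoid_scheme"
begin

abbreviation K0_gens :: "(('g, 'k::field) mrep \<Rightarrow>\<^sub>0 int) set" where
  "K0_gens \<equiv> {frag_of V - frag_of U - frag_of W | U V W.
     is_rep G U \<and> is_rep G V \<and> is_rep G W \<and> short_exact G U V W}"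

lemma K0_gens_closed: "K0_gens \<subseteq> carrier (K0_free G)"
proof
  fix r :: "('g, 'k::field) mrep \<Rightarrow>\<^sub>0 int" assume "r \<in> K0_gens"
  then obtain U V W where r: "r = frag_of V - frag_of U - frag_of W" and *: "is_rep G U" "is_rep G V" "is_rep G W"
    by blast
  have "Poly_Mapping.keys r \<subseteq> {V, U, W}"
    unfolding r using keys_diff[of "frag_of V - frag_of U" "frag_of W"] keys_diff[of "frag_of V" "frag_of U"] by auto
  then show "r \<in> carrier (K0_free G)" using * by (auto simp: K0_free_def)
qed

lemma group_K0_free: "group (K0_free G)"
  by (simp add: K0_free_def)

lemma subgroup_K0_rel: "subgroup (K0_rel G) (K0_free G)"
  unfolding K0_rel_def by (rule group.generate_is_subgroup[OF group_K0_free K0_gens_closed])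

lemma normal_K0_rel: "K0_rel G \<lhd> K0_free G"
  by (rule group.normalI[OF group_K0_free subgroup_K0_rel])
    (auto simp: r_coset_def l_coset_def K0_free_def add.commute)

lemma comm_group_K0: "comm_group (K0 G :: (('g, 'k::field) mrep \<Rightarrow>\<^sub>0 int) set monoid)"
  unfolding K0_def
  by (rule comm_group.abelian_FactGroup[OF _ subgroup_K0_rel])
    (simp add: K0_free_def abelian_free_Abelian_group)

lemma K0_class_closed: "is_rep G V \<Longrightarrow> K0_class G V \<in> carrier (K0 G)"
  by (simp add: K0_class_def K0_def carrier_FactGroup K0_free_def)

lemma K0_class_exact:
  assumes "is_rep G U" "is_rep G V" "is_rep G W" "short_exact G U V W"
  shows "K0_class G V = K0_class G U \<otimes>\<^bsub>K0 G\<^esub> K0_class G W"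
proof -
  interpret group "K0_free G" by (rule group_K0_free)
  have c: "frag_of U \<in> carrier (K0_free G)" "frag_of V \<in> carrier (K0_free G)"
    "frag_of W \<in> carrier (K0_free G)"
    using assms by (simp_all add: K0_free_def)
  have "frag_of V - frag_of U - frag_of W \<in> K0_rel G"
    unfolding K0_rel_def using assms by (intro generate.incl) blast
  then have "frag_of V \<in> K0_rel G #>\<^bsub>K0_free G\<^esub> (frag_of U \<otimes>\<^bsub>K0_free G\<^esub> frag_of W)"
    unfolding r_coset_def by (intro UN_I) (auto simp: K0_free_def)
  then have "K0_rel G #>\<^bsub>K0_free G\<^esub> (frag_of U \<otimes>\<^bsub>K0_free G\<^esub> frag_of W) = K0_rel G #>\<^bsub>K0_free G\<^esub> frag_of V"
    using c by (intro repr_independence subgroup_K0_rel) auto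
  then show ?thesis
    using normal.rcos_sum[OF normal_K0_rel c(1,3)] by (simp add: K0_class_def K0_def)
qed

lemma K0_class_zero:
  assumes "is_rep G (0, \<sigma>)"
  shows "K0_class G (0, \<sigma>) = \<one>\<^bsub>K0 G\<^esub>"
proof -
  interpret comm_group "K0 G" by (rule comm_group_K0)
  have v: "v = u" if "v \<in> carrier_vec 0" "u \<in> carrier_vec 0" for u v :: "'c::field vec"
    using that by (auto simp: vec_eq_iff)
  have "\<sigma> g \<in> carrier_mat 0 0" if "g \<in> carrier G" for g using assms that by (auto simp: is_rep_def)
  then have "short_exact G (0, \<sigma>) (0, \<sigma>) (0, \<sigma>)"
    unfolding short_exact_def
    by (intro bexI[of _ "0\<^sub>m 0 0"]) (auto simp: inj_on_def mat_eq_iff vec_eq_iff image_iff intro!: mult_mat_vec_carrier[of _ 0 0])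
  then have "K0_class G (0, \<sigma>) = K0_class G (0, \<sigma>) \<otimes>\<^bsub>K0 G\<^esub> K0_class G (0, \<sigma>)"
    by (intro K0_class_exact assms)
  then show ?thesis using K0_class_closed[OF assms] by (metis l_cancel_one')
qed

end

subsection \<open>Linear maps as matrices\<close>

definition matrix_of :: "nat \<Rightarrow> nat \<Rightarrow> ('k::field vec \<Rightarrow> 'k vec) \<Rightarrow> 'k mat" where
  "matrix_of d' d S = mat d' d (\<lambda>(i, j). S (unit_vec d j) $ i)"

lemma matrix_of_carrier [simp]: "matrix_of d' d S \<in> carrier_mat d' d"
  by (simp add: matrix_of_def)

lemma matrix_of_mult:
  assumes closed: "\<And>v. v \<in> carrier_vec d \<Longrightarrow> S v \<in> carrier_vec d'"
    and add: "\<And>u v. u \<in> carrier_vec d \<Longrightarrow> v \<in> carrier_vec d \<Longrightarrow> S (u + v) = S u + S v"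
    and scale: "\<And>a v. v \<in> carrier_vec d \<Longrightarrow> S (a \<cdot>\<^sub>v v) = a \<cdot>\<^sub>v S v"
    and v: "v \<in> carrier_vec d"
  shows "matrix_of d' d S *\<^sub>v v = S v"
proof -
  let ?w = "\<lambda>k. vec d (\<lambda>i. if i < k then v $ i else 0)"
  have "S (?w k) = matrix_of d' d S *\<^sub>v ?w k" if "k \<le> d" for k
    using that
  proof (induction k)
    case 0
    have "?w 0 = 0 \<cdot>\<^sub>v v" using v by auto
    then have "S (?w 0) = 0 \<cdot>\<^sub>v S v" using scale[OF v] by simp
    also have "\<dots> = 0\<^sub>v d'" using closed[OF v] by auto
    finally show ?case by (auto simp: scalar_prod_def matrix_of_def)
  next
    case (Suc k)
    have w: "?w (Suc k) = ?w k + v $ k \<cdot>\<^sub>v unit_vec d k" using Suc.prems by (auto simp: less_Suc_eq)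
    have col: "matrix_of d' d S *\<^sub>v unit_vec d k = S (unit_vec d k)"
      using Suc.prems closed[of "unit_vec d k"] by (auto simp: matrix_of_def)
    have "S (?w (Suc k)) = S (?w k) + v $ k \<cdot>\<^sub>v S (unit_vec d k)"
      unfolding w by (simp add: add scale)
    also have "\<dots> = matrix_of d' d S *\<^sub>v ?w k + v $ k \<cdot>\<^sub>v (matrix_of d' d S *\<^sub>v unit_vec d k)"
      using Suc by (simp add: col)
    also have "\<dots> = matrix_of d' d S *\<^sub>v ?w (Suc k)"
      unfolding w using mult_add_distrib_mat_vec[of "matrix_of d' d S" d' d "?w k" "v $ k \<cdot>\<^sub>v unit_vec d k"]
        mult_mat_vec[of "matrix_of d' d S" d' d "unit_vec d k" "v $ k"] by simp
    finally show ?case .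
  qed
  moreover have "?w d = v" using v by auto
  ultimately show ?thesis by (metis order_refl)
qed

text \<open>A matrix with more columns than rows has no left inverse; the proof is by determinants.\<close>

lemma linear_injection_dim_le:
  fixes B C :: "'a::field mat"
  assumes B: "B \<in> carrier_mat d d'" and C: "C \<in> carrier_mat d' d" and CB: "C * B = 1\<^sub>m d'"
  shows "d' \<le> (d::nat)"
proof (rule ccontr)
  assume "\<not> d' \<le> d"
  then have d: "d < d'" by simp
  \<comment> \<open>Padding with zeros makes both matrices square, but leaves a zero column in the second one.\<close>
  let ?B = "mat d' d' (\<lambda>(i, j). if i < d then B $$ (i, j) else (0::'a))"
  let ?C = "mat d' d' (\<lambda>(i, j). if j < d then C $$ (i, j) else (0::'a))"
  have "?C * ?B = C * B"
  proof (rule eq_matI)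
    fix i j assume ij: "i < dim_row (C * B)" "j < dim_col (C * B)"
    have "(\<Sum>k = 0..<d'. (if k < d then C $$ (i, k) * B $$ (k, j) else 0)) = (\<Sum>k = 0..<d. C $$ (i, k) * B $$ (k, j))"
      using d by (intro sum.mono_neutral_cong_right) auto
    moreover have "(\<Sum>k = 0..<d'. (if k < d then C $$ (i, k) else 0) * (if k < d then B $$ (k, j) else 0)) =
        (\<Sum>k = 0..<d'. (if k < d then C $$ (i, k) * B $$ (k, j) else 0))"
      by (intro sum.cong) auto
    ultimately show "(?C * ?B) $$ (i, j) = (C * B) $$ (i, j)"
      using ij B C d by (simp add: scalar_prod_def)
  qed (use B C in auto)
  then have "det ?C * det ?B = 1"
    using CB det_mult[of ?C d' ?B] by simp
  moreover have "?C *\<^sub>v unit_vec d' d = 0\<^sub>v d'" using d by auto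
  then have "det ?C = 0"
    using det_0_iff_vec_prod_zero_field[of ?C d'] d unit_vec_nonzero[of d d'] by (auto intro!: exI[of _ "unit_vec d' d"])
  ultimately show False by simp
qed

text \<open>Two coordinate systems on the same space differ by an invertible linear map. This makes the dimension of
  \<open>V\<close> and its class in \<open>K\<^sub>0\<close> independent of the coordinates.\<close>

lemma is_linear_iso_transfer:
  assumes T: "is_linear_iso d V T" and T': "is_linear_iso d' V T'"
  shows "\<exists>S. bij_betw S (carrier_vec d) (carrier_vec d') \<and>
    (\<forall>u\<in>carrier_vec d. \<forall>v\<in>carrier_vec d. S (u + v) = S u + S v) \<and>
    (\<forall>a. \<forall>v\<in>carrier_vec d. S (a \<cdot>\<^sub>v v) = a \<cdot>\<^sub>v S v) \<and>
    (\<forall>v\<in>carrier_vec d. T' (S v) = T v)"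
proof -
  define S where "S = the_inv_into (carrier_vec d') T' \<circ> T"
  have b: "bij_betw T (carrier_vec d) (rep_space V)" "bij_betw T' (carrier_vec d') (rep_space V)"
    using T T' by (auto simp: is_linear_iso_def)
  have bS: "bij_betw S (carrier_vec d) (carrier_vec d')"
    unfolding S_def using b(1) bij_betw_the_inv_into[OF b(2)] by (rule bij_betw_trans)
  have S: "S v \<in> carrier_vec d'" "T' (S v) = T v" if "v \<in> carrier_vec d" for v
    using bij_betwE[OF bS] that f_the_inv_into_f_bij_betw[OF b(2)] bij_betwE[OF b(1)] by (auto simp: S_def)
  have inj: "x = y" if "T' x = T' y" "x \<in> carrier_vec d'" "y \<in> carrier_vec d'" for x y
    using b(2) that by (auto simp: bij_betw_def inj_on_def)
  have "S (u + v) = S u + S v" if "u \<in> carrier_vec d" "v \<in> carrier_vec d" for u v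
    using that T T' S by (intro inj) (auto simp: is_linear_iso_def)
  moreover have "S (a \<cdot>\<^sub>v v) = a \<cdot>\<^sub>v S v" if "v \<in> carrier_vec d" for a v
    using that T T' S by (intro inj) (auto simp: is_linear_iso_def)
  ultimately show ?thesis using bS S(2) by blast
qed

lemma is_linear_iso_dim_le:
  assumes T: "is_linear_iso d V T" and T': "is_linear_iso d' V T'"
  shows "d' \<le> d"
proof -
  obtain S where S: "bij_betw S (carrier_vec d) (carrier_vec d')"
    "\<And>u v. u \<in> carrier_vec d \<Longrightarrow> v \<in> carrier_vec d \<Longrightarrow> S (u + v) = S u + S v"
    "\<And>a v. v \<in> carrier_vec d \<Longrightarrow> S (a \<cdot>\<^sub>v v) = a \<cdot>\<^sub>v S v"
    "\<And>v. v \<in> carrier_vec d \<Longrightarrow> T' (S v) = T v"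
    using is_linear_iso_transfer[OF T T'] by blast
  obtain R where R: "bij_betw R (carrier_vec d') (carrier_vec d)"
    "\<And>u v. u \<in> carrier_vec d' \<Longrightarrow> v \<in> carrier_vec d' \<Longrightarrow> R (u + v) = R u + R v"
    "\<And>a v. v \<in> carrier_vec d' \<Longrightarrow> R (a \<cdot>\<^sub>v v) = a \<cdot>\<^sub>v R v"
    "\<And>v. v \<in> carrier_vec d' \<Longrightarrow> T (R v) = T' v"
    using is_linear_iso_transfer[OF T' T] by blast
  have cl: "S v \<in> carrier_vec d'" if "v \<in> carrier_vec d" for v using S(1) that by (auto simp: bij_betw_def)
  have cl': "R v \<in> carrier_vec d" if "v \<in> carrier_vec d'" for v using R(1) that by (auto simp: bij_betw_def)
  have SR: "S (R v) = v" if v: "v \<in> carrier_vec d'" for v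
  proof -
    have "T' (S (R v)) = T' v" using S(4)[OF cl'[OF v]] R(4)[OF v] by simp
    then show ?thesis using T' cl[OF cl'[OF v]] v by (auto simp: is_linear_iso_def bij_betw_def inj_on_def)
  qed
  let ?C = "matrix_of d' d S" and ?B = "matrix_of d d' R"
  have "?C * ?B = 1\<^sub>m d'"
  proof (rule eq_matI)
    fix i j assume ij: "i < dim_row (1\<^sub>m d' :: 'b mat)" "j < dim_col (1\<^sub>m d' :: 'b mat)"
    have "?C *\<^sub>v (?B *\<^sub>v unit_vec d' j) = unit_vec d' j"
      using matrix_of_mult[of d' R d "unit_vec d' j", OF cl' R(2,3)] matrix_of_mult[of d S d' "R (unit_vec d' j)", OF cl S(2,3)]
        cl' SR by simp
    then have "(?C * ?B) *\<^sub>v unit_vec d' j = unit_vec d' j"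
      using assoc_mult_mat_vec[of ?C d' d ?B d' "unit_vec d' j"] by simp
    then have "((?C * ?B) *\<^sub>v unit_vec d' j) $ i = unit_vec d' j $ i" by simp
    moreover have "((?C * ?B) *\<^sub>v unit_vec d' j) $ i = (?C * ?B) $$ (i, j)"
      using ij by (simp add: row_def matrix_of_def)
    ultimately show "(?C * ?B) $$ (i, j) = 1\<^sub>m d' $$ (i, j)" using ij by auto
  qed (auto simp: matrix_of_def)
  then show ?thesis by (intro linear_injection_dim_le[of ?B d d' ?C]) auto
qed

lemma rep_dim_eq:
  assumes "is_linear_iso d V T"
  shows "rep_dim V = d"
  unfolding rep_dim_def
  by (rule the_equality) (use assms in \<open>auto intro: antisym is_linear_iso_dim_le\<close>)

subsection \<open>Classes of representations\<close>

text \<open>An isomorphism is a short exact sequence whose first term is a representation on the zero space, and that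
  one has the class zero.\<close>

lemma K0_class_iso:
  fixes W W' :: "('g, 'k::field) mrep" and \<sigma> :: "'g \<Rightarrow> 'k mat"
  assumes W: "is_rep G W" and W': "is_rep G W'" and Z: "is_rep G (0, \<sigma>)"
    and S: "bij_betw S (carrier_vec (fst W)) (carrier_vec (fst W'))"
    "\<And>u v. u \<in> carrier_vec (fst W) \<Longrightarrow> v \<in> carrier_vec (fst W) \<Longrightarrow> S (u + v) = S u + S v"
    "\<And>a v. v \<in> carrier_vec (fst W) \<Longrightarrow> S (a \<cdot>\<^sub>v v) = a \<cdot>\<^sub>v S v"
    "\<And>g v. g \<in> carrier G \<Longrightarrow> v \<in> carrier_vec (fst W) \<Longrightarrow> S (snd W g *\<^sub>v v) = snd W' g *\<^sub>v S v"
  shows "K0_class G W = K0_class G W'"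
proof -
  interpret comm_group "K0 G" by (rule comm_group_K0)
  let ?d = "fst W" and ?d' = "fst W'" let ?B = "matrix_of ?d' ?d S" let ?A = "0\<^sub>m ?d 0 :: 'k mat"
  have cl: "S v \<in> carrier_vec ?d'" if "v \<in> carrier_vec ?d" for v using S(1) that by (auto simp: bij_betw_def)
  have B: "?B *\<^sub>v v = S v" if "v \<in> carrier_vec ?d" for v
    by (rule matrix_of_mult[OF cl S(2,3) that])
  have Wc: "snd W g \<in> carrier_mat ?d ?d" "snd W' g \<in> carrier_mat ?d' ?d'" "\<sigma> g \<in> carrier_mat 0 0"
    if "g \<in> carrier G" for g
    using W W' Z that by (auto simp: is_rep_def)
  have S0: "S (0\<^sub>v ?d) = 0\<^sub>v ?d'"
  proof -
    have "0 \<cdot>\<^sub>v 0\<^sub>v ?d = (0\<^sub>v ?d :: 'k vec)" "0 \<cdot>\<^sub>v S (0\<^sub>v ?d) = 0\<^sub>v ?d'"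
      using cl[of "0\<^sub>v ?d"] by auto
    then show ?thesis using S(3)[of "0\<^sub>v ?d" 0] by simp
  qed
  have "short_exact G (0, \<sigma>) W W'"
    unfolding short_exact_def fst_conv snd_conv
  proof (rule bexI[of _ ?A], rule bexI[of _ ?B], intro conjI ballI)
    fix g assume g: "g \<in> carrier G"
    show "snd W g * ?A = ?A * \<sigma> g" using Wc[OF g] by (auto simp: mat_eq_iff)
    show "snd W' g * ?B = ?B * snd W g"
    proof (rule eq_matI)
      fix i j assume ij: "i < dim_row (?B * snd W g)" "j < dim_col (?B * snd W g)"
      then have j: "j < ?d" and i: "i < ?d'" using Wc[OF g] by (auto simp: matrix_of_def)
      have *: "(A *\<^sub>v unit_vec ?d j) $ i = A $$ (i, j)" if "A \<in> carrier_mat ?d' ?d" for A :: "'k mat"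
        using that i j by (simp add: row_def)
      have "snd W' g *\<^sub>v (?B *\<^sub>v unit_vec ?d j) = ?B *\<^sub>v (snd W g *\<^sub>v unit_vec ?d j)"
        using g Wc[OF g] by (simp add: B S(4))
      then have e: "(snd W' g * ?B) *\<^sub>v unit_vec ?d j = (?B * snd W g) *\<^sub>v unit_vec ?d j"
        using assoc_mult_mat_vec[OF Wc(2)[OF g] matrix_of_carrier[of ?d' ?d S], of "unit_vec ?d j"]
          assoc_mult_mat_vec[OF matrix_of_carrier[of ?d' ?d S] Wc(1)[OF g], of "unit_vec ?d j"] by simp
      have c: "snd W' g * ?B \<in> carrier_mat ?d' ?d" "?B * snd W g \<in> carrier_mat ?d' ?d"
        using mult_carrier_mat[OF Wc(2)[OF g] matrix_of_carrier] mult_carrier_mat[OF matrix_of_carrier Wc(1)[OF g]]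
        by simp_all
      show "(snd W' g * ?B) $$ (i, j) = (?B * snd W g) $$ (i, j)"
        unfolding *[OF c(1), symmetric] *[OF c(2), symmetric] e ..
    qed (use Wc[OF g] in \<open>auto simp: matrix_of_def\<close>)
  next
    show "inj_on ((*\<^sub>v) ?A) (carrier_vec 0)" by (auto simp: inj_on_def)
    have "v = 0\<^sub>v ?d" if "v \<in> carrier_vec ?d" "?B *\<^sub>v v = 0\<^sub>v ?d'" for v
    proof (rule inj_onD[OF bij_betw_imp_inj_on[OF S(1)] _ that(1) zero_carrier_vec])
      show "S v = S (0\<^sub>v ?d)" using that by (simp add: B S0)
    qed
    then have "{v \<in> carrier_vec ?d. ?B *\<^sub>v v = 0\<^sub>v ?d'} = {0\<^sub>v ?d}"
      using B[OF zero_carrier_vec, unfolded S0] zero_carrier_vec by blast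
    moreover have "?A *\<^sub>v u = 0\<^sub>v ?d" if "u \<in> carrier_vec 0" for u
      by (rule eq_vecI) (use that in \<open>auto simp: scalar_prod_def\<close>)
    then have "(*\<^sub>v) ?A ` carrier_vec 0 = (\<lambda>_. 0\<^sub>v ?d) ` (carrier_vec 0 :: 'k vec set)"
      by (rule image_cong[OF refl])
    then have "(*\<^sub>v) ?A ` carrier_vec 0 = {0\<^sub>v ?d}"
      using image_constant[OF zero_carrier_vec] by (rule trans)
    ultimately have "(*\<^sub>v) ?A ` carrier_vec 0 = {0\<^sub>v ?d} \<and> {v \<in> carrier_vec ?d. ?B *\<^sub>v v = 0\<^sub>v ?d'} = {0\<^sub>v ?d}"
      by simp
    then show "(*\<^sub>v) ?A ` carrier_vec 0 = {v \<in> carrier_vec ?d. ?B *\<^sub>v v = 0\<^sub>v ?d'}" by simp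
    have "(*\<^sub>v) ?B ` carrier_vec ?d = S ` carrier_vec ?d" by (intro image_cong) (auto simp: B)
    then show "(*\<^sub>v) ?B ` carrier_vec ?d = carrier_vec ?d'" using S(1) by (simp add: bij_betw_def)
  qed auto
  then have "K0_class G W = K0_class G (0, \<sigma>) \<otimes>\<^bsub>K0 G\<^esub> K0_class G W'"
    by (intro K0_class_exact W W' Z)
  then show ?thesis using K0_class_zero[OF Z] K0_class_closed[OF W'] by simp
qed

text \<open>The union in \<open>rep_class\<close> runs over all matrix forms of \<open>V\<close>. They are isomorphic to each other, hence have
  the same class.\<close>

lemma rep_class_eq:
  fixes W :: "('g, 'k::field) mrep"
  assumes W: "is_rep G W" and iso: "isomorphic_rep G W V"
  shows "rep_class G V = K0_class G W"
proof -
  have Z: "is_rep G (0, \<lambda>_. 1\<^sub>m 0)" by (simp add: is_rep_def)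
  have "K0_class G W' = K0_class G W" if W': "is_rep G W'" and iso': "isomorphic_rep G W' V" for W' :: "('g, 'k) mrep"
  proof -
    obtain T where T: "is_linear_iso (fst W) V T"
      "\<And>g v. g \<in> carrier G \<Longrightarrow> v \<in> carrier_vec (fst W) \<Longrightarrow> T (snd W g *\<^sub>v v) = rep_act V g (T v)"
      using iso by (auto simp: isomorphic_rep_def)
    obtain T' where T': "is_linear_iso (fst W') V T'"
      "\<And>g v. g \<in> carrier G \<Longrightarrow> v \<in> carrier_vec (fst W') \<Longrightarrow> T' (snd W' g *\<^sub>v v) = rep_act V g (T' v)"
      using iso' by (auto simp: isomorphic_rep_def)
    obtain S where S: "bij_betw S (carrier_vec (fst W')) (carrier_vec (fst W))"
      "\<And>u v. u \<in> carrier_vec (fst W') \<Longrightarrow> v \<in> carrier_vec (fst W') \<Longrightarrow> S (u + v) = S u + S v"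
      "\<And>a v. v \<in> carrier_vec (fst W') \<Longrightarrow> S (a \<cdot>\<^sub>v v) = a \<cdot>\<^sub>v S v"
      "\<And>v. v \<in> carrier_vec (fst W') \<Longrightarrow> T (S v) = T' v"
      using is_linear_iso_transfer[OF T'(1) T(1)] by blast
    have cl: "S v \<in> carrier_vec (fst W)" if "v \<in> carrier_vec (fst W')" for v
      using S(1) that by (auto simp: bij_betw_def)
    show ?thesis
    proof (rule K0_class_iso[OF W' W Z S(1-3)])
      fix g and v :: "'k vec" assume g: "g \<in> carrier G" and v: "v \<in> carrier_vec (fst W')"
      have c: "snd W' g *\<^sub>v v \<in> carrier_vec (fst W')" "snd W g *\<^sub>v S v \<in> carrier_vec (fst W)"
        using W W' g v cl[OF v] by (auto simp: is_rep_def intro!: mult_mat_vec_carrier)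
      have "T (S (snd W' g *\<^sub>v v)) = T (snd W g *\<^sub>v S v)"
        using S(4)[OF c(1)] S(4)[OF v] T(2)[OF g cl[OF v]] T'(2)[OF g v] by simp
      then show "S (snd W' g *\<^sub>v v) = snd W g *\<^sub>v S v"
        using T(1) c cl[OF c(1)] by (auto simp: is_linear_iso_def bij_betw_def inj_on_def)
    qed
  qed
  then show ?thesis unfolding rep_class_def using W iso by blast
qed

text \<open>For block triangular matrices multiplicativity amounts to the cocycle condition on the off-diagonal
  block \<open>S\<close>. The first \<open>a\<close> coordinates span a subrepresentation with matrices \<open>\<sigma>\<close>, and
  the quotient by it has matrices \<open>\<omega>\<close>.\<close>

lemma block_rep:
  assumes U: "is_rep G (a, \<sigma>)" and W: "is_rep G (b, \<omega>)" and G: "monoid G"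
    and S: "\<And>g. g \<in> carrier G \<Longrightarrow> S g \<in> carrier_mat a b"
    and S1: "S \<one>\<^bsub>G\<^esub> = 0\<^sub>m a b"
    and cocycle: "\<And>g h. g \<in> carrier G \<Longrightarrow> h \<in> carrier G \<Longrightarrow> S (g \<otimes>\<^bsub>G\<^esub> h) = \<sigma> g * S h + S g * \<omega> h"
  shows "is_rep G (a + b, \<lambda>g. four_block_mat (\<sigma> g) (S g) (0\<^sub>m b a) (\<omega> g))" (is "is_rep G (_, ?V)")
    and "K0_class G (a + b, \<lambda>g. four_block_mat (\<sigma> g) (S g) (0\<^sub>m b a) (\<omega> g)) =
      K0_class G (a, \<sigma>) \<otimes>\<^bsub>K0 G\<^esub> K0_class G (b, \<omega>)"
proof -
  have c: "\<sigma> g \<in> carrier_mat a a" "\<omega> g \<in> carrier_mat b b" if "g \<in> carrier G" for g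
    using U W that by (auto simp: is_rep_def)
  have V: "?V g \<in> carrier_mat (a + b) (a + b)" if "g \<in> carrier G" for g
    using c[OF that] S[OF that] by auto
  show rep: "is_rep G (a + b, ?V)"
    unfolding is_rep_def fst_conv snd_conv
  proof (intro conjI ballI)
    fix g h assume g: "g \<in> carrier G" and h: "h \<in> carrier G"
    have "?V g * ?V h = four_block_mat (\<sigma> g * \<sigma> h + S g * 0\<^sub>m b a) (\<sigma> g * S h + S g * \<omega> h)
        (0\<^sub>m b a * \<sigma> h + \<omega> g * 0\<^sub>m b a) (0\<^sub>m b a * S h + \<omega> g * \<omega> h)"
      by (rule mult_four_block_mat[OF c(1)[OF g] S[OF g] zero_carrier_mat c(2)[OF g]
            c(1)[OF h] S[OF h] zero_carrier_mat c(2)[OF h]])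
    also have "\<dots> = ?V (g \<otimes>\<^bsub>G\<^esub> h)"
    proof -
      have "S g * 0\<^sub>m b a = 0\<^sub>m a a" "0\<^sub>m b a * \<sigma> h = 0\<^sub>m b a" "\<omega> g * 0\<^sub>m b a = 0\<^sub>m b a" "0\<^sub>m b a * S h = 0\<^sub>m b b"
        using c[OF g] c[OF h] S[OF g] S[OF h] by simp_all
      moreover have "\<sigma> g * \<sigma> h \<in> carrier_mat a a" "\<omega> g * \<omega> h \<in> carrier_mat b b"
        using c[OF g] c[OF h] by auto
      moreover have "\<sigma> (g \<otimes>\<^bsub>G\<^esub> h) = \<sigma> g * \<sigma> h" "\<omega> (g \<otimes>\<^bsub>G\<^esub> h) = \<omega> g * \<omega> h"
        using U W g h by (auto simp: is_rep_def)
      ultimately show ?thesis using cocycle[OF g h] by simp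
    qed
    finally show "?V (g \<otimes>\<^bsub>G\<^esub> h) = ?V g * ?V h" ..
  qed (use V U W S1 in \<open>auto simp: is_rep_def mat_eq_iff\<close>)
  let ?A = "mat (a + b) a (\<lambda>(i, j). if i = j then 1 else 0) :: 'c mat"
  let ?B = "mat b (a + b) (\<lambda>(i, j). if j = a + i then 1 else 0) :: 'c mat"
  have A: "?A *\<^sub>v u = vec (a + b) (\<lambda>i. if i < a then u $ i else 0)" if "u \<in> carrier_vec a" for u
    using that by (auto simp: scalar_prod_def if_distrib[of "\<lambda>x. x * _"] cong: if_cong)
  have B: "?B *\<^sub>v v = vec b (\<lambda>i. v $ (a + i))" if "v \<in> carrier_vec (a + b)" for v
    using that by (auto simp: scalar_prod_def if_distrib[of "\<lambda>x. x * _"] cong: if_cong)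
  have "short_exact G (a, \<sigma>) (a + b, ?V) (b, \<omega>)"
    unfolding short_exact_def fst_conv snd_conv
  proof (rule bexI[of _ ?A], rule bexI[of _ ?B], intro conjI ballI)
    fix g assume g: "g \<in> carrier G"
    note cg = c[OF g] S[OF g]
    show "?V g * ?A = ?A * \<sigma> g"
      by (rule eq_matI)
        (use cg in \<open>auto simp: scalar_prod_def if_distrib[of "\<lambda>x. x * _"] if_distrib[of "\<lambda>x. _ * x"] cong: if_cong\<close>)
    show "\<omega> g * ?B = ?B * ?V g"
    proof (rule eq_matI)
      fix i j assume "i < dim_row (?B * ?V g)" "j < dim_col (?B * ?V g)"
      then have ij: "i < b" "j < a + b" using cg by auto
      have "(\<Sum>k = 0..<b. if j = a + k then \<omega> g $$ (i, k) else 0) = (if j < a then 0 else \<omega> g $$ (i, j - a))"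
      proof (cases "j < a")
        case False
        then obtain k where "j = a + k" using le_Suc_ex[of a j] by auto
        then show ?thesis using ij by simp
      qed simp
      moreover have "(\<Sum>k = 0..<a + b. if k < a then 0 else if j < a then 0 else if k = a + i then \<omega> g $$ (i, j - a) else 0) =
          (\<Sum>k = 0..<a + b. if k = a + i then if j < a then 0 else \<omega> g $$ (i, j - a) else 0)"
        by (intro sum.cong) auto
      ultimately show "(\<omega> g * ?B) $$ (i, j) = (?B * ?V g) $$ (i, j)"
        using cg ij
        by (auto simp: scalar_prod_def if_distrib[of "\<lambda>x. x * _"] if_distrib[of "\<lambda>x. _ * x"] cong: if_cong)
    qed (use cg in auto)
  next
    show "inj_on ((*\<^sub>v) ?A) (carrier_vec a)"
    proof (rule inj_onI)
      fix u v assume uv: "u \<in> carrier_vec a" "v \<in> carrier_vec a" "?A *\<^sub>v u = ?A *\<^sub>v v"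
      have "u $ i = v $ i" if "i < a" for i
        using arg_cong[OF uv(3), of "\<lambda>x. x $ i"] that by (simp only: A[OF uv(1)] A[OF uv(2)]) simp
      then show "u = v" using uv by auto
    qed
    have "v \<in> (*\<^sub>v) ?A ` carrier_vec a" if v: "v \<in> carrier_vec (a + b)" and Bv: "?B *\<^sub>v v = 0\<^sub>v b" for v
    proof
      have z: "v $ (a + i) = 0" if "i < b" for i
        using arg_cong[OF Bv, of "\<lambda>x. x $ i"] that by (simp only: B[OF v]) simp
      have "v $ i = 0" if "\<not> i < a" "i < a + b" for i
        using z[of "i - a"] that by simp
      then show "v = ?A *\<^sub>v vec a (\<lambda>i. v $ i)" using v by (subst A) auto
    qed auto
    moreover have "?B *\<^sub>v (?A *\<^sub>v u) = 0\<^sub>v b" if u: "u \<in> carrier_vec a" for u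
      unfolding A[OF u] by (subst B) auto
    ultimately show "(*\<^sub>v) ?A ` carrier_vec a = {v \<in> carrier_vec (a + b). ?B *\<^sub>v v = 0\<^sub>v b}"
      by (auto intro!: mult_mat_vec_carrier[of _ "a + b" a])
    have "w \<in> (*\<^sub>v) ?B ` carrier_vec (a + b)" if "w \<in> carrier_vec b" for w
    proof
      show "w = ?B *\<^sub>v vec (a + b) (\<lambda>i. w $ (i - a))" using that by (subst B) auto
    qed auto
    then show "(*\<^sub>v) ?B ` carrier_vec (a + b) = carrier_vec b"
      by (auto intro!: mult_mat_vec_carrier[of _ b "a + b"])
  qed auto
  then show "K0_class G (a + b, ?V) = K0_class G (a, \<sigma>) \<otimes>\<^bsub>K0 G\<^esub> K0_class G (b, \<omega>)"
    by (rule K0_class_exact[OF U rep W])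
qed

section \<open>The general linear group over a finite field\<close>

text \<open>The roots of \<open>z\<^sup>q = z\<close> form a subfield as soon as \<open>z \<mapsto> z\<^sup>q\<close> is additive, and this is what the group laws of
  \<open>GL\<^sub>n(F\<^sub>q)\<close> depend on. The parameter \<open>ty\<close> records the type of the ambient field, which the number \<open>q\<close> alone
  does not determine.\<close>

locale frobenius_subfield =
  fixes q :: nat and ty :: "'k::field itself"
  assumes q_pos: "q > 0" and frobenius_add: "((a::'k) + b) ^ q = a ^ q + b ^ q"
begin

lemma frobenius_minus: "(- a::'k) ^ q = - (a ^ q)"
  using frobenius_add[of a "-a"] q_pos by (simp add: power_0_left eq_neg_iff_add_eq_0 add.commute)

lemma frobenius_diff: "(a - b::'k) ^ q = a ^ q - b ^ q"
  using frobenius_add[of a "-b"] by (simp add: frobenius_minus)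

lemma frobenius_sum: "(sum f J :: 'k) ^ q = (\<Sum>i\<in>J. f i ^ q)"
  using q_pos by (induction J rule: infinite_finite_induct) (auto simp: frobenius_add power_0_left)

abbreviation "G \<equiv> GL_Fq :: nat \<Rightarrow> nat \<Rightarrow> 'k mat monoid"

abbreviation frobenius :: "'k mat \<Rightarrow> 'k mat" where
  "frobenius \<equiv> map_mat (\<lambda>x. x ^ q)"

lemma frobenius_mult:
  assumes "A \<in> carrier_mat n n" "B \<in> carrier_mat n n"
  shows "frobenius (A * B) = frobenius A * frobenius B"
  using assms
  by (intro eq_matI) (auto simp: scalar_prod_def frobenius_sum power_mult_distrib)

lemma frobenius_one: "frobenius (1\<^sub>m n) = 1\<^sub>m n"
  using q_pos by (intro eq_matI) (auto simp: power_0_left)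

lemma GL_carrier: "A \<in> carrier (G n q) \<longleftrightarrow> A \<in> carrier_mat n n \<and> invertible_mat A \<and> frobenius A = A"
  by (auto simp: GL_Fq_def mat_eq_iff)

lemma GL_mult [simp]: "A \<otimes>\<^bsub>G n q\<^esub> B = A * B" "\<one>\<^bsub>G n q\<^esub> = 1\<^sub>m n"
  by (simp_all add: GL_Fq_def)

lemma GL_intro:
  assumes "A \<in> carrier_mat n n" "B \<in> carrier_mat n n" "A * B = 1\<^sub>m n" "frobenius A = A"
  shows "A \<in> carrier (G n q)"
proof -
  have "B * A = 1\<^sub>m n" using mat_mult_left_right_inverse[OF assms(1-3)] .
  then have "invertible_mat A"
    using assms unfolding invertible_mat_def inverts_mat_def by auto
  then show ?thesis using assms by (simp add: GL_carrier)
qed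

lemma GL_inverse:
  assumes "A \<in> carrier (G n q)"
  obtains B where "B \<in> carrier (G n q)" "A * B = 1\<^sub>m n" "B * A = 1\<^sub>m n"
proof -
  have A: "A \<in> carrier_mat n n" "frobenius A = A" using assms by (simp_all add: GL_carrier)
  obtain B where AB: "A * B = 1\<^sub>m n" and BA: "B * A = 1\<^sub>m (dim_row B)"
    using assms A(1) unfolding GL_carrier invertible_mat_def inverts_mat_def by auto
  have "dim_row B = n" using AB BA A(1) by (metis carrier_matD(2) index_mult_mat(3) index_one_mat(3))
  moreover have "dim_col B = n" using AB by (metis index_mult_mat(3) index_one_mat(3))
  ultimately have B: "B \<in> carrier_mat n n" by auto
  have BA: "B * A = 1\<^sub>m n" using BA \<open>dim_row B = n\<close> by simp
  \<comment> \<open>The Frobenius image of the inverse is again an inverse, hence equal to it.\<close>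
  have "A * frobenius B = 1\<^sub>m n" using frobenius_mult[OF A(1) B] by (simp add: AB A(2) frobenius_one)
  then have "B * (A * frobenius B) = B" using B by simp
  then have "frobenius B = B" using A(1) B BA by (simp flip: assoc_mult_mat[of B n n A n])
  then have "B \<in> carrier (G n q)" using GL_intro[OF B A(1) BA] by simp
  then show thesis using that AB BA by blast
qed

lemma group_GL: "group (G n q)"
proof (rule groupI)
  fix A B assume AB: "A \<in> carrier (G n q)" "B \<in> carrier (G n q)"
  obtain A' where A': "A' \<in> carrier (G n q)" "A * A' = 1\<^sub>m n" "A' * A = 1\<^sub>m n" using GL_inverse[OF AB(1)] .
  obtain B' where B': "B' \<in> carrier (G n q)" "B * B' = 1\<^sub>m n" "B' * B = 1\<^sub>m n" using GL_inverse[OF AB(2)] .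
  have c: "A \<in> carrier_mat n n" "B \<in> carrier_mat n n" "A' \<in> carrier_mat n n" "B' \<in> carrier_mat n n"
    "frobenius A = A" "frobenius B = B"
    using AB A' B' by (simp_all add: GL_carrier)
  have "(A * B) * (B' * A') = A * (B * B') * A'" using c by (simp add: assoc_mult_mat[of _ n n _ n _ n])
  then have "(A * B) * (B' * A') = 1\<^sub>m n" using c A' B' by simp
  then have "A * B \<in> carrier (G n q)"
    by (rule GL_intro[rotated 2]) (use c in \<open>auto simp: frobenius_mult[of A n B]\<close>)
  then show "A \<otimes>\<^bsub>G n q\<^esub> B \<in> carrier (G n q)" by simp
  show "\<exists>y\<in>carrier (G n q). y \<otimes>\<^bsub>G n q\<^esub> A = \<one>\<^bsub>G n q\<^esub>" using A' by auto
next
  show "\<one>\<^bsub>G n q\<^esub> \<in> carrier (G n q)"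
    using GL_intro[of "1\<^sub>m n" n "1\<^sub>m n"] by (simp add: frobenius_one)
qed (auto simp: GL_carrier assoc_mult_mat)

lemma GL_rca_simps [simp]:
  "rca_grp (GL_rca n q t c) = G n q" "rca_dim (GL_rca n q t c) = n" "rca_rep (GL_rca n q t c) = (\<lambda>g. g)"
  "rca_t (GL_rca n q t c) = t" "rca_c (GL_rca n q t c) = c"
  by (simp_all add: GL_rca_def)

lemma rational_cherednik_GL: "rational_cherednik (GL_rca n q (t :: 'k) c)"
  using group_GL by (simp add: rational_cherednik_def is_rep_def GL_carrier)

lemma reflections_GL: "s \<in> reflections (GL_rca n q t c) \<longleftrightarrow>
    s \<in> carrier (G n q) \<and> 1\<^sub>m n \<noteq> s \<and> outer_product_form n (1\<^sub>m n - s)"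
  using rational_cherednik.reflections_iff[OF rational_cherednik_GL[of n t c], of s] by simp

lemma GL_inv:
  assumes "A \<in> carrier (G n q)" "B \<in> carrier (G n q)" "A * B = 1\<^sub>m n"
  shows "inv\<^bsub>G n q\<^esub> A = B"
  using group.inv_equality[OF group_GL[of n], of B A] assms mat_mult_left_right_inverse[of A n B]
  by (simp add: GL_carrier)

subsection \<open>Conjugating reflections by elementary matrices\<close>

definition transvection :: "nat \<Rightarrow> 'k \<Rightarrow> nat \<Rightarrow> nat \<Rightarrow> 'k mat" where
  "transvection n a i j = addrow_mat n a i j"

definition conj_transvection :: "nat \<Rightarrow> 'k \<Rightarrow> nat \<Rightarrow> nat \<Rightarrow> 'k mat \<Rightarrow> 'k mat" where
  "conj_transvection n a i j s = transvection n a i j * s * transvection n (- a) i j"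

lemma transvection_mult:
  "i < n \<Longrightarrow> j < n \<Longrightarrow> i \<noteq> j \<Longrightarrow> transvection n a i j * transvection n (- a) i j = 1\<^sub>m n"
  "i < n \<Longrightarrow> j < n \<Longrightarrow> i \<noteq> j \<Longrightarrow> transvection n (- a) i j * transvection n a i j = 1\<^sub>m n"
  using addrow_mat_inv[of i n j a] addrow_mat_inv[of i n j "- a"] by (simp_all add: transvection_def)

lemma transvection_carrier [simp]: "transvection n a i j \<in> carrier_mat n n"
  by (simp add: transvection_def)

lemma transvection_one [simp]: "transvection n a i j * 1\<^sub>m n = transvection n a i j"
  by (rule right_mult_one_mat[OF transvection_carrier])

lemma transvection_GL:
  assumes "i < n" "j < n" "i \<noteq> j" "a ^ q = a"
  shows "transvection n a i j \<in> carrier (G n q)"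
proof (rule GL_intro[OF _ _ transvection_mult(1)[OF assms(1-3)]])
  show "frobenius (transvection n a i j) = transvection n a i j"
    using assms q_pos by (intro eq_matI) (auto simp: transvection_def addrow_mat_def power_0_left)
qed auto

lemma conj_transvection_inverse:
  assumes "i < n" "j < n" "i \<noteq> j" "s \<in> carrier_mat n n"
  shows "conj_transvection n (- a) i j (conj_transvection n a i j s) = s"
proof -
  let ?T = "transvection n a i j" and ?U = "transvection n (- a) i j"
  have "?U * (?T * s * ?U) * ?T = (?U * ?T) * s * (?U * ?T)"
    using assms(4) by (simp add: assoc_mult_mat[of _ n n _ n _ n] mult_carrier_mat[of _ n n _ n])
  then show ?thesis using assms by (simp add: conj_transvection_def transvection_mult)
qed

lemma conj_transvection_minus:
  assumes "i < n" "j < n" "i \<noteq> j" "s \<in> carrier_mat n n"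
  shows "1\<^sub>m n - conj_transvection n a i j s = conj_transvection n a i j (1\<^sub>m n - s)"
proof -
  let ?T = "transvection n a i j" and ?U = "transvection n (- a) i j"
  have "?T * (1\<^sub>m n - s) * ?U = (?T - ?T * s) * ?U"
    using assms(4) mult_minus_distrib_mat[of ?T n n "1\<^sub>m n" n s] by simp
  also have "\<dots> = ?T * ?U - ?T * s * ?U"
    using assms(4) by (intro minus_mult_distrib_mat[of _ n n _ _ n] mult_carrier_mat[of _ n n _ n]) auto
  finally show ?thesis using assms by (simp add: conj_transvection_def transvection_mult)
qed

lemma conj_transvection_entry:
  assumes "i < n" "j < n" "i \<noteq> j" "N \<in> carrier_mat n n" "k < n" "l < n"
  shows "conj_transvection n a i j N $$ (k, l) =
    N $$ (k, l) + (if k = i then a * N $$ (j, l) else 0) -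
    (if l = j then a * (N $$ (k, i) + (if k = i then a * N $$ (j, i) else 0)) else 0)"
proof -
  have "conj_transvection n a i j N = addcol (- a) j i (addrow a i j N)"
    using assms by (simp add: conj_transvection_def transvection_def addrow_mat[of N n n] addcol_mat[of "addrow_mat n a i j * N" n n]
        mult_carrier_mat[of _ n n _ n])
  then show ?thesis using assms by auto
qed

lemma conj_transvection_reflection:
  assumes "i < n" "j < n" "i \<noteq> j" "a ^ q = a" "s \<in> reflections (GL_rca n q t c)"
  shows "conj_transvection n a i j s \<in> reflections (GL_rca n q t c)"
    and "conj_invariant (GL_rca n q t c) \<Longrightarrow> c (conj_transvection n a i j s) = c s"
proof -
  interpret group "G n q" by (rule group_GL)
  let ?T = "transvection n a i j" and ?U = "transvection n (- a) i j"
  have T: "?T \<in> carrier (G n q)" "?U \<in> carrier (G n q)"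
    using assms by (auto intro!: transvection_GL simp: frobenius_minus)
  have inv: "inv\<^bsub>G n q\<^esub> ?T = ?U" by (rule GL_inv[OF T transvection_mult(1)[OF assms(1-3)]])
  have s: "s \<in> carrier (G n q)" "s \<in> carrier_mat n n" "outer_product_form n (1\<^sub>m n - s)" "1\<^sub>m n \<noteq> s"
    using assms(5) by (simp_all add: reflections_GL GL_carrier)
  then show "c (conj_transvection n a i j s) = c s" if "conj_invariant (GL_rca n q t c)"
    using that T(1) assms(5) inv unfolding conj_invariant_def by (auto simp: conj_transvection_def)
  have N: "1\<^sub>m n - s \<in> carrier_mat n n" using s(2) by (rule minus_carrier_mat)
  have "?T * (1\<^sub>m n - s) \<in> carrier_mat n n" using N by (intro mult_carrier_mat[of _ n n]) auto
  then have "outer_product_form n (conj_transvection n a i j (1\<^sub>m n - s))"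
    unfolding conj_transvection_def using s(3) N
    by (intro outer_product_form_mult(2) outer_product_form_mult(1)) auto
  moreover have "1\<^sub>m n \<noteq> conj_transvection n a i j s"
  proof
    assume "1\<^sub>m n = conj_transvection n a i j s"
    then have "conj_transvection n (- a) i j (1\<^sub>m n) = s"
      using conj_transvection_inverse[OF assms(1-3) s(2), of a] by simp
    moreover have "conj_transvection n (- a) i j (1\<^sub>m n) = 1\<^sub>m n"
      using assms transvection_mult(2)[OF assms(1-3), of a] by (simp add: conj_transvection_def)
    ultimately show False using s(4) by simp
  qed
  moreover have "conj_transvection n a i j s \<in> carrier (G n q)"
    using m_closed[OF m_closed[OF T(1) s(1)] T(2)] by (simp add: conj_transvection_def)
  ultimately show "conj_transvection n a i j s \<in> reflections (GL_rca n q t c)"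
    by (simp add: reflections_GL conj_transvection_minus[OF assms(1-3) s(2)])
qed

end

subsection \<open>The weighted sum of all reflections\<close>

text \<open>Reindexing \<open>\<Sum> f h\<close> by the permutation \<open>\<phi>\<close> of \<open>X\<close> with inverse \<open>\<psi>\<close> gives \<open>\<Sum> f h = \<Sum> f h + \<Sum> f\<close>.\<close>

lemma sum_shift_zero:
  fixes f h :: "'a \<Rightarrow> 'k::comm_ring_1"
  assumes "\<And>s. s \<in> X \<Longrightarrow> \<phi> s \<in> X \<and> \<psi> s \<in> X \<and> \<psi> (\<phi> s) = s \<and> \<phi> (\<psi> s) = s"
    and f: "\<And>s. s \<in> X \<Longrightarrow> f (\<phi> s) = f s" and h: "\<And>s. s \<in> X \<Longrightarrow> h (\<phi> s) = h s + 1"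
  shows "sum f X = 0"
proof -
  have "(\<Sum>s\<in>X. f s * h s) = (\<Sum>s\<in>X. f (\<phi> s) * h (\<phi> s))"
    by (rule sum.reindex_bij_witness[of _ \<phi> \<psi>]) (use assms(1) in auto)
  also have "\<dots> = (\<Sum>s\<in>X. f s * h s) + sum f X"
    by (simp add: f h distrib_left sum.distrib)
  finally show ?thesis by simp
qed

text \<open>The polynomial \<open>1 + z + \<dots> + z\<^sup>q\<^sup>-\<^sup>2 = (z\<^sup>q\<^sup>-\<^sup>1 - 1) / (z - 1)\<close> has a root, which differs from \<open>1\<close> because the value at
  \<open>1\<close> is \<open>q - 1 = -1\<close>.\<close>

lemma ex_generic_scalar:
  assumes q_zero: "of_nat q = (0::'k::alg_closed_field)" and "q > 2"
  shows "\<exists>\<mu>::'k. \<mu> ^ q = \<mu> \<and> \<mu> \<noteq> 0 \<and> \<mu> \<noteq> 1"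
proof -
  obtain \<mu> :: 'k where \<mu>: "(\<Sum>k\<le>q - 2. 1 * \<mu> ^ k) = 0"
    using alg_closed[of "q - 2" "\<lambda>_. 1"] assms by auto
  have "\<mu> \<noteq> 1"
  proof
    assume "\<mu> = 1"
    then have "of_nat (q - 1) = (0::'k)" using \<mu> assms by (simp add: Suc_diff_Suc numeral_2_eq_2)
    moreover have "of_nat q = of_nat (q - 1) + (1::'k)" using assms by (simp add: of_nat_diff)
    ultimately show False using q_zero by simp
  qed
  moreover have "\<mu> \<noteq> 0" using \<mu> by (auto simp: power_0_left)
  moreover have "1 - \<mu> ^ Suc (q - 2) = 0"
    using sum_gp_basic[of \<mu> "q - 2"] \<mu> by simp
  then have "\<mu> ^ (Suc (q - 2)) * \<mu> = \<mu>" by simp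
  then have "\<mu> ^ q = \<mu>" using assms by (simp add: power_Suc2[symmetric] Suc_diff_Suc numeral_2_eq_2 del: power_Suc)
  ultimately show ?thesis by blast
qed

text \<open>Existence of a scalar of \<open>F\<^sub>q\<close> other than \<open>0\<close> and \<open>1\<close> is an assumption here, so that the ground field may
  be arbitrary; over an algebraically closed field it is \<open>ex_generic_scalar\<close>.\<close>

locale GL_parameters = frobenius_subfield q ty for q and ty :: "'k::field itself" +
  fixes n :: nat and t :: 'k and c :: "'k mat \<Rightarrow> 'k"
  assumes generic_scalar: "q > 2 \<Longrightarrow> \<exists>\<mu>::'k. \<mu> ^ q = \<mu> \<and> \<mu> \<noteq> 0 \<and> \<mu> \<noteq> 1"
    and q_gt_1: "q > 1" and n_ge_2: "n \<ge> 2"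
    and c_invariant: "conj_invariant (GL_rca n q t c)"
begin

abbreviation "R \<equiv> reflections (GL_rca n q t c)"
abbreviation "N s \<equiv> 1\<^sub>m n - s"

lemma N_carrier: "s \<in> R \<Longrightarrow> s \<in> carrier_mat n n \<and> N s \<in> carrier_mat n n"
  by (auto simp: reflections_GL GL_carrier intro: minus_carrier_mat)

lemma N_minor:
  assumes "s \<in> R" "i < n" "j < n" "k < n" "l < n"
  shows "N s $$ (i, j) * N s $$ (k, l) = N s $$ (i, l) * N s $$ (k, j)"
proof -
  obtain f g where fg: "\<And>i j. i < n \<Longrightarrow> j < n \<Longrightarrow> N s $$ (i, j) = f i * g j"
    using assms(1) by (auto simp: reflections_GL outer_product_form_def)
  show ?thesis by (simp only: fg[OF assms(2,3)] fg[OF assms(4,5)] fg[OF assms(2,5)] fg[OF assms(4,3)] mult_ac)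
qed

lemma N_frobenius:
  assumes "s \<in> R" "i < n" "j < n"
  shows "(N s $$ (i, j)) ^ q = N s $$ (i, j)"
proof -
  have "s $$ (i, j) ^ q = s $$ (i, j)"
    using assms by (auto simp: reflections_GL GL_Fq_def)
  then show ?thesis using assms N_carrier[OF assms(1)] q_pos by (auto simp: frobenius_diff power_0_left)
qed

lemma N_conj:
  assumes "s \<in> R" "i < n" "j < n" "i \<noteq> j" "k < n" "l < n"
  shows "N (conj_transvection n a i j s) $$ (k, l) =
    N s $$ (k, l) + (if k = i then a * N s $$ (j, l) else 0) -
    (if l = j then a * (N s $$ (k, i) + (if k = i then a * N s $$ (j, i) else 0)) else 0)"
  using N_carrier[OF assms(1)] conj_transvection_entry[OF assms(2-4) _ assms(5,6), of "N s" a]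
  by (simp add: conj_transvection_minus[OF assms(2-4)])

lemma conj_R:
  assumes "s \<in> R" "i < n" "j < n" "i \<noteq> j" "a ^ q = a"
  shows "conj_transvection n a i j s \<in> R" "c (conj_transvection n a i j s) = c s"
    "conj_transvection n (- a) i j (conj_transvection n a i j s) = s"
  using conj_transvection_reflection[OF assms(2-5) assms(1)] c_invariant
    conj_transvection_inverse[OF assms(2-4), of s a] N_carrier[OF assms(1)] by simp_all

lemma conj_perm:
  assumes ij: "i < n" "j < n" "i \<noteq> j"
    and X: "X \<subseteq> R" "\<And>s a. s \<in> X \<Longrightarrow> a ^ q = a \<Longrightarrow> conj_transvection n a i j s \<in> X"
    and s: "s \<in> X"
  shows "conj_transvection n 1 i j s \<in> X \<and> conj_transvection n (- 1) i j s \<in> X \<and>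
    conj_transvection n (- 1) i j (conj_transvection n 1 i j s) = s \<and>
    conj_transvection n 1 i j (conj_transvection n (- 1) i j s) = s"
proof -
  have one: "(1::'k) ^ q = 1" "(- 1::'k) ^ q = - 1" by (simp_all add: frobenius_minus)
  have "s \<in> R" using X(1) s by auto
  then show ?thesis
    using X(2)[OF s one(1)] X(2)[OF s one(2)] conj_R(3)[OF _ ij one(1), of s] conj_R(3)[OF _ ij one(2), of s]
    by simp
qed

text \<open>If \<open>N s $$ (j, i) = 0 \<noteq> N s $$ (i, i)\<close>, then \<open>N s $$ (j, j) = 0\<close> by the vanishing minor. Conjugation by \<open>1 + E\<^sub>i\<^sub>j\<close> keeps
  the entry \<open>(i, i)\<close> and subtracts it from the entry \<open>(i, j)\<close>, so the quotient of these two entries is shifted.\<close>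

lemma sum_diagonal_A:
  assumes ij: "i < n" "j < n" "i \<noteq> j"
  shows "(\<Sum>s\<in>{s\<in>R. N s $$ (i, i) \<noteq> 0 \<and> N s $$ (j, i) = 0}. c s * N s $$ (i, i)) = 0"
proof (rule sum_shift_zero)
  let ?X = "{s\<in>R. N s $$ (i, i) \<noteq> 0 \<and> N s $$ (j, i) = 0}"
  have X: "conj_transvection n a i j s \<in> ?X" if "s \<in> ?X" "a ^ q = a" for s a
    using that conj_R(1)[OF _ ij that(2)] ij by (auto simp: N_conj)
  fix s assume s: "s \<in> ?X"
  show "conj_transvection n 1 i j s \<in> ?X \<and> conj_transvection n (- 1) i j s \<in> ?X \<and>
    conj_transvection n (- 1) i j (conj_transvection n 1 i j s) = s \<and>
    conj_transvection n 1 i j (conj_transvection n (- 1) i j s) = s"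
    by (rule conj_perm[OF ij _ X s]) auto
  show "c (conj_transvection n 1 i j s) * N (conj_transvection n 1 i j s) $$ (i, i) = c s * N s $$ (i, i)"
    using s ij conj_R(2)[of s i j 1] by (auto simp: N_conj)
  have "N s $$ (j, j) = 0"
    using s ij N_minor[of s i i j j] by auto
  then show "- N (conj_transvection n 1 i j s) $$ (i, j) / N (conj_transvection n 1 i j s) $$ (i, i) =
      - N s $$ (i, j) / N s $$ (i, i) + 1"
    using s ij by (auto simp: N_conj field_simps)
qed

text \<open>Conjugation by \<open>1 + E\<^sub>j\<^sub>k\<close> adds row \<open>k\<close> to row \<open>j\<close> and changes column \<open>k\<close>. In column \<open>i\<close>, which is distinct from
  \<open>k\<close>, it affects only the entry in row \<open>j\<close>; that entry is not among those defining the set or the summand, and it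
  provides the function to be shifted.\<close>

lemma sum_diagonal_B:
  assumes ijk: "i < n" "j < n" "k < n" "i \<noteq> j" "i \<noteq> k" "j \<noteq> k"
  shows "(\<Sum>s\<in>{s\<in>R. N s $$ (k, i) \<noteq> 0}. c s * N s $$ (i, i)) = 0"
proof (rule sum_shift_zero)
  let ?X = "{s\<in>R. N s $$ (k, i) \<noteq> 0}"
  have X: "conj_transvection n a j k s \<in> ?X" if "s \<in> ?X" "a ^ q = a" for s a
    using that conj_R(1)[OF _ ijk(2,3,6) that(2)] ijk by (auto simp: N_conj)
  fix s assume s: "s \<in> ?X"
  show "conj_transvection n 1 j k s \<in> ?X \<and> conj_transvection n (- 1) j k s \<in> ?X \<and>
    conj_transvection n (- 1) j k (conj_transvection n 1 j k s) = s \<and>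
    conj_transvection n 1 j k (conj_transvection n (- 1) j k s) = s"
    by (rule conj_perm[OF ijk(2,3,6) _ X s]) auto
  show "c (conj_transvection n 1 j k s) * N (conj_transvection n 1 j k s) $$ (i, i) = c s * N s $$ (i, i)"
    using s ijk conj_R(2)[of s j k 1] by (auto simp: N_conj)
  show "N (conj_transvection n 1 j k s) $$ (j, i) / N (conj_transvection n 1 j k s) $$ (k, i) =
      N s $$ (j, i) / N s $$ (k, i) + 1"
    using s ijk by (auto simp: N_conj field_simps)
qed

lemma frobenius_mult_closed: "a ^ q = a \<Longrightarrow> b ^ q = b \<Longrightarrow> (a * b::'k) ^ q = a * b"
  and frobenius_divide_closed: "a ^ q = a \<Longrightarrow> b ^ q = b \<Longrightarrow> (a / b::'k) ^ q = a / b"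
  and frobenius_diff_closed: "a ^ q = a \<Longrightarrow> b ^ q = b \<Longrightarrow> (a - b::'k) ^ q = a - b"
  by (simp_all add: power_mult_distrib power_divide frobenius_diff)

text \<open>Without a third index, each reflection is conjugated by a transvection that depends on it: \<open>1 + a E\<^sub>i\<^sub>j\<close> adds
  \<open>a N s $$ (j, i)\<close> to the entry \<open>(i, i)\<close>, and \<open>a\<close> is chosen to turn that entry into its \<open>\<mu>\<close>-fold. The entry
  \<open>(j, i)\<close> is not changed, so the same recipe with \<open>1 / \<mu>\<close> is inverse to this one. The sum is therefore equal to
  its own \<open>\<mu>\<close>-fold.\<close>

lemma sum_diagonal_B':
  assumes ij: "i < n" "j < n" "i \<noteq> j" and q: "q > 2"
  shows "(\<Sum>s\<in>{s\<in>R. N s $$ (j, i) \<noteq> 0}. c s * N s $$ (i, i)) = 0"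
proof -
  let ?X = "{s\<in>R. N s $$ (j, i) \<noteq> 0}"
  obtain \<mu> :: 'k where \<mu>: "\<mu> ^ q = \<mu>" "\<mu> \<noteq> 0" "\<mu> \<noteq> 1" using generic_scalar[OF q] by blast
  define a where "a \<nu> s = (\<nu> - 1) * N s $$ (i, i) / N s $$ (j, i)" for \<nu> :: 'k and s
  define \<phi> where "\<phi> \<nu> s = conj_transvection n (a \<nu> s) i j s" for \<nu> s
  have a: "a \<nu> s ^ q = a \<nu> s" if "s \<in> R" "\<nu> ^ q = \<nu>" for \<nu> s
    unfolding a_def using that N_frobenius[OF that(1)] ij
    by (intro frobenius_divide_closed frobenius_mult_closed frobenius_diff_closed) auto
  have \<phi>: "\<phi> \<nu> s \<in> ?X" "N (\<phi> \<nu> s) $$ (i, i) = \<nu> * N s $$ (i, i)" "N (\<phi> \<nu> s) $$ (j, i) = N s $$ (j, i)"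
    "c (\<phi> \<nu> s) = c s"
    if "s \<in> ?X" "\<nu> ^ q = \<nu>" for \<nu> s
    using that conj_R(1,2)[OF _ ij a[OF _ that(2)], of s s] ij
    by (auto simp: \<phi>_def N_conj a_def field_simps)
  have inv: "\<phi> (inverse \<nu>) (\<phi> \<nu> s) = s" if "s \<in> ?X" "\<nu> ^ q = \<nu>" "\<nu> \<noteq> 0" for \<nu> s
  proof -
    have "a (inverse \<nu>) (\<phi> \<nu> s) = - a \<nu> s"
      using that \<phi>[OF that(1,2)] by (simp add: a_def[of "inverse \<nu>"]) (simp add: a_def field_simps)
    then show ?thesis
      using conj_R(3)[OF _ ij a[OF _ that(2)], of s s] that by (simp add: \<phi>_def[of "inverse \<nu>"]) (simp add: \<phi>_def)
  qed
  have \<mu>': "inverse \<mu> ^ q = inverse \<mu>" using \<mu> by (simp add: power_inverse)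
  have "(\<Sum>s\<in>?X. c s * N s $$ (i, i)) = (\<Sum>s\<in>?X. c (\<phi> \<mu> s) * N (\<phi> \<mu> s) $$ (i, i))"
    by (rule sum.reindex_bij_witness[of _ "\<phi> \<mu>" "\<phi> (inverse \<mu>)"])
      (use \<phi>(1)[OF _ \<mu>(1)] \<phi>(1)[OF _ \<mu>'] inv[OF _ \<mu>(1,2)] inv[OF _ \<mu>'] \<mu>(2) in auto)
  also have "\<dots> = (\<Sum>s\<in>?X. \<mu> * (c s * N s $$ (i, i)))"
    by (intro sum.cong refl) (simp add: \<phi>(2,4) \<mu>(1))
  also have "\<dots> = \<mu> * (\<Sum>s\<in>?X. c s * N s $$ (i, i))" by (simp add: sum_distrib_left)
  finally have "(1 - \<mu>) * (\<Sum>s\<in>?X. c s * N s $$ (i, i)) = 0" by (simp add: algebra_simps)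
  then show ?thesis using \<mu>(3) by simp
qed

text \<open>The two parts are \<open>N s $$ (j, i) = 0\<close> and \<open>N s $$ (j, i) \<noteq> 0\<close>, for any \<open>j \<noteq> i\<close>; for the second one either \<open>q > 2\<close> or there is a
  third index. An infinite sum would be zero by convention.\<close>

lemma sum_diagonal:
  assumes "(q, n) \<noteq> (2, 2)" "i < n"
  shows "(\<Sum>s\<in>R. c s * N s $$ (i, i)) = 0"
proof (cases "finite R")
  case True
  have "\<exists>j<n. i \<noteq> j" using n_ge_2 by (intro exI[of _ "if i = 0 then 1 else 0"]) auto
  then obtain j where j: "j < n" "i \<noteq> j" by blast
  have B: "(\<Sum>s\<in>{s\<in>R. N s $$ (j, i) \<noteq> 0}. c s * N s $$ (i, i)) = 0"
  proof (cases "q > 2")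
    case True
    then show ?thesis using sum_diagonal_B' assms j by blast
  next
    case False
    then have "n \<ge> 3" using q_gt_1 assms n_ge_2 by auto
    then have "\<not> {..<n} \<subseteq> {i, j}"
      using card_mono[of "{i, j}" "{..<n}"] j by (auto simp: card_insert_if)
    then obtain k where "k < n" "k \<noteq> i" "k \<noteq> j" by auto
    then show ?thesis using sum_diagonal_B[of i k j] assms j by auto
  qed
  have "(\<Sum>s\<in>R. c s * N s $$ (i, i)) = (\<Sum>s\<in>{s\<in>R. N s $$ (j, i) \<noteq> 0}. c s * N s $$ (i, i)) +
      (\<Sum>s\<in>R - {s\<in>R. N s $$ (j, i) \<noteq> 0}. c s * N s $$ (i, i))"
    using True by (subst sum.subset_diff[of "{s\<in>R. N s $$ (j, i) \<noteq> 0}" R]) (auto simp: add.commute)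
  also have "(\<Sum>s\<in>R - {s\<in>R. N s $$ (j, i) \<noteq> 0}. c s * N s $$ (i, i)) =
      (\<Sum>s\<in>{s\<in>R. N s $$ (i, i) \<noteq> 0 \<and> N s $$ (j, i) = 0}. c s * N s $$ (i, i))"
    using True by (intro sum.mono_neutral_right) auto
  finally show ?thesis using B sum_diagonal_A[OF assms(2) j] by simp
qed simp

text \<open>Conjugation by \<open>1 + E\<^sub>j\<^sub>i\<close> adds the entry \<open>(i, j)\<close> to the entry \<open>(j, j)\<close>; since it permutes the
  reflections, the off-diagonal sum is the difference of two equal diagonal sums.\<close>

lemma sum_entries:
  assumes "(q, n) \<noteq> (2, 2)" "i < n" "j < n"
  shows "(\<Sum>s\<in>R. c s * N s $$ (i, j)) = 0"
proof (cases "i = j")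
  case True
  then show ?thesis using sum_diagonal assms by simp
next
  case False
  have ji: "j < n" "i < n" "j \<noteq> i" using assms False by auto
  have one: "(1::'k) ^ q = 1" by simp
  note perm = conj_perm[OF ji order_refl conj_R(1)[OF _ ji]]
  have "(\<Sum>s\<in>R. c s * N s $$ (j, j)) =
      (\<Sum>s\<in>R. c (conj_transvection n 1 j i s) * N (conj_transvection n 1 j i s) $$ (j, j))"
    by (rule sum.reindex_bij_witness[of _ "conj_transvection n 1 j i" "conj_transvection n (- 1) j i"])
      (simp_all add: perm)
  also have "\<dots> = (\<Sum>s\<in>R. c s * N s $$ (j, j)) + (\<Sum>s\<in>R. c s * N s $$ (i, j))"
    using ji by (simp add: N_conj conj_R(2)[OF _ ji one] distrib_left sum.distrib)
  finally show ?thesis by simp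
qed

end

section \<open>Characters and Hilbert series from a realization\<close>

context contravariant_pair
begin

theorem L_piece_class:
  assumes "is_rep (rca_grp D) (d, W)" and "bij_betw \<psi> (carrier_vec d) (V i)"
    and "\<And>u v. u \<in> carrier_vec d \<Longrightarrow> v \<in> carrier_vec d \<Longrightarrow> \<psi> (u + v) = \<psi> u + \<psi> v"
    and "\<And>a v. v \<in> carrier_vec d \<Longrightarrow> \<psi> (a \<cdot>\<^sub>v v) = scale a (\<psi> v)"
    and "\<And>g v. g \<in> carrier (rca_grp D) \<Longrightarrow> v \<in> carrier_vec d \<Longrightarrow> \<psi> (W g *\<^sub>v v) = opr (GG g) (\<psi> v)"
  shows "character_L D triv_rep i = K0_class (rca_grp D) (d, W)" and "hilbert_L D triv_rep i = d"
  using rep_class_eq[OF assms(1) L_piece_isomorphic(2)[OF assms(2-5)]]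
    rep_dim_eq[OF L_piece_isomorphic(1)[OF assms(2-4)]]
  by (simp_all add: character_L_def hilbert_L_def)

lemma L_piece_class_zero:
  assumes "V i = {0}"
  shows "character_L D triv_rep i = \<one>\<^bsub>K0 (rca_grp D)\<^esub>" and "hilbert_L D triv_rep i = 0"
proof -
  have Z: "is_rep (rca_grp D) (0, \<lambda>_. 1\<^sub>m 0 :: 'k mat)" by (simp add: is_rep_def)
  have "bij_betw (\<lambda>_. 0) (carrier_vec 0 :: 'k vec set) (V i)"
    unfolding assms using image_constant[OF zero_carrier_vec, of "0::'v" 0]
    by (auto simp: bij_betw_def inj_on_def intro: zero_carrier_vec)
  then have "character_L D triv_rep i = K0_class (rca_grp D) (0, \<lambda>_. 1\<^sub>m 0 :: 'k mat) \<and> hilbert_L D triv_rep i = 0"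
    using L_piece_class[OF Z, of "\<lambda>_. 0" i] opr_scale[of _ 0 0] by simp
  then show "character_L D triv_rep i = \<one>\<^bsub>K0 (rca_grp D)\<^esub>" "hilbert_L D triv_rep i = 0"
    using K0_class_zero[OF Z] by simp_all
qed

end

section \<open>The case of a one-dimensional irreducible module\<close>

text \<open>The trivial action of \<open>G\<close> on the ground field, with \<open>h\<close> and \<open>h\<^sup>*\<close> acting by zero.\<close>

definition augmentation :: "'g gen \<Rightarrow> 'k::field \<Rightarrow> 'k" where
  "augmentation l x = (case l of GG g \<Rightarrow> x | _ \<Rightarrow> 0)"

lemma augmentation_simps [simp]:
  "augmentation (GG g) x = x" "augmentation (GX i) x = 0" "augmentation (GY i) x = 0"
  by (simp_all add: augmentation_def)

definition degree_zero :: "int \<Rightarrow> 'k::field set" where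
  "degree_zero i = (if i = 0 then UNIV else {0})"

lemma linear_operators_augmentation: "linear_operators (*) augmentation"
  by unfold_locales (auto simp: algebra_simps augmentation_def split: gen.split)

lemma (in rational_cherednik) graded_operators_augmentation:
  "graded_operators D (*) augmentation 1 degree_zero"
proof -
  interpret linear_operators "(*)" augmentation by (rule linear_operators_augmentation)
  show ?thesis
  proof unfold_locales
    fix l :: "'g gen" and x :: 'k and j assume "x \<in> degree_zero j"
    then show "augmentation l x \<in> degree_zero (j + gdeg l)"
      by (cases l) (auto simp: degree_zero_def)
  qed (auto simp: degree_zero_def split: if_splits)
qed

text \<open>Commutators of \<open>x\<close> and \<open>y\<close> act by zero, so \<open>[y, x]\<close> must be sent to zero by the trivial representation; this is the
  hypothesis \<open>vanish\<close>. The pairing is multiplication in the field.\<close>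

lemma (in rational_cherednik) contravariant_pair_augmentation:
  assumes t: "rca_t D = 0"
    and vanish: "\<And>x y. x \<in> carrier_vec (rca_dim D) \<Longrightarrow> y \<in> carrier_vec (rca_dim D) \<Longrightarrow>
      (\<Sum>s\<in>reflections D. rca_c D s * (y \<bullet> (x - contra (rca_grp D) (rca_rep D) s *\<^sub>v x))) = 0"
  shows "contravariant_pair D (*) augmentation 1 degree_zero (*) augmentation 1 degree_zero (*)"
proof -
  interpret A: linear_operators "(*) :: 'k \<Rightarrow> _" "augmentation :: 'g gen \<Rightarrow> _" by (rule linear_operators_augmentation)
  interpret A: graded_operators D "(*)" augmentation 1 degree_zero by (rule graded_operators_augmentation)
  interpret A: cherednik_module D "(*)" augmentation 1 degree_zero
  proof unfold_locales
    fix r x assume r: "r \<in> smash_rels D \<union> cherednik_rels D"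
    show "A.alg_act r x = 0"
      using r unfolding smash_rels_def cherednik_rels_def Let_def
    proof (elim UnE CollectE exE conjE insertE emptyE)
      fix y v
      assume *: "r = yel y * xel v - xel v * yel y - (scal (rca_t D * (y \<bullet> v)) -
          (\<Sum>s\<in>reflections D. scal (rca_c D s * (y \<bullet> (v - contra (rca_grp D) (rca_rep D) s *\<^sub>v v))) * gel s))"
        "y \<in> carrier_vec (rca_dim D)" "v \<in> carrier_vec (rca_dim D)"
      have "(\<Sum>s\<in>reflections D. rca_c D s * (y \<bullet> (v - contra (rca_grp D) (rca_rep D) s *\<^sub>v v)) * x) = 0"
        unfolding sum_distrib_right[symmetric] using vanish[OF *(3,2)] by simp
      then show ?thesis unfolding *(1) using t by simp
    qed simp_all
  qed
  interpret D': rational_cherednik "dual_rca D" by (rule dual_rational_cherednik)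
  show ?thesis
  proof (intro contravariant_pair.intro contravariant_pair_axioms.intro)
    show "cherednik_module D (*) augmentation 1 degree_zero" by unfold_locales
    show "graded_operators (dual_rca D) (*) augmentation 1 degree_zero"
      by (rule D'.graded_operators_augmentation)
    show "augmentation l f * x = f * augmentation (opp_gen (rca_grp D) l) x" for l and f x :: 'k
      by (cases l) auto
    show "f = 0" if "\<And>x. f * x = 0" for f :: 'k using that[of 1] by simp
    show "x = 0" if "\<And>f. f * x = 0" for x :: 'k using that[of 1] by simp
    show "f * x = 0" if "i \<noteq> j" "f \<in> degree_zero i" "x \<in> degree_zero j" for f x :: 'k and i j
      using that by (auto simp: degree_zero_def split: if_splits)
    show "\<exists>J. finite J \<and> (\<forall>x::'k. \<exists>f. (\<forall>j\<in>J. f j \<in> degree_zero j) \<and> x = sum f J)"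
      by (intro exI[of _ "{0}"]) (auto simp: degree_zero_def intro!: exI[of _ "\<lambda>_. _"])
    show "\<exists>a\<in>homogeneous D i. A.alg_act a 1 = x" if "x \<in> degree_zero i" for x :: 'k and i
    proof (cases "i = 0")
      case True
      then show ?thesis by (intro bexI[of _ "scal x"]) (auto simp: scal_def intro!: homogeneous_single)
    next
      case False
      then show ?thesis using that by (intro bexI[of _ 0]) (auto simp: degree_zero_def homogeneous_zero)
    qed
    show "\<exists>a\<in>carrier (free_alg D). A.alg_act a 1 = f" for f :: 'k
      by (intro bexI[of _ "scal f"]) (auto intro: free_alg_closed)
    show "(f + f') * x = f * x + f' * x" for f f' x :: 'k by (rule distrib_right)
    show "f * (x + x') = f * x + f * x'" for f x x' :: 'k by (rule distrib_left)
    show "a * f * x = a * (f * x)" for a f x :: 'k by (rule mult.assoc)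
    show "f * (a * x) = a * (f * x)" for a f x :: 'k by (rule mult.left_commute)
    show "1 * (1::'k) = 1" by simp
  qed
qed

theorem (in rational_cherednik) L_triv_one_dimensional:
  assumes t: "rca_t D = 0"
    and vanish: "\<And>x y. x \<in> carrier_vec (rca_dim D) \<Longrightarrow> y \<in> carrier_vec (rca_dim D) \<Longrightarrow>
      (\<Sum>s\<in>reflections D. rca_c D s * (y \<bullet> (x - contra (rca_grp D) (rca_rep D) s *\<^sub>v x))) = 0"
  shows "character_L D triv_rep = poly_series \<one>\<^bsub>K0 (rca_grp D)\<^esub> [K0_class (rca_grp D) triv_rep]"
    and "hilbert_L D triv_rep = poly_series 0 [1]"
proof -
  note pair = contravariant_pair_augmentation[OF t vanish]
  have 0: "character_L D triv_rep 0 = K0_class (rca_grp D) triv_rep \<and> hilbert_L D triv_rep 0 = 1"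
  proof -
    have "bij_betw (\<lambda>v. v $ 0) (carrier_vec 1 :: 'k vec set) (degree_zero 0)"
    proof (rule bij_betwI[where g = "\<lambda>a. vec 1 (\<lambda>_. a)"])
      show "vec 1 (\<lambda>_. v $ 0) = v" if "v \<in> carrier_vec 1" for v :: "'k vec"
        using that by (intro eq_vecI) auto
    qed (auto simp: degree_zero_def)
    moreover have "is_rep (rca_grp D) (1, \<lambda>_. 1\<^sub>m 1 :: 'k mat)"
      using is_rep_triv by (simp add: triv_rep_def)
    ultimately show ?thesis
      using contravariant_pair.L_piece_class[OF pair, of 1 "\<lambda>_. 1\<^sub>m 1" "\<lambda>v. v $ 0" 0] by (simp add: triv_rep_def)
  qed
  have other: "character_L D triv_rep i = \<one>\<^bsub>K0 (rca_grp D)\<^esub> \<and> hilbert_L D triv_rep i = 0" if "i \<noteq> 0" for i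
    using contravariant_pair.L_piece_class_zero[OF pair, of i] that by (simp add: degree_zero_def)
  show "character_L D triv_rep = poly_series \<one>\<^bsub>K0 (rca_grp D)\<^esub> [K0_class (rca_grp D) triv_rep]"
  proof
    show "character_L D triv_rep i = poly_series \<one>\<^bsub>K0 (rca_grp D)\<^esub> [K0_class (rca_grp D) triv_rep] i" for i
      using 0 other[of i] by (cases "i = 0") (auto simp: poly_series_def)
  qed
  show "hilbert_L D triv_rep = poly_series 0 [1]"
  proof
    show "hilbert_L D triv_rep i = poly_series 0 [1] i" for i
      using 0 other[of i] by (cases "i = 0") (auto simp: poly_series_def)
  qed
qed

lemma mult_mat_vec_index:
  assumes "A \<in> carrier_mat n m" "y \<in> carrier_vec m" "i < n"
  shows "(A *\<^sub>v y) $ i = (\<Sum>j<m. A $$ (i, j) * y $ j)"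
  using assms by (auto simp: scalar_prod_def atLeast0LessThan intro!: sum.cong)

text \<open>In the commutator the reflections act on \<open>h\<^sup>*\<close>. Passing to the action on \<open>h\<close> replaces \<open>s\<close> by its inverse, so the vanishing of
  the sums of entries is applied to the function \<open>s \<mapsto> c(s\<^sup>-\<^sup>1)\<close>, which is invariant as well.\<close>

theorem (in GL_parameters) L_triv_GL:
  assumes t: "t = 0" and *: "(q, n) \<noteq> (2, 2) \<or> (\<forall>s\<in>R. c s = 0)"
  shows "character_L (GL_rca n q t c) triv_rep = poly_series \<one>\<^bsub>K0 (G n q)\<^esub> [K0_class (G n q) triv_rep]"
    and "hilbert_L (GL_rca n q t c) triv_rep = poly_series 0 [1]"
proof -
  interpret D: rational_cherednik "GL_rca n q t c" by (rule rational_cherednik_GL)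
  interpret group "G n q" by (rule group_GL)
  have "(\<Sum>s\<in>R. c s * (y \<bullet> (x - contra (G n q) (\<lambda>g. g) s *\<^sub>v x))) = 0"
    if x: "x \<in> carrier_vec n" and y: "y \<in> carrier_vec n" for x y
  proof (cases "\<forall>s\<in>R. c s = 0")
    case False
    then have qn: "(q, n) \<noteq> (2, 2)" using * by auto
    let ?c = "\<lambda>s. c (inv\<^bsub>G n q\<^esub> s)"
    have R': "reflections (GL_rca n q t ?c) = R"
      using reflections_GL[of _ n t c] reflections_GL[of _ n t ?c] by blast
    interpret c': GL_parameters q ty n t ?c
    proof unfold_locales
      have "c (inv\<^bsub>G n q\<^esub> (g \<otimes>\<^bsub>G n q\<^esub> s \<otimes>\<^bsub>G n q\<^esub> inv\<^bsub>G n q\<^esub> g)) = c (inv\<^bsub>G n q\<^esub> s)"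
        if g: "g \<in> carrier (G n q)" and s: "s \<in> R" for g s
      proof -
        have sG: "s \<in> carrier (G n q)" using D.reflections_closed[OF s] by simp
        have "inv\<^bsub>G n q\<^esub> (g \<otimes>\<^bsub>G n q\<^esub> s \<otimes>\<^bsub>G n q\<^esub> inv\<^bsub>G n q\<^esub> g) =
            g \<otimes>\<^bsub>G n q\<^esub> inv\<^bsub>G n q\<^esub> s \<otimes>\<^bsub>G n q\<^esub> inv\<^bsub>G n q\<^esub> g"
          using g sG by (simp add: inv_mult_group m_assoc del: GL_mult)
        then show ?thesis
          using c_invariant g D.reflections_inv[OF s] by (simp add: conj_invariant_def del: GL_mult)
      qed
      then show "conj_invariant (GL_rca n q t ?c)"
        unfolding conj_invariant_def R' by (simp del: GL_mult)
    qed (use generic_scalar q_gt_1 n_ge_2 in auto)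
    have "(\<Sum>s\<in>R. c s * (y \<bullet> (x - contra (G n q) (\<lambda>g. g) s *\<^sub>v x))) =
        (\<Sum>s\<in>R. c s * (x \<bullet> (y - inv\<^bsub>G n q\<^esub> s *\<^sub>v y)))"
      using D.pairing_contra[of y x] x y D.reflections_closed by (intro sum.cong) auto
    also have "\<dots> = (\<Sum>s\<in>R. ?c s * (x \<bullet> (y - s *\<^sub>v y)))"
      by (rule sum.reindex_bij_witness[of _ "\<lambda>s. inv\<^bsub>G n q\<^esub> s" "\<lambda>s. inv\<^bsub>G n q\<^esub> s"])
        (use D.reflections_inv D.reflections_closed in auto)
    also have "\<dots> = (\<Sum>s\<in>R. \<Sum>i<n. \<Sum>j<n. (x $ i * y $ j) * (?c s * N s $$ (i, j)))"
    proof (rule sum.cong[OF refl])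
      fix s assume s: "s \<in> R"
      have sc: "s \<in> carrier_mat n n" "N s \<in> carrier_mat n n" using N_carrier[OF s] by auto
      have "y - s *\<^sub>v y = N s *\<^sub>v y"
        using sc y by (simp add: minus_mult_distrib_mat_vec[of _ n n])
      moreover have "(N s *\<^sub>v y) $ i = (\<Sum>j<n. N s $$ (i, j) * y $ j)" if "i < n" for i
        by (rule mult_mat_vec_index[OF sc(2) y that])
      ultimately have "x \<bullet> (y - s *\<^sub>v y) = (\<Sum>i<n. x $ i * (\<Sum>j<n. N s $$ (i, j) * y $ j))"
        using sc(2) by (simp add: scalar_prod_def[of x] atLeast0LessThan carrier_matD(1)[OF sc(1)])
      then show "?c s * (x \<bullet> (y - s *\<^sub>v y)) = (\<Sum>i<n. \<Sum>j<n. (x $ i * y $ j) * (?c s * N s $$ (i, j)))"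
        by (simp add: sum_distrib_left mult_ac)
    qed
    also have "\<dots> = (\<Sum>i<n. \<Sum>j<n. (x $ i * y $ j) * (\<Sum>s\<in>R. ?c s * N s $$ (i, j)))"
      by (subst sum.swap) (simp add: sum.swap[of _ R] sum_distrib_left)
    also have "\<dots> = 0"
      using c'.sum_entries[OF qn] unfolding R' by simp
    finally show ?thesis .
  qed simp
  then show "character_L (GL_rca n q t c) triv_rep = poly_series \<one>\<^bsub>K0 (G n q)\<^esub> [K0_class (G n q) triv_rep]"
    "hilbert_L (GL_rca n q t c) triv_rep = poly_series 0 [1]"
    using D.L_triv_one_dimensional t by simp_all
qed

section \<open>The coinvariant algebra for two-by-two matrices over the field of two elements\<close>

subsection \<open>Two-by-two matrices\<close>

definition m2 :: "'k \<Rightarrow> 'k \<Rightarrow> 'k \<Rightarrow> 'k \<Rightarrow> 'k::field mat" where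
  "m2 a b c d = mat 2 2 (\<lambda>(i, j). if i = 0 then if j = 0 then a else b else if j = 0 then c else d)"

lemma m2_carrier [simp]: "m2 a b c d \<in> carrier_mat 2 2"
  by (simp add: m2_def)

lemma m2_dim [simp]: "dim_row (m2 a b c d) = 2" "dim_col (m2 a b c d) = 2"
  by (simp_all add: m2_def)

lemma m2_index [simp]:
  "m2 a b c d $$ (0, 0) = a" "m2 a b c d $$ (0, Suc 0) = b"
  "m2 a b c d $$ (Suc 0, 0) = c" "m2 a b c d $$ (Suc 0, Suc 0) = d"
  by (simp_all add: m2_def)

lemma mat_2_eqI:
  assumes "A \<in> carrier_mat 2 2" "B \<in> carrier_mat 2 2" "A $$ (0, 0) = B $$ (0, 0)" "A $$ (0, Suc 0) = B $$ (0, Suc 0)"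
    "A $$ (Suc 0, 0) = B $$ (Suc 0, 0)" "A $$ (Suc 0, Suc 0) = B $$ (Suc 0, Suc 0)"
  shows "A = B"
  using assms by (intro eq_matI) (auto simp: less_2_cases_iff)

lemma m2_eta: "A \<in> carrier_mat 2 2 \<Longrightarrow> A = m2 (A $$ (0, 0)) (A $$ (0, Suc 0)) (A $$ (Suc 0, 0)) (A $$ (Suc 0, Suc 0))"
  by (rule mat_2_eqI) simp_all

lemma m2_inject [simp]: "m2 a b c d = m2 a' b' c' d' \<longleftrightarrow> a = a' \<and> b = b' \<and> c = c' \<and> d = d'"
proof
  assume eq: "m2 a b c d = m2 a' b' c' d'"
  show "a = a' \<and> b = b' \<and> c = c' \<and> d = d'"
    using arg_cong[OF eq, of "\<lambda>A. A $$ (0, 0)"] arg_cong[OF eq, of "\<lambda>A. A $$ (0, Suc 0)"]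
      arg_cong[OF eq, of "\<lambda>A. A $$ (Suc 0, 0)"] arg_cong[OF eq, of "\<lambda>A. A $$ (Suc 0, Suc 0)"]
    by simp
qed simp

lemma sum_below_2:
  "sum f {..<2::nat} = f 0 + f (Suc 0)" "sum f {0..<2::nat} = f 0 + f (Suc 0)"
  by (simp_all add: numeral_2_eq_2)

lemma m2_mult [simp]:
  "m2 a b c d * m2 a' b' c' d' = m2 (a * a' + b * c') (a * b' + b * d') (c * a' + d * c') (c * b' + d * d')"
  by (rule mat_2_eqI[OF mult_carrier_mat[of _ 2 2]]) (simp_all add: scalar_prod_def sum_below_2)

lemma m2_transpose [simp]: "(m2 a b c d)\<^sup>T = m2 a c b d"
  by (rule mat_2_eqI) simp_all

lemma m2_one: "1\<^sub>m 2 = m2 1 0 0 1"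
  by (rule mat_2_eqI) simp_all

lemma m2_minus [simp]: "m2 a b c d - m2 a' b' c' d' = m2 (a - a') (b - b') (c - c') (d - d')"
  by (rule mat_2_eqI) (simp_all add: minus_carrier_mat)

lemma scalar_prod_2: "v \<in> carrier_vec 2 \<Longrightarrow> w \<in> carrier_vec 2 \<Longrightarrow> v \<bullet> w = v $ 0 * w $ 0 + v $ Suc 0 * w $ Suc 0"
  by (simp add: scalar_prod_def sum_below_2)

lemma mult_mat_vec_2:
  assumes "A \<in> carrier_mat 2 2" "v \<in> carrier_vec 2"
  shows "(A *\<^sub>v v) $ 0 = A $$ (0, 0) * v $ 0 + A $$ (0, Suc 0) * v $ Suc 0"
    "(A *\<^sub>v v) $ Suc 0 = A $$ (Suc 0, 0) * v $ 0 + A $$ (Suc 0, Suc 0) * v $ Suc 0"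
  using mult_mat_vec_index[OF assms, of 0] mult_mat_vec_index[OF assms, of "Suc 0"]
  by (simp_all add: sum_below_2)

text \<open>The determinant is zero exactly when one row is a multiple of the other.\<close>

lemma outer_product_form_m2: "outer_product_form 2 (m2 a b c d) \<longleftrightarrow> a * d = b * c"
proof
  assume "outer_product_form 2 (m2 a b c d)"
  then obtain f g where "\<And>i j. i < 2 \<Longrightarrow> j < 2 \<Longrightarrow> m2 a b c d $$ (i, j) = f i * g j"
    by (auto simp: outer_product_form_def)
  from this[of 0 0] this[of 0 "Suc 0"] this[of "Suc 0" 0] this[of "Suc 0" "Suc 0"]
  show "a * d = b * c" by simp
next
  assume *: "a * d = b * c"
  show "outer_product_form 2 (m2 a b c d)"
  proof (cases "a = 0 \<and> b = 0")
    case True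
    then show ?thesis
      by (intro outer_product_formI[of _ _ "\<lambda>i. if i = 0 then 0 else 1" "\<lambda>j. if j = 0 then c else d"])
        (auto simp: less_2_cases_iff)
  next
    case False
    let ?l = "if a = 0 then d / b else c / a"
    show ?thesis
      using * False
      by (intro outer_product_formI[of _ _ "\<lambda>i. if i = 0 then 1 else ?l" "\<lambda>j. if j = 0 then a else b"])
        (auto simp: less_2_cases_iff field_simps)
  qed
qed

subsection \<open>The graded vector space and its operators\<close>

text \<open>Coordinates with respect to the basis \<open>1, x, y, x\<^sup>2, y\<^sup>2, x\<^sup>2 y\<close> of
  \<open>k[x, y] / (x\<^sup>2 + x y + y\<^sup>2, x\<^sup>2 y + x y\<^sup>2)\<close> in characteristic \<open>2\<close>. With tuples all identities between operators become
  identities between their components, which the simplifier decides.\<close>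

type_synonym 'k coinv = "'k \<times> 'k \<times> 'k \<times> 'k \<times> 'k \<times> 'k"

fun coinv_scale :: "'k::field \<Rightarrow> 'k coinv \<Rightarrow> 'k coinv" where
  "coinv_scale r (a0, a1, a2, a3, a4, a5) = (r * a0, r * a1, r * a2, r * a3, r * a4, r * a5)"

text \<open>\<open>A\<close> is the matrix of the substitution on \<open>x, y\<close>. It has the same effect on \<open>x\<^sup>2, y\<^sup>2\<close>, its entries being equal to
  their squares, and fixes \<open>x\<^sup>2 y\<close>, its determinant being \<open>1\<close>.\<close>

fun coinv_group :: "'k::field mat \<Rightarrow> 'k coinv \<Rightarrow> 'k coinv" where
  "coinv_group A (a0, a1, a2, a3, a4, a5) =
    (a0, A $$ (0, 0) * a1 + A $$ (0, Suc 0) * a2, A $$ (Suc 0, 0) * a1 + A $$ (Suc 0, Suc 0) * a2,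
     A $$ (0, 0) * a3 + A $$ (0, Suc 0) * a4, A $$ (Suc 0, 0) * a3 + A $$ (Suc 0, Suc 0) * a4, a5)"

text \<open>Multiplication by \<open>x\<close> (index \<open>0\<close>) and by \<open>y\<close>. In the quotient \<open>x y = x\<^sup>2 + y\<^sup>2\<close>, \<open>x y\<^sup>2 = x\<^sup>2 y\<close> and \<open>x\<^sup>3 = y\<^sup>3 = 0\<close>.\<close>

fun coinv_mult :: "nat \<Rightarrow> 'k::field coinv \<Rightarrow> 'k coinv" where
  "coinv_mult i (a0, a1, a2, a3, a4, a5) =
    (if i = 0 then (0, a0, 0, a1 + a2, a2, a4) else (0, 0, a0, a1, a1 + a2, a3))"

text \<open>The Dunkl operators for \<open>c = 1\<close>. They are the transposes of the multiplications.\<close>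

fun coinv_dunkl :: "nat \<Rightarrow> 'k::field coinv \<Rightarrow> 'k coinv" where
  "coinv_dunkl i (a0, a1, a2, a3, a4, a5) =
    (if i = 0 then (a1, a3, a3 + a4, 0, a5, 0) else (a2, a3 + a4, a4, a5, 0, 0))"

fun coinv_pair :: "'k::field coinv \<Rightarrow> 'k coinv \<Rightarrow> 'k" where
  "coinv_pair (b0, b1, b2, b3, b4, b5) (a0, a1, a2, a3, a4, a5) =
    b0 * a0 + b1 * a1 + b2 * a2 + b3 * a3 + b4 * a4 + b5 * a5"

text \<open>The scalars \<open>\<alpha>\<close> and \<open>\<beta>\<close> allow one definition for both sides of the pairing: the parameter \<open>c\<close> multiplies the Dunkl
  operators on one side, hence their transposes, the multiplications, on the other.\<close>

definition coinv_opr :: "('g \<Rightarrow> 'k::field mat) \<Rightarrow> 'k \<Rightarrow> 'k \<Rightarrow> 'g gen \<Rightarrow> 'k coinv \<Rightarrow> 'k coinv" where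
  "coinv_opr A \<alpha> \<beta> l = (case l of GG g \<Rightarrow> coinv_group (A g)
     | GX i \<Rightarrow> coinv_scale \<alpha> \<circ> coinv_mult i | GY i \<Rightarrow> coinv_scale \<beta> \<circ> coinv_dunkl i)"

lemma coinv_opr_simps [simp]:
  "coinv_opr A \<alpha> \<beta> (GG g) v = coinv_group (A g) v"
  "coinv_opr A \<alpha> \<beta> (GX i) v = coinv_scale \<alpha> (coinv_mult i v)"
  "coinv_opr A \<alpha> \<beta> (GY i) v = coinv_scale \<beta> (coinv_dunkl i v)"
  by (simp_all add: coinv_opr_def)

fun coinv_piece :: "int \<Rightarrow> 'k::field coinv \<Rightarrow> bool" where
  "coinv_piece i (a0, a1, a2, a3, a4, a5) \<longleftrightarrow>
    (i \<noteq> 0 \<longrightarrow> a0 = 0) \<and> (i \<noteq> 1 \<longrightarrow> a1 = 0 \<and> a2 = 0) \<and> (i \<noteq> 2 \<longrightarrow> a3 = 0 \<and> a4 = 0) \<and> (i \<noteq> 3 \<longrightarrow> a5 = 0)"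

abbreviation coinv_one :: "'k::field coinv" where
  "coinv_one \<equiv> (1, 0, 0, 0, 0, 0)"

lemma linear_operators_coinv:
  fixes A :: "'g \<Rightarrow> 'k::field mat"
  shows "linear_operators coinv_scale (coinv_opr A \<alpha> \<beta>)"
proof unfold_locales
  fix l :: "'g gen" and x y :: "'k coinv"
  show "coinv_opr A \<alpha> \<beta> l (x + y) = coinv_opr A \<alpha> \<beta> l x + coinv_opr A \<alpha> \<beta> l y"
    by (cases x rule: prod_cases6; cases y rule: prod_cases6; cases l) (auto simp: algebra_simps)
next
  fix l :: "'g gen" and r and x :: "'k coinv"
  show "coinv_opr A \<alpha> \<beta> l (coinv_scale r x) = coinv_scale r (coinv_opr A \<alpha> \<beta> l x)"
    by (cases x rule: prod_cases6; cases l) (auto simp: algebra_simps)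
next
  fix a b and x y :: "'k coinv"
  show "coinv_scale a (x + y) = coinv_scale a x + coinv_scale a y"
    by (cases x rule: prod_cases6; cases y rule: prod_cases6) (simp add: algebra_simps)
  show "coinv_scale (a + b) x = coinv_scale a x + coinv_scale b x"
    "coinv_scale a (coinv_scale b x) = coinv_scale (a * b) x" "coinv_scale 1 x = x"
    by (cases x rule: prod_cases6; simp add: algebra_simps)+
qed

lemma (in rational_cherednik) graded_operators_coinv:
  "graded_operators D coinv_scale (coinv_opr A \<alpha> \<beta>) coinv_one (\<lambda>i. Collect (coinv_piece i))"
proof -
  interpret linear_operators coinv_scale "coinv_opr A \<alpha> \<beta>" by (rule linear_operators_coinv)
  show ?thesis
  proof unfold_locales
    fix l :: "'g gen" and x :: "'k coinv" and j
    assume "x \<in> Collect (coinv_piece j)"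
    then show "coinv_opr A \<alpha> \<beta> l x \<in> Collect (coinv_piece (j + gdeg l))"
      by (cases x rule: prod_cases6; cases l) (auto split: if_splits)
  next
    fix x y :: "'k coinv" and j a assume x: "x \<in> Collect (coinv_piece j)"
    then show "coinv_scale a x \<in> Collect (coinv_piece j)" by (cases x rule: prod_cases6) auto
    assume "y \<in> Collect (coinv_piece j)"
    with x show "x + y \<in> Collect (coinv_piece j)"
      by (cases x rule: prod_cases6; cases y rule: prod_cases6) auto
  qed (simp_all add: zero_prod_def)
qed

subsection \<open>The group and its three reflections\<close>

locale GL_2_F_2 = GL_parameters 2 ty 2 0 c for ty :: "'k::field itself" and c +
  assumes two: "(1::'k) + 1 = 0"
begin

lemma char_2: "x + x = (0::'k)" "x + (x + y) = y" "- x = x" "x - y = x + y"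
proof -
  show *: "x + x = 0" for x :: 'k using two distrib_left[of x 1 1] by simp
  show m: "- x = x" for x :: 'k using *[of x] by (rule minus_unique)
  show "x - y = x + y" by (simp only: diff_conv_add_uminus m)
  show "x + (x + y) = y" using *[of x] by (simp flip: add.assoc)
qed

lemma two_zero [simp]: "(2::'k) = 0"
  using two by simp

lemma carrier_G_iff: "g \<in> carrier (G 2 2) \<longleftrightarrow>
    g \<in> {m2 1 0 0 1, m2 1 1 0 1, m2 1 0 1 1, m2 0 1 1 0, m2 1 1 1 0, m2 0 1 1 1}"
proof
  assume g: "g \<in> carrier (G 2 2)"
  then have gc: "g \<in> carrier_mat 2 2" by (simp add: GL_carrier)
  obtain B where B: "B \<in> carrier (G 2 2)" "g * B = 1\<^sub>m 2" using GL_inverse[OF g] by blast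
  have Bc: "B \<in> carrier_mat 2 2" using B by (simp add: GL_carrier)
  have idem: "x = 0 \<or> x = 1" if "x ^ 2 = x" for x :: 'k
    using that by (simp add: power2_eq_square)
  have e: "g $$ (i, j) = 0 \<or> g $$ (i, j) = 1" if "i < 2" "j < 2" for i j
    using g that by (intro idem) (auto simp: GL_Fq_def)
  obtain a b e d where abcd: "g = m2 a b e d" using m2_eta[OF gc] by blast
  obtain a' b' e' d' where B': "B = m2 a' b' e' d'" using m2_eta[OF Bc] by blast
  have "a = 0 \<or> a = 1" "b = 0 \<or> b = 1" "e = 0 \<or> e = 1" "d = 0 \<or> d = 1"
    using e[of 0 0] e[of 0 "Suc 0"] e[of "Suc 0" 0] e[of "Suc 0" "Suc 0"] by (simp_all add: abcd)
  moreover have "a * a' + b * e' = 1" "a * b' + b * d' = 0" "e * a' + d * e' = 0" "e * b' + d * d' = 1"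
    using B(2) by (simp_all add: abcd B' m2_one)
  ultimately show "g \<in> {m2 1 0 0 1, m2 1 1 0 1, m2 1 0 1 1, m2 0 1 1 0, m2 1 1 1 0, m2 0 1 1 1}"
    unfolding abcd by (elim disjE) simp_all
next
  have fro: "frobenius (m2 a b e d) = m2 (a ^ 2) (b ^ 2) (e ^ 2) (d ^ 2)" for a b e d
    by (rule mat_2_eqI) simp_all
  have I: "m2 a b e d \<in> carrier (G 2 2)" if "a * d + b * e = 1" "a ^ 2 = a" "b ^ 2 = b" "e ^ 2 = e" "d ^ 2 = d" for a b e d :: 'k
    by (rule GL_intro[of _ _ "m2 d b e a"]) (use that in \<open>simp_all add: m2_one fro char_2 mult.commute add.commute\<close>)
  assume "g \<in> {m2 1 0 0 1, m2 1 1 0 1, m2 1 0 1 1, m2 0 1 1 0, m2 1 1 1 0, m2 0 1 1 1}"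
  then show "g \<in> carrier (G 2 2)" by (auto intro!: I)
qed

abbreviation "A \<equiv> contra (G 2 2) (\<lambda>g. g)"

lemma contra_m2:
  assumes "m2 a b e d \<in> carrier (G 2 2)"
  shows "A (m2 a b e d) = m2 d e b a"
proof -
  have "a * d + b * e = 1 \<and> m2 d b e a \<in> carrier (G 2 2)" using assms by (auto simp: carrier_G_iff)
  then have "inv\<^bsub>G 2 2\<^esub> (m2 a b e d) = m2 d b e a"
    by (intro GL_inv[OF assms]) (auto simp: m2_one char_2 mult.commute add.commute)
  then show ?thesis by (simp add: contra_def)
qed

lemma is_rep_A: "is_rep (G 2 2) (2, A)"
proof -
  have "is_rep (G 2 2) (2, \<lambda>g. g)" by (simp add: is_rep_def GL_carrier)
  then show ?thesis by (rule is_rep_contra[OF group_GL])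
qed

lemma A_mult: "g \<in> carrier (G 2 2) \<Longrightarrow> h \<in> carrier (G 2 2) \<Longrightarrow> A (g * h) = A g * A h"
  using is_rep_A by (simp add: is_rep_def)

lemma A_one: "A (1\<^sub>m 2) = m2 1 0 0 1"
  by (simp add: m2_one contra_m2 carrier_G_iff)

lemma A_carrier [simp]: "g \<in> carrier (G 2 2) \<Longrightarrow> A g \<in> carrier_mat 2 2"
  by (rule is_rep_A[unfolded is_rep_def, THEN conjunct1, rule_format, simplified])

lemma R_eq: "R = {m2 1 1 0 1, m2 1 0 1 1, m2 0 1 1 0}"
proof -
  have "s \<in> {m2 1 1 0 1, m2 1 0 1 1, m2 0 1 1 0}" if "s \<in> R" for s
    using that unfolding reflections_GL carrier_G_iff m2_one
    by (elim conjE insertE emptyE) (simp_all add: outer_product_form_m2)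
  moreover have "s \<in> R" if "s \<in> {m2 1 1 0 1, m2 1 0 1 1, m2 0 1 1 0}" for s
    using that unfolding reflections_GL carrier_G_iff m2_one
    by (elim insertE emptyE) (simp_all add: outer_product_form_m2)
  ultimately show ?thesis by blast
qed

text \<open>The common value of \<open>c\<close> on the three reflections, which are conjugate to each other.\<close>

definition \<gamma> :: 'k where "\<gamma> = c (m2 1 1 0 1)"

lemma c_const:
  assumes "s \<in> R"
  shows "c s = \<gamma>"
proof -
  have inv: "\<forall>g\<in>carrier (G 2 2). \<forall>s\<in>R. c (g * s * inv\<^bsub>G 2 2\<^esub> g) = c s"
    using c_invariant unfolding conj_invariant_def GL_rca_simps GL_mult .
  have "m2 1 1 0 1 \<in> R" by (simp add: R_eq)
  then have *: "c (g * m2 1 1 0 1 * inv\<^bsub>G 2 2\<^esub> g) = \<gamma>" if "g \<in> carrier (G 2 2)" for g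
    unfolding \<gamma>_def using inv that by blast
  have g: "m2 0 1 1 0 \<in> carrier (G 2 2)" "m2 1 0 1 1 \<in> carrier (G 2 2)" by (simp_all add: carrier_G_iff)
  have sq: "m2 0 1 1 0 * m2 0 1 1 0 = (1\<^sub>m 2 :: 'k mat)" "m2 1 0 1 1 * m2 1 0 1 1 = (1\<^sub>m 2 :: 'k mat)"
    unfolding m2_mult m2_one by (simp_all only: m2_inject) (simp_all add: two_zero)
  have "m2 0 1 1 0 * m2 1 1 0 1 * m2 0 1 1 0 = (m2 1 0 1 1 :: 'k mat)"
    "m2 1 0 1 1 * m2 1 1 0 1 * m2 1 0 1 1 = (m2 0 1 1 0 :: 'k mat)"
    unfolding m2_mult by (simp_all only: m2_inject) (simp_all add: two_zero)
  then have "c (m2 1 0 1 1) = \<gamma>" "c (m2 0 1 1 0) = \<gamma>"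
    using *[OF g(1)] *[OF g(2)] GL_inv[OF g(1) g(1) sq(1)] GL_inv[OF g(2) g(2) sq(2)] by simp_all
  then show ?thesis using assms by (auto simp: R_eq \<gamma>_def)
qed

subsection \<open>The Cherednik algebra acting on the coinvariant algebra\<close>

lemma coinv_group_mult:
  assumes "P \<in> carrier_mat 2 2" "Q \<in> carrier_mat 2 2"
  shows "coinv_group (P * Q) v = coinv_group P (coinv_group Q v)"
proof -
  obtain a b e d where P: "P = m2 a b e d" using m2_eta[OF assms(1)] by blast
  obtain a' b' e' d' where Q: "Q = m2 a' b' e' d'" using m2_eta[OF assms(2)] by blast
  show ?thesis unfolding P Q m2_mult by (cases v rule: prod_cases6) (simp add: algebra_simps)
qed

lemma coinv_group_linear:
  "coinv_group P (v + w) = coinv_group P v + coinv_group P w"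
  "coinv_group P (coinv_scale a v) = coinv_scale a (coinv_group P v)"
  by (cases v rule: prod_cases6; cases w rule: prod_cases6; simp add: algebra_simps)+

lemma coinv_dunkl_equivariant:
  assumes g: "g \<in> carrier (G 2 2)"
  shows "coinv_group (A g) (coinv_scale y (coinv_dunkl 0 v) + coinv_scale z (coinv_dunkl (Suc 0) v)) =
    coinv_scale (g $$ (0, 0) * y + g $$ (0, Suc 0) * z) (coinv_dunkl 0 (coinv_group (A g) v)) +
    coinv_scale (g $$ (Suc 0, 0) * y + g $$ (Suc 0, Suc 0) * z) (coinv_dunkl (Suc 0) (coinv_group (A g) v))"
proof -
  obtain a0 a1 a2 a3 a4 a5 where v: "v = (a0, a1, a2, a3, a4, a5)" by (rule prod_cases6)
  show ?thesis
    unfolding v using g[unfolded carrier_G_iff]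
    by (elim insertE emptyE) (simp_all add: contra_m2 carrier_G_iff algebra_simps char_2)
qed

lemma coinv_mult_equivariant:
  assumes g: "g \<in> carrier (G 2 2)"
  shows "coinv_group (A g) (coinv_scale y (coinv_mult 0 v) + coinv_scale z (coinv_mult (Suc 0) v)) =
    coinv_scale (A g $$ (0, 0) * y + A g $$ (0, Suc 0) * z) (coinv_mult 0 (coinv_group (A g) v)) +
    coinv_scale (A g $$ (Suc 0, 0) * y + A g $$ (Suc 0, Suc 0) * z) (coinv_mult (Suc 0) (coinv_group (A g) v))"
proof -
  obtain a0 a1 a2 a3 a4 a5 where v: "v = (a0, a1, a2, a3, a4, a5)" by (rule prod_cases6)
  show ?thesis
    unfolding v using g[unfolded carrier_G_iff]
    by (elim insertE emptyE) (simp_all add: contra_m2 carrier_G_iff algebra_simps char_2)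
qed

abbreviation "D \<equiv> GL_rca 2 2 0 c"
abbreviation "opr \<equiv> coinv_opr A 1 \<gamma>"
abbreviation "opr' \<equiv> coinv_opr (\<lambda>g. g) \<gamma> 1"

lemma sum_reflections:
  assumes y: "y \<in> carrier_vec 2" and x: "x \<in> carrier_vec 2"
  shows "(\<Sum>s\<in>R. coinv_scale (c s * (y \<bullet> (x - A s *\<^sub>v x))) (coinv_group (A s) v)) =
    coinv_scale (\<gamma> * (y $ Suc 0 * x $ 0)) (coinv_group (m2 1 0 1 1) v) +
    coinv_scale (\<gamma> * (y $ 0 * x $ Suc 0)) (coinv_group (m2 1 1 0 1) v) +
    coinv_scale (\<gamma> * ((y $ 0 + y $ Suc 0) * (x $ 0 + x $ Suc 0))) (coinv_group (m2 0 1 1 0) v)"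
proof -
  have pairing: "y \<bullet> (x - m2 a b e d *\<^sub>v x) =
      y $ 0 * (x $ 0 - (a * x $ 0 + b * x $ Suc 0)) + y $ Suc 0 * (x $ Suc 0 - (e * x $ 0 + d * x $ Suc 0))"
    for a b e d :: 'k
    using y x mult_mat_vec_2[OF m2_carrier x, of a b e d]
      mult_mat_vec_carrier[OF m2_carrier x, of a b e d]
    by (subst scalar_prod_2) auto
  have c: "c s = \<gamma>" if "s \<in> {m2 1 1 0 1, m2 1 0 1 1, m2 0 1 1 0}" for s
    using c_const that by (simp only: R_eq)
  have A3: "A (m2 1 1 0 1) = m2 1 0 1 1" "A (m2 1 0 1 1) = m2 1 1 0 1" "A (m2 0 1 1 0) = m2 0 1 1 0"
    by (simp_all add: contra_m2 carrier_G_iff)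
  show ?thesis
    unfolding R_eq
    by (simp add: c A3 pairing) (simp add: algebra_simps char_2)
qed

text \<open>The relations are checked component by component. For the commutator relation, \<open>sum_reflections\<close> evaluates
  the sum over the three reflections.\<close>

lemma cherednik_module_coinv:
  "cherednik_module D coinv_scale opr coinv_one (\<lambda>i. Collect (coinv_piece i))"
proof -
  interpret D: rational_cherednik D by (rule rational_cherednik_GL)
  interpret A: graded_operators D coinv_scale opr coinv_one "\<lambda>i. Collect (coinv_piece i)"
    by (rule D.graded_operators_coinv)
  show ?thesis
  proof (intro cherednik_module.intro cherednik_module_axioms.intro A.graded_operators_axioms)
    fix r and v :: "'k coinv" assume r: "r \<in> smash_rels D \<union> cherednik_rels D"
    obtain a0 a1 a2 a3 a4 a5 where v: "v = (a0, a1, a2, a3, a4, a5)" by (rule prod_cases6)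
    show "A.alg_act r v = 0"
      using r unfolding smash_rels_def cherednik_rels_def Let_def GL_rca_simps GL_mult
    proof (elim UnE CollectE exE conjE insertE emptyE)
      assume r: "r = gel (1\<^sub>m 2) - 1"
      show ?thesis unfolding r v by (simp add: A_one)
    next
      fix g h assume r: "r = gel (g * h) - gel g * gel h" and "g \<in> carrier (G 2 2)" "h \<in> carrier (G 2 2)"
      then show ?thesis by (simp add: A_mult coinv_group_mult)
    next
      fix g y assume r: "r = gel g * yel y - yel (g *\<^sub>v y) * gel g" and g: "g \<in> carrier (G 2 2)" and y: "y \<in> carrier_vec 2"
      have gc: "g \<in> carrier_mat 2 2" using g by (simp add: GL_carrier)
      show ?thesis unfolding r
        using coinv_dunkl_equivariant[OF g, of "\<gamma> * y $ 0" v "\<gamma> * y $ Suc 0"] y gc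
        by (simp add: sum_below_2 mult_mat_vec_2[OF gc y] carrier_vecD carrier_matD algebra_simps coinv_group_linear del: index_mult_mat_vec)
    next
      fix g x assume r: "r = gel g * xel x - xel (A g *\<^sub>v x) * gel g" and g: "g \<in> carrier (G 2 2)" and x: "x \<in> carrier_vec 2"
      have gc: "A g \<in> carrier_mat 2 2" using g by simp
      show ?thesis unfolding r
        using coinv_mult_equivariant[OF g, of "x $ 0" v "x $ Suc 0"] x gc
        by (simp add: sum_below_2 mult_mat_vec_2[OF gc x] carrier_vecD carrier_matD algebra_simps coinv_group_linear del: index_mult_mat_vec)
    next
      fix x x' assume r: "r = xel x * xel x' - xel x' * xel x" and x: "x \<in> carrier_vec 2" "x' \<in> carrier_vec 2"
      show ?thesis unfolding r v using x
        by (simp add: sum_below_2 carrier_vecD) (simp add: algebra_simps char_2 zero_prod_def)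
    next
      fix x x' assume r: "r = yel x * yel x' - yel x' * yel x" and x: "x \<in> carrier_vec 2" "x' \<in> carrier_vec 2"
      show ?thesis unfolding r v using x
        by (simp add: sum_below_2 carrier_vecD) (simp add: algebra_simps char_2 zero_prod_def)
    next
      fix y x
      assume r: "r = yel y * xel x - xel x * yel y - (scal (0 * (y \<bullet> x)) -
          (\<Sum>s\<in>R. scal (c s * (y \<bullet> (x - A s *\<^sub>v x))) * gel s))"
        and y: "y \<in> carrier_vec 2" and x: "x \<in> carrier_vec 2"
      have "A.alg_act r v = A.alg_act (yel y) (A.alg_act (xel x) v) - A.alg_act (xel x) (A.alg_act (yel y) v) +
          (\<Sum>s\<in>R. coinv_scale (c s * (y \<bullet> (x - A s *\<^sub>v x))) (coinv_group (A s) v))"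
        unfolding r by simp
      also have "\<dots> = 0"
        unfolding sum_reflections[OF y x] unfolding v using x y
        by (simp add: sum_below_2 carrier_vecD) (simp add: algebra_simps char_2 zero_prod_def)
      finally show ?thesis .
    qed
  qed
qed

text \<open>An element of the free algebra that produces \<open>v\<close> from \<open>1\<close> when the letters \<open>GX\<close> act by multiplication. With a
  factor \<open>\<alpha>\<close> in this action the coordinates acquire powers of \<open>\<alpha>\<close>, which can be divided out if \<open>\<alpha> \<noteq> 0\<close>. It is here
  that \<open>c \<noteq> 0\<close> is needed: for \<open>c = 0\<close> the dual side is not generated by \<open>1\<close>.\<close>

definition coinv_generator :: "'k coinv \<Rightarrow> ('k mat, 'k) falg" where
  "coinv_generator v = (case v of (a0, a1, a2, a3, a4, a5) \<Rightarrow>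
    Poly_Mapping.single (Word []) a0 + Poly_Mapping.single (Word [GX 0]) a1 +
    Poly_Mapping.single (Word [GX 1]) a2 + Poly_Mapping.single (Word [GX 0, GX 0]) a3 +
    Poly_Mapping.single (Word [GX 1, GX 1]) a4 + Poly_Mapping.single (Word [GX 1, GX 0, GX 0]) a5)"

lemma coinv_generator_act:
  "linear_operators.alg_act coinv_scale (coinv_opr B \<alpha> \<beta>) (coinv_generator (a0, a1, a2, a3, a4, a5)) coinv_one =
    (a0, a1 * \<alpha>, a2 * \<alpha>, a3 * \<alpha> ^ 2, a4 * \<alpha> ^ 2, a5 * \<alpha> ^ 3)"
proof -
  interpret linear_operators coinv_scale "coinv_opr B \<alpha> \<beta>" by (rule linear_operators_coinv)
  show ?thesis by (simp add: coinv_generator_def word_act_def power2_eq_square power3_eq_cube)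
qed

lemma coinv_generator_closed: "coinv_generator v \<in> carrier (free_alg D)"
  unfolding coinv_generator_def
  by (cases v rule: prod_cases6) (auto intro!: free_alg_closed simp: gens_def)

lemma coinv_generator_homogeneous:
  assumes "coinv_piece i v"
  shows "coinv_generator v \<in> homogeneous D i"
  using assms unfolding coinv_generator_def
  by (cases v rule: prod_cases6) (auto intro!: homogeneous_add homogeneous_single_if simp: gens_def)

lemma contravariant_pair_coinv:
  assumes "\<gamma> \<noteq> 0"
  shows "contravariant_pair D coinv_scale opr coinv_one (\<lambda>i. Collect (coinv_piece i))
    coinv_scale opr' coinv_one (\<lambda>i. Collect (coinv_piece i)) coinv_pair"
proof -
  interpret D: rational_cherednik D by (rule rational_cherednik_GL)
  interpret D': rational_cherednik "dual_rca D" by (rule D.dual_rational_cherednik)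
  show ?thesis
  proof (intro contravariant_pair.intro contravariant_pair_axioms.intro)
    show "cherednik_module D coinv_scale opr coinv_one (\<lambda>i. Collect (coinv_piece i))"
      by (rule cherednik_module_coinv)
    show "graded_operators (dual_rca D) coinv_scale opr' coinv_one (\<lambda>i. Collect (coinv_piece i))"
      by (rule D'.graded_operators_coinv)
    show "coinv_pair (f + f') x = coinv_pair f x + coinv_pair f' x" for f f' x :: "'k coinv"
      by (cases f rule: prod_cases6; cases f' rule: prod_cases6; cases x rule: prod_cases6) (simp add: algebra_simps)
    show "coinv_pair f (x + x') = coinv_pair f x + coinv_pair f x'" for f x x' :: "'k coinv"
      by (cases f rule: prod_cases6; cases x' rule: prod_cases6; cases x rule: prod_cases6) (simp add: algebra_simps)
    show "coinv_pair (coinv_scale a f) x = a * coinv_pair f x" for a and f x :: "'k coinv"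
      by (cases f rule: prod_cases6; cases x rule: prod_cases6) (simp add: algebra_simps)
    show "coinv_pair f (coinv_scale a x) = a * coinv_pair f x" for a and f x :: "'k coinv"
      by (cases f rule: prod_cases6; cases x rule: prod_cases6) (simp add: algebra_simps)
    show "coinv_pair (opr' l f) x = coinv_pair f (opr (opp_gen (rca_grp D) l) x)" if l: "l \<in> gens D" for l f x
    proof -
      obtain f0 f1 f2 f3 f4 f5 where f: "f = (f0, f1, f2, f3, f4, f5)" by (rule prod_cases6)
      obtain x0 x1 x2 x3 x4 x5 where x: "x = (x0, x1, x2, x3, x4, x5)" by (rule prod_cases6)
      show ?thesis
      proof (cases l)
        case (GG g)
        then have g: "g \<in> carrier (G 2 2)" using l by (auto simp: gens_def)
        then have "A (inv\<^bsub>G 2 2\<^esub> g) = g\<^sup>T" by (simp add: contra_def group.inv_inv[OF group_GL])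
        moreover have "g \<in> carrier_mat 2 2" using g by (simp add: GL_carrier)
        ultimately show ?thesis unfolding GG f x by (simp add: algebra_simps)
      qed (simp_all add: f x algebra_simps)
    qed
    show "f = 0" if z: "\<And>x. coinv_pair f x = 0" for f :: "'k coinv"
      using z[of "(1, 0, 0, 0, 0, 0)"] z[of "(0, 1, 0, 0, 0, 0)"] z[of "(0, 0, 1, 0, 0, 0)"]
        z[of "(0, 0, 0, 1, 0, 0)"] z[of "(0, 0, 0, 0, 1, 0)"] z[of "(0, 0, 0, 0, 0, 1)"]
      by (cases f rule: prod_cases6) (simp add: zero_prod_def)
    show "x = 0" if z: "\<And>f. coinv_pair f x = 0" for x :: "'k coinv"
      using z[of "(1, 0, 0, 0, 0, 0)"] z[of "(0, 1, 0, 0, 0, 0)"] z[of "(0, 0, 1, 0, 0, 0)"]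
        z[of "(0, 0, 0, 1, 0, 0)"] z[of "(0, 0, 0, 0, 1, 0)"] z[of "(0, 0, 0, 0, 0, 1)"]
      by (cases x rule: prod_cases6) (simp add: zero_prod_def)
    show "coinv_pair f x = 0" if "i \<noteq> j" "f \<in> Collect (coinv_piece i)" "x \<in> Collect (coinv_piece j)"
      for i j and f x :: "'k coinv"
      using that by (cases f rule: prod_cases6; cases x rule: prod_cases6) auto
    show "coinv_pair coinv_one coinv_one = (1::'k)" by simp
    show "\<exists>J. finite J \<and> (\<forall>x::'k coinv. \<exists>f. (\<forall>j\<in>J. f j \<in> Collect (coinv_piece j)) \<and> x = sum f J)"
    proof (intro exI[of _ "{0, 1, 2, 3}"] conjI allI)
      fix x :: "'k coinv"
      obtain x0 x1 x2 x3 x4 x5 where x: "x = (x0, x1, x2, x3, x4, x5)" by (rule prod_cases6)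
      show "\<exists>f. (\<forall>j\<in>{0, 1, 2, 3}. f j \<in> Collect (coinv_piece j)) \<and> x = sum f {0, 1, 2, 3}"
        by (rule exI[of _ "\<lambda>j. if j = 0 then (x0, 0, 0, 0, 0, 0) else if j = 1 then (0, x1, x2, 0, 0, 0)
            else if j = 2 then (0, 0, 0, x3, x4, 0) else (0, 0, 0, 0, 0, x5)"]) (simp add: x)
    qed simp
    show "\<exists>a\<in>homogeneous D i. linear_operators.alg_act coinv_scale opr a coinv_one = x"
      if "x \<in> Collect (coinv_piece i)" for x i
      by (rule bexI[OF _ coinv_generator_homogeneous[of i x]], cases x rule: prod_cases6)
        (use that in \<open>simp_all add: coinv_generator_act\<close>)
    show "\<exists>a\<in>carrier (free_alg D). linear_operators.alg_act coinv_scale opr' a coinv_one = f" for f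
    proof (cases f rule: prod_cases6)
      case (fields f0 f1 f2 f3 f4 f5)
      show ?thesis unfolding fields
        by (rule bexI[OF _ coinv_generator_closed[of "(f0, f1 / \<gamma>, f2 / \<gamma>, f3 / \<gamma> ^ 2, f4 / \<gamma> ^ 2, f5 / \<gamma> ^ 3)"]])
          (use assms in \<open>simp add: coinv_generator_act\<close>)
    qed
  qed
qed

theorem L_coinv:
  assumes "\<gamma> \<noteq> 0"
  shows "character_L D triv_rep = poly_series \<one>\<^bsub>K0 (G 2 2)\<^esub>
      [K0_class (G 2 2) triv_rep, K0_class (G 2 2) (2, A), K0_class (G 2 2) (2, A), K0_class (G 2 2) triv_rep]"
    and "hilbert_L D triv_rep = poly_series 0 [1, 2, 2, 1]"
proof -
  note pair = contravariant_pair_coinv[OF assms]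
  note piece = contravariant_pair.L_piece_class[OF pair, unfolded GL_rca_simps]
  note piece_zero = contravariant_pair.L_piece_class_zero[OF pair, unfolded GL_rca_simps]
  have triv: "is_rep (G 2 2) (1, \<lambda>_. 1\<^sub>m 1 :: 'k mat)" using is_rep_triv by (simp add: triv_rep_def)
  have v1: "vec 1 (\<lambda>_. v $ 0) = v" if "v \<in> carrier_vec 1" for v :: "'k vec"
    using that by (intro eq_vecI) auto
  have v2: "vec 2 (\<lambda>i. if i = 0 then v $ 0 else v $ Suc 0) = v" if "v \<in> carrier_vec 2" for v :: "'k vec"
    using that by (intro eq_vecI) (auto simp: less_2_cases_iff)
  have "bij_betw (\<lambda>v. (v $ 0, 0, 0, 0, 0, 0)) (carrier_vec 1) (Collect (coinv_piece 0) :: 'k coinv set)"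
    by (rule bij_betwI[where g = "\<lambda>a. vec 1 (\<lambda>_. fst a)"]) (auto simp: v1)
  then have 0: "character_L D triv_rep 0 = K0_class (G 2 2) triv_rep \<and> hilbert_L D triv_rep 0 = 1"
    using piece[OF triv] by (simp add: triv_rep_def)
  have "bij_betw (\<lambda>v. (0, v $ 0, v $ Suc 0, 0, 0, 0)) (carrier_vec 2) (Collect (coinv_piece 1) :: 'k coinv set)"
    by (rule bij_betwI[where g = "\<lambda>(a0, a1, a2, a). vec 2 (\<lambda>i. if i = 0 then a1 else a2)"]) (auto simp: v2)
  then have 1: "character_L D triv_rep 1 = K0_class (G 2 2) (2, A) \<and> hilbert_L D triv_rep 1 = 2"
    using piece[OF is_rep_A] by (simp add: mult_mat_vec_2 del: index_mult_mat_vec)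
  have "bij_betw (\<lambda>v. (0, 0, 0, v $ 0, v $ Suc 0, 0)) (carrier_vec 2) (Collect (coinv_piece 2) :: 'k coinv set)"
    by (rule bij_betwI[where g = "\<lambda>(a0, a1, a2, a3, a4, a5). vec 2 (\<lambda>i. if i = 0 then a3 else a4)"]) (auto simp: v2)
  then have 2: "character_L D triv_rep 2 = K0_class (G 2 2) (2, A) \<and> hilbert_L D triv_rep 2 = 2"
    using piece[OF is_rep_A] by (simp add: mult_mat_vec_2 del: index_mult_mat_vec)
  have "bij_betw (\<lambda>v. (0, 0, 0, 0, 0, v $ 0)) (carrier_vec 1) (Collect (coinv_piece 3) :: 'k coinv set)"
    by (rule bij_betwI[where g = "\<lambda>(a0, a1, a2, a3, a4, a5). vec 1 (\<lambda>_. a5)"]) (auto simp: v1)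
  then have 3: "character_L D triv_rep 3 = K0_class (G 2 2) triv_rep \<and> hilbert_L D triv_rep 3 = 1"
    using piece[OF triv] by (simp add: triv_rep_def)
  have other: "character_L D triv_rep i = \<one>\<^bsub>K0 (G 2 2)\<^esub> \<and> hilbert_L D triv_rep i = 0"
    if "i \<notin> {0, 1, 2, 3}" for i
  proof -
    have "Collect (coinv_piece i) = ({0} :: 'k coinv set)" using that by (auto simp: zero_prod_def)
    then show ?thesis using piece_zero[of i] by simp
  qed
  have cases: "i = 0 \<or> i = 1 \<or> i = 2 \<or> i = 3 \<or> i \<notin> {0, 1, 2, 3} \<and> \<not> (0 \<le> i \<and> i < 4)" for i :: int
    by auto
  show "character_L D triv_rep = poly_series \<one>\<^bsub>K0 (G 2 2)\<^esub>
      [K0_class (G 2 2) triv_rep, K0_class (G 2 2) (2, A), K0_class (G 2 2) (2, A), K0_class (G 2 2) triv_rep]"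
    (is "_ = ?P")
  proof
    show "character_L D triv_rep i = ?P i" for i
      using cases[of i] 0 1 2 3 other[of i] by (elim disjE) (auto simp: poly_series_def)
  qed
  show "hilbert_L D triv_rep = poly_series 0 [1, 2, 2, 1]"
  proof
    show "hilbert_L D triv_rep i = poly_series 0 [1, 2, 2, 1] i" for i
      using cases[of i] 0 1 2 3 other[of i] by (elim disjE) (auto simp: poly_series_def)
  qed
qed

end

section \<open>Symmetric powers of a two-dimensional representation\<close>

subsection \<open>Polynomials in two variables\<close>

type_synonym 'k mpoly2 = "(nat \<Rightarrow>\<^sub>0 nat) \<Rightarrow>\<^sub>0 'k"

definition pconst :: "'k::field \<Rightarrow> 'k mpoly2" where "pconst a = Poly_Mapping.single 0 a"
definition pvar :: "nat \<Rightarrow> 'k::field mpoly2" where "pvar l = Poly_Mapping.single (Poly_Mapping.single l 1) 1"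
definition expo :: "nat \<Rightarrow> nat \<Rightarrow> nat \<Rightarrow>\<^sub>0 nat" where "expo a b = Poly_Mapping.single 0 a + Poly_Mapping.single (Suc 0) b"

lemma pconst_simps [simp]: "pconst 0 = 0" "pconst 1 = 1"
  by (simp_all add: pconst_def)

lemma pconst_add: "pconst (a + b) = pconst a + pconst b"
  by (simp add: pconst_def single_add)

lemma pvar_power: "pvar l ^ k = Poly_Mapping.single (Poly_Mapping.single l k) 1"
  by (induction k) (simp_all add: pvar_def mult_single single_add[symmetric] add.commute)

lemma single_expo: "Poly_Mapping.single (expo a b) c = pconst c * pvar 0 ^ a * pvar (Suc 0) ^ b"
  by (simp add: pvar_power pconst_def mult_single expo_def)

lemma lookup_expo [simp]: "Poly_Mapping.lookup (expo a b) 0 = a" "Poly_Mapping.lookup (expo a b) (Suc 0) = b"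
  by (simp_all add: expo_def lookup_add lookup_single)

lemma expo_inject [simp]: "expo a b = expo a' b' \<longleftrightarrow> a = a' \<and> b = b'"
  by (metis lookup_expo)

lemma keys_expo: "Poly_Mapping.keys (expo a b) \<subseteq> {0, Suc 0}"
  unfolding expo_def using keys_add[of "Poly_Mapping.single 0 a" "Poly_Mapping.single (Suc 0) b"]
  by (auto split: if_splits)

lemma sum_expo: "(\<Sum>j\<in>Poly_Mapping.keys (expo a b). Poly_Mapping.lookup (expo a b) j) = a + b"
proof -
  have "(\<Sum>j\<in>Poly_Mapping.keys (expo a b). Poly_Mapping.lookup (expo a b) j) =
      (\<Sum>j\<in>{0, Suc 0}. Poly_Mapping.lookup (expo a b) j)"
    using keys_expo by (intro sum.mono_neutral_left) (auto simp: in_keys_iff)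
  then show ?thesis by simp
qed

text \<open>In two variables a monomial of degree \<open>i\<close> is determined by its first exponent.\<close>

lemma expo_cases:
  assumes "Poly_Mapping.keys e \<subseteq> {..<2}" "(\<Sum>j\<in>Poly_Mapping.keys e. Poly_Mapping.lookup e j) = i"
  shows "\<exists>a\<le>i. e = expo a (i - a)"
proof -
  have z: "Poly_Mapping.lookup e l = 0" if "l \<noteq> 0" "l \<noteq> Suc 0" for l
  proof (rule ccontr)
    assume "Poly_Mapping.lookup e l \<noteq> 0"
    then have "l \<in> Poly_Mapping.keys e" by (simp add: in_keys_iff)
    then have "l < 2" using assms(1) by auto
    then show False using that by (simp add: less_2_cases_iff)
  qed
  then have e: "e = expo (Poly_Mapping.lookup e 0) (Poly_Mapping.lookup e (Suc 0))"
    by (intro poly_mapping_eqI) (auto simp: expo_def lookup_add lookup_single when_def)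
  then have "Poly_Mapping.lookup e 0 + Poly_Mapping.lookup e (Suc 0) = i"
    using sum_expo assms(2) by metis
  then show ?thesis using e by (intro exI[of _ "Poly_Mapping.lookup e 0"]) auto
qed

lemma linear_subst_superset:
  assumes "finite E" "Poly_Mapping.keys f \<subseteq> E"
  shows "linear_subst M f = (\<Sum>e\<in>E. pconst (Poly_Mapping.lookup f e) *
     (\<Prod>j\<in>Poly_Mapping.keys e.
        (\<Sum>l<dim_row M. Poly_Mapping.single (Poly_Mapping.single l 1) (M $$ (l, j))) ^ Poly_Mapping.lookup e j))"
  unfolding linear_subst_def pconst_def using assms
  by (intro sum.mono_neutral_left) (auto simp: in_keys_iff)

lemma linear_subst_add: "linear_subst M (f + g) = linear_subst M f + linear_subst M g"
proof -
  let ?E = "Poly_Mapping.keys f \<union> Poly_Mapping.keys g"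
  show ?thesis
    using keys_add[of f g]
    by (simp add: linear_subst_superset[of ?E] lookup_add pconst_add distrib_right sum.distrib)
qed

lemma linear_subst_monomial:
  assumes "dim_row M = 2"
  shows "linear_subst M (Poly_Mapping.single (expo a b) c) = pconst c *
    (pconst (M $$ (0, 0)) * pvar 0 + pconst (M $$ (Suc 0, 0)) * pvar (Suc 0)) ^ a *
    (pconst (M $$ (0, Suc 0)) * pvar 0 + pconst (M $$ (Suc 0, Suc 0)) * pvar (Suc 0)) ^ b"
proof -
  let ?L = "\<lambda>j. \<Sum>l<dim_row M. Poly_Mapping.single (Poly_Mapping.single l 1) (M $$ (l, j))"
  have L: "?L j = pconst (M $$ (0, j)) * pvar 0 + pconst (M $$ (Suc 0, j)) * pvar (Suc 0)" for j
    by (simp add: assms sum_below_2 pconst_def pvar_def mult_single)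
  have "linear_subst M (Poly_Mapping.single (expo a b) c) =
      pconst c * (\<Prod>j\<in>Poly_Mapping.keys (expo a b). ?L j ^ Poly_Mapping.lookup (expo a b) j)"
    by (subst linear_subst_superset[of "{expo a b}"]) auto
  also have "(\<Prod>j\<in>Poly_Mapping.keys (expo a b). ?L j ^ Poly_Mapping.lookup (expo a b) j) =
      (\<Prod>j\<in>{0, Suc 0}. ?L j ^ Poly_Mapping.lookup (expo a b) j)"
    using keys_expo by (intro prod.mono_neutral_left) (auto simp: in_keys_iff)
  also have "\<dots> = ?L 0 ^ a * ?L (Suc 0) ^ b" by simp
  finally show ?thesis unfolding L by (simp add: mult.assoc)
qed

lemma sym_power_space:
  assumes "fst V = 2"
  shows "f \<in> rep_space (sym_power V i) \<longleftrightarrow> Poly_Mapping.keys f \<subseteq> (\<lambda>a. expo a (i - a)) ` {..i}"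
proof -
  have "Poly_Mapping.keys e \<subseteq> {..<2} \<and> (\<Sum>j\<in>Poly_Mapping.keys e. Poly_Mapping.lookup e j) = i \<longleftrightarrow>
      e \<in> (\<lambda>a. expo a (i - a)) ` {..i}" for e
  proof
    assume "Poly_Mapping.keys e \<subseteq> {..<2} \<and> (\<Sum>j\<in>Poly_Mapping.keys e. Poly_Mapping.lookup e j) = i"
    then obtain a where "a \<le> i" "e = expo a (i - a)" using expo_cases by blast
    then show "e \<in> (\<lambda>a. expo a (i - a)) ` {..i}" by simp
  next
    assume "e \<in> (\<lambda>a. expo a (i - a)) ` {..i}"
    then obtain a where a: "a \<le> i" "e = expo a (i - a)" by auto
    have "Poly_Mapping.keys e \<subseteq> {..<2}" unfolding a(2) by (rule order_trans[OF keys_expo]) auto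
    then show "Poly_Mapping.keys e \<subseteq> {..<2} \<and> (\<Sum>j\<in>Poly_Mapping.keys e. Poly_Mapping.lookup e j) = i"
      using a by (simp add: sum_expo)
  qed
  then show ?thesis using assms unfolding sym_power_def by (auto simp: subset_iff)
qed

lemma sym_power_expand:
  assumes "fst V = 2" "f \<in> rep_space (sym_power V i)"
  shows "f = (\<Sum>a\<le>i. Poly_Mapping.single (expo a (i - a)) (Poly_Mapping.lookup f (expo a (i - a))))"
proof -
  have "inj_on (\<lambda>a. expo a (i - a)) {..i}" by (auto simp: inj_on_def)
  then have "(\<Sum>a\<le>i. Poly_Mapping.single (expo a (i - a)) (Poly_Mapping.lookup f (expo a (i - a)))) =
      (\<Sum>e\<in>(\<lambda>a. expo a (i - a)) ` {..i}. Poly_Mapping.single e (Poly_Mapping.lookup f e))"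
    by (simp add: sum.reindex)
  also have "\<dots> = (\<Sum>e\<in>Poly_Mapping.keys f. Poly_Mapping.single e (Poly_Mapping.lookup f e))"
    using assms(2) unfolding sym_power_space[OF assms(1)] by (intro sum.mono_neutral_right) (auto simp: in_keys_iff)
  also have "\<dots> = f" by (rule poly_mapping_sum_singles)
  finally show ?thesis ..
qed

lemma sym_power_member:
  assumes "fst V = 2"
  shows "Poly_Mapping.single (expo a b) c \<in> rep_space (sym_power V (a + b))"
  unfolding sym_power_space[OF assms]
  by (auto intro!: image_eqI[of _ _ a])

lemma sym_power_space_add:
  assumes "fst V = 2" "f \<in> rep_space (sym_power V i)" "g \<in> rep_space (sym_power V i)"
  shows "f + g \<in> rep_space (sym_power V i)"
  using assms(2,3) keys_add[of f g] unfolding sym_power_space[OF assms(1)] by blast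

lemma sym_power_ops [simp]:
  "rep_plus (sym_power V i) = (+)" "rep_scale (sym_power V i) a f = pconst a * f"
  "rep_act (sym_power V i) g = linear_subst (snd V g)"
  by (simp_all add: sym_power_def pconst_def)

subsection \<open>The symmetric square and cube over the field of two elements\<close>

lemma sum_below_3: "sum f {..<3::nat} = f 0 + f (Suc 0) + f 2" "sum f {..<4::nat} = f 0 + f (Suc 0) + f 2 + f 3"
  by (simp_all add: numeral_eq_Suc)

lemma all_below_3: "i < 3 \<longleftrightarrow> i = 0 \<or> i = Suc 0 \<or> i = (2::nat)" "i < 4 \<longleftrightarrow> i = 0 \<or> i = Suc 0 \<or> i = 2 \<or> i = (3::nat)"
  by auto

text \<open>For a matrix with columns \<open>(a, e)\<close> and \<open>(b, d)\<close> over \<open>F\<^sub>2\<close> and of determinant \<open>1\<close>, the substitution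
  \<open>x \<mapsto> a x + e y\<close>, \<open>y \<mapsto> b x + d y\<close> sends \<open>x\<^sup>2\<close> to \<open>a x\<^sup>2 + e y\<^sup>2\<close>, \<open>y\<^sup>2\<close> to \<open>b x\<^sup>2 + d y\<^sup>2\<close> and \<open>x y\<close> to
  \<open>a b x\<^sup>2 + e d y\<^sup>2 + x y\<close>. This is block triangular in the basis \<open>x\<^sup>2, y\<^sup>2, x y\<close>.\<close>

definition square_cocycle :: "'k::field mat \<Rightarrow> 'k mat" where
  "square_cocycle M = mat 2 1 (\<lambda>(i, j). M $$ (i, 0) * M $$ (i, Suc 0))"

definition square_matrix :: "'k::field mat \<Rightarrow> 'k mat" where
  "square_matrix M = four_block_mat M (square_cocycle M) (0\<^sub>m 1 2) (1\<^sub>m 1)"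

text \<open>In degree three the Dickson invariant \<open>f = x\<^sup>2 y + x y\<^sup>2\<close> is fixed, \<open>x\<^sup>3\<close> goes to \<open>a x\<^sup>3 + e y\<^sup>3 + a e f\<close>, \<open>y\<^sup>3\<close> goes to
  \<open>b x\<^sup>3 + d y\<^sup>3 + b d f\<close>, and \<open>x\<^sup>2 y\<close> goes to \<open>b e f + a b x\<^sup>3 + e d y\<^sup>3 + x\<^sup>2 y\<close>. The basis \<open>f, x\<^sup>3, y\<^sup>3, x\<^sup>2 y\<close> thus yields a
  filtration with quotients \<open>triv\<close>, \<open>h\<^sup>*\<close>, \<open>triv\<close>; the first three vectors form the \<open>sub\<close> matrix.\<close>

definition cube_sub_cocycle :: "'k::field mat \<Rightarrow> 'k mat" where
  "cube_sub_cocycle M = mat 1 2 (\<lambda>(i, j). M $$ (0, j) * M $$ (Suc 0, j))"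

definition cube_sub_matrix :: "'k::field mat \<Rightarrow> 'k mat" where
  "cube_sub_matrix M = four_block_mat (1\<^sub>m 1) (cube_sub_cocycle M) (0\<^sub>m 2 1) M"

definition cube_cocycle :: "'k::field mat \<Rightarrow> 'k mat" where
  "cube_cocycle M = mat 3 1 (\<lambda>(i, j). if i = 0 then M $$ (0, Suc 0) * M $$ (Suc 0, 0)
     else if i = Suc 0 then M $$ (0, 0) * M $$ (0, Suc 0) else M $$ (Suc 0, 0) * M $$ (Suc 0, Suc 0))"

definition cube_matrix :: "'k::field mat \<Rightarrow> 'k mat" where
  "cube_matrix M = four_block_mat (cube_sub_matrix M) (cube_cocycle M) (0\<^sub>m 1 3) (1\<^sub>m 1)"

lemma block_carriers:
  "square_cocycle M \<in> carrier_mat 2 1" "cube_sub_cocycle M \<in> carrier_mat 1 2" "cube_cocycle M \<in> carrier_mat 3 1"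
  "M \<in> carrier_mat 2 2 \<Longrightarrow> square_matrix M \<in> carrier_mat 3 3"
  "M \<in> carrier_mat 2 2 \<Longrightarrow> cube_sub_matrix M \<in> carrier_mat 3 3"
  "M \<in> carrier_mat 2 2 \<Longrightarrow> cube_matrix M \<in> carrier_mat 4 4"
proof -
  show 1: "square_cocycle M \<in> carrier_mat 2 1" "cube_sub_cocycle M \<in> carrier_mat 1 2" "cube_cocycle M \<in> carrier_mat 3 1"
    by (simp_all add: square_cocycle_def cube_sub_cocycle_def cube_cocycle_def)
  show "square_matrix M \<in> carrier_mat 3 3" if "M \<in> carrier_mat 2 2"
    using four_block_carrier_mat[OF that one_carrier_mat[of 1], of "square_cocycle M" "0\<^sub>m 1 2"]
    by (simp add: square_matrix_def)
  show 2: "cube_sub_matrix M \<in> carrier_mat 3 3" if "M \<in> carrier_mat 2 2"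
    using four_block_carrier_mat[OF one_carrier_mat[of 1] that, of "cube_sub_cocycle M" "0\<^sub>m 2 1"]
    by (simp add: cube_sub_matrix_def numeral_3_eq_3)
  show "cube_matrix M \<in> carrier_mat 4 4" if "M \<in> carrier_mat 2 2"
    using four_block_carrier_mat[OF 2[OF that] one_carrier_mat[of 1], of "cube_cocycle M" "0\<^sub>m 1 3"]
    by (simp add: cube_matrix_def)
qed

lemma square_matrix_vec:
  assumes "v \<in> carrier_vec 3"
  shows "(square_matrix (m2 a b e d) *\<^sub>v v) $ 0 = a * v $ 0 + b * v $ Suc 0 + a * b * v $ 2"
    "(square_matrix (m2 a b e d) *\<^sub>v v) $ Suc 0 = e * v $ 0 + d * v $ Suc 0 + e * d * v $ 2"
    "(square_matrix (m2 a b e d) *\<^sub>v v) $ 2 = v $ 2"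
  using mult_mat_vec_index[OF block_carriers(4)[OF m2_carrier] assms]
  by (simp_all add: sum_below_3 square_matrix_def square_cocycle_def)

lemma cube_matrix_vec:
  assumes "v \<in> carrier_vec 4"
  shows "(cube_matrix (m2 a b e d) *\<^sub>v v) $ 0 = v $ 0 + a * e * v $ Suc 0 + b * d * v $ 2 + b * e * v $ 3"
    "(cube_matrix (m2 a b e d) *\<^sub>v v) $ Suc 0 = a * v $ Suc 0 + b * v $ 2 + a * b * v $ 3"
    "(cube_matrix (m2 a b e d) *\<^sub>v v) $ 2 = e * v $ Suc 0 + d * v $ 2 + e * d * v $ 3"
    "(cube_matrix (m2 a b e d) *\<^sub>v v) $ 3 = v $ 3"
  using mult_mat_vec_index[OF block_carriers(6)[OF m2_carrier] assms]
  by (simp_all add: sum_below_3 cube_matrix_def cube_sub_matrix_def cube_cocycle_def cube_sub_cocycle_def)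

text \<open>The coordinate maps for these two bases. The invariant \<open>f\<close> contributes to both \<open>x\<^sup>2 y\<close> and \<open>x y\<^sup>2\<close>.\<close>

definition square_poly :: "'k::field vec \<Rightarrow> 'k mpoly2" where
  "square_poly v = Poly_Mapping.single (expo 2 0) (v $ 0) + Poly_Mapping.single (expo 0 2) (v $ Suc 0) +
    Poly_Mapping.single (expo 1 1) (v $ 2)"

definition cube_poly :: "'k::field vec \<Rightarrow> 'k mpoly2" where
  "cube_poly v = Poly_Mapping.single (expo 3 0) (v $ Suc 0) + Poly_Mapping.single (expo 0 3) (v $ 2) +
    Poly_Mapping.single (expo 2 1) (v $ 0 + v $ 3) + Poly_Mapping.single (expo 1 2) (v $ 0)"

lemma is_linear_iso_square:
  assumes "fst V = 2"
  shows "is_linear_iso 3 (sym_power V 2) square_poly"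
proof -
  let ?g = "\<lambda>f. vec 3 (\<lambda>i. Poly_Mapping.lookup f (if i = 0 then expo 2 0 else if i = Suc 0 then expo 0 2 else expo 1 1))"
  have "bij_betw square_poly (carrier_vec 3) (rep_space (sym_power V 2))"
  proof (rule bij_betwI[of _ _ _ ?g])
    show "square_poly \<in> carrier_vec 3 \<rightarrow> rep_space (sym_power V 2)"
      using sym_power_member[OF assms, of 2 0] sym_power_member[OF assms, of 0 2] sym_power_member[OF assms, of 1 1]
      unfolding square_poly_def by (intro Pi_I sym_power_space_add[OF assms]) (simp_all add: numeral_2_eq_2)
    show "?g (square_poly v) = v" if "v \<in> carrier_vec 3" for v
      using that by (intro eq_vecI) (auto simp: all_below_3 square_poly_def lookup_add lookup_single)
    show "square_poly (?g f) = f" if "f \<in> rep_space (sym_power V 2)" for f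
    proof -
      have "f = (\<Sum>a\<in>{0, 1, 2}. Poly_Mapping.single (expo a (2 - a)) (Poly_Mapping.lookup f (expo a (2 - a))))"
        using sym_power_expand[OF assms that] by (simp add: numeral_2_eq_2 atMost_Suc insert_commute)
      then show ?thesis by (simp add: square_poly_def add_ac)
    qed
  qed auto
  then show ?thesis unfolding is_linear_iso_def by (simp add: square_poly_def pconst_def mult_single single_add algebra_simps)
qed

lemma is_linear_iso_cube:
  assumes "fst V = 2"
  shows "is_linear_iso 4 (sym_power V 3) cube_poly"
proof -
  let ?g = "\<lambda>f. vec 4 (\<lambda>i. if i = 0 then Poly_Mapping.lookup f (expo 1 2)
    else if i = Suc 0 then Poly_Mapping.lookup f (expo 3 0) else if i = 2 then Poly_Mapping.lookup f (expo 0 3)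
    else Poly_Mapping.lookup f (expo 2 1) - Poly_Mapping.lookup f (expo 1 2))"
  have "bij_betw cube_poly (carrier_vec 4) (rep_space (sym_power V 3))"
  proof (rule bij_betwI[of _ _ _ ?g])
    show "cube_poly \<in> carrier_vec 4 \<rightarrow> rep_space (sym_power V 3)"
      using sym_power_member[OF assms, of 3 0] sym_power_member[OF assms, of 0 3]
        sym_power_member[OF assms, of 2 1] sym_power_member[OF assms, of 1 2]
      unfolding cube_poly_def by (intro Pi_I sym_power_space_add[OF assms]) (simp_all add: numeral_3_eq_3 numeral_2_eq_2)
    show "?g (cube_poly v) = v" if "v \<in> carrier_vec 4" for v
      using that by (intro eq_vecI) (auto simp: all_below_3 cube_poly_def lookup_add lookup_single)
    show "cube_poly (?g f) = f" if "f \<in> rep_space (sym_power V 3)" for f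
    proof -
      have "f = (\<Sum>a\<in>{0, 1, 2, 3}. Poly_Mapping.single (expo a (3 - a)) (Poly_Mapping.lookup f (expo a (3 - a))))"
        using sym_power_expand[OF assms that] by (simp add: numeral_3_eq_3 numeral_2_eq_2 atMost_Suc insert_commute)
      then show ?thesis by (simp add: cube_poly_def add_ac)
    qed
  qed auto
  then show ?thesis unfolding is_linear_iso_def by (simp add: cube_poly_def pconst_def mult_single single_add algebra_simps)
qed

context GL_2_F_2
begin

lemma poly_char_2: "p + p = (0 :: 'k mpoly2)" "p + (p + r) = r"
proof -
  have "p + p = pconst (1 + 1) * p" by (simp only: pconst_add pconst_simps distrib_right mult_1)
  then show *: "p + p = 0" using two by (simp only: pconst_simps) simp
  show "p + (p + r) = r" using * by (simp flip: add.assoc)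
qed

lemma A_in_G: "g \<in> carrier (G 2 2) \<Longrightarrow> A g \<in> carrier (G 2 2)"
  unfolding carrier_G_iff by (elim insertE emptyE) (simp_all add: contra_m2 carrier_G_iff)

lemma square_cocycle:
  assumes "M \<in> carrier (G 2 2)" "P \<in> carrier (G 2 2)"
  shows "square_cocycle (M * P) = M * square_cocycle P + square_cocycle M * 1\<^sub>m 1"
  using assms unfolding carrier_G_iff
  by (elim insertE emptyE; intro eq_matI)
    (auto simp: square_cocycle_def less_2_cases_iff scalar_prod_def sum_below_2)

lemma cube_sub_cocycle:
  assumes "M \<in> carrier (G 2 2)" "P \<in> carrier (G 2 2)"
  shows "cube_sub_cocycle (M * P) = 1\<^sub>m 1 * cube_sub_cocycle P + cube_sub_cocycle M * P"
  using assms unfolding carrier_G_iff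
  by (elim insertE emptyE; intro eq_matI)
    (auto simp: cube_sub_cocycle_def less_2_cases_iff scalar_prod_def sum_below_2)

lemma cube_cocycle:
  assumes "M \<in> carrier (G 2 2)" "P \<in> carrier (G 2 2)"
  shows "cube_cocycle (M * P) = cube_sub_matrix M * cube_cocycle P + cube_cocycle M * 1\<^sub>m 1"
proof (rule eq_matI)
  have c: "M \<in> carrier_mat 2 2" using assms by (simp add: GL_carrier)
  have s3: "sum f {0..<3::nat} = f 0 + f (Suc 0) + f 2" for f :: "nat \<Rightarrow> 'k"
    using sum_below_3(1)[of f] by (simp add: atLeast0LessThan)
  fix i j assume ij: "i < dim_row (cube_sub_matrix M * cube_cocycle P + cube_cocycle M * 1\<^sub>m 1)"
    "j < dim_col (cube_sub_matrix M * cube_cocycle P + cube_cocycle M * 1\<^sub>m 1)"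
  then have i: "i = 0 \<or> i = Suc 0 \<or> i = 2" and j: "j = 0"
    using block_carriers(3)[of M] by (auto simp: all_below_3)
  show "cube_cocycle (M * P) $$ (i, j) = (cube_sub_matrix M * cube_cocycle P + cube_cocycle M * 1\<^sub>m 1) $$ (i, j)"
    using assms i unfolding carrier_G_iff j
    by (elim insertE emptyE disjE)
      (simp_all add: cube_cocycle_def cube_sub_matrix_def cube_sub_cocycle_def scalar_prod_def s3)
qed (use block_carriers(3)[of M] block_carriers(3)[of "M * P"] in auto)

lemma rep_triv_1: "is_rep (G 2 2) (1, \<lambda>_. 1\<^sub>m 1 :: 'k mat)"
  using is_rep_triv by (simp add: triv_rep_def)

lemma square_class:
  "is_rep (G 2 2) (3, \<lambda>g. square_matrix (A g))"
  "K0_class (G 2 2) (3, \<lambda>g. square_matrix (A g)) =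
    K0_class (G 2 2) (2, A) \<otimes>\<^bsub>K0 (G 2 2)\<^esub> K0_class (G 2 2) triv_rep"
proof -
  note block = block_rep[OF is_rep_A rep_triv_1 group.is_monoid[OF group_GL], of "\<lambda>g. square_cocycle (A g)"]
  have "square_cocycle (A (1\<^sub>m 2)) = 0\<^sub>m 2 1"
    unfolding A_one by (intro eq_matI) (auto simp: square_cocycle_def less_2_cases_iff)
  then show "is_rep (G 2 2) (3, \<lambda>g. square_matrix (A g))"
    "K0_class (G 2 2) (3, \<lambda>g. square_matrix (A g)) =
      K0_class (G 2 2) (2, A) \<otimes>\<^bsub>K0 (G 2 2)\<^esub> K0_class (G 2 2) triv_rep"
    using block by (simp_all add: block_carriers A_mult square_cocycle A_in_G square_matrix_def triv_rep_def del: One_nat_def)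
qed

lemma cube_class:
  "is_rep (G 2 2) (4, \<lambda>g. cube_matrix (A g))"
  "K0_class (G 2 2) (4, \<lambda>g. cube_matrix (A g)) =
    K0_class (G 2 2) triv_rep \<otimes>\<^bsub>K0 (G 2 2)\<^esub> K0_class (G 2 2) (2, A) \<otimes>\<^bsub>K0 (G 2 2)\<^esub> K0_class (G 2 2) triv_rep"
proof -
  note block = block_rep[OF rep_triv_1 is_rep_A group.is_monoid[OF group_GL], of "\<lambda>g. cube_sub_cocycle (A g)"]
  have "cube_sub_cocycle (A (1\<^sub>m 2)) = 0\<^sub>m 1 2"
    unfolding A_one by (intro eq_matI) (auto simp: cube_sub_cocycle_def less_2_cases_iff)
  then have sub: "is_rep (G 2 2) (3, \<lambda>g. cube_sub_matrix (A g))"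
    "K0_class (G 2 2) (3, \<lambda>g. cube_sub_matrix (A g)) =
      K0_class (G 2 2) triv_rep \<otimes>\<^bsub>K0 (G 2 2)\<^esub> K0_class (G 2 2) (2, A)"
    using block by (simp_all add: block_carriers A_mult cube_sub_cocycle A_in_G cube_sub_matrix_def triv_rep_def del: One_nat_def)
  note block' = block_rep[OF sub(1) rep_triv_1 group.is_monoid[OF group_GL], of "\<lambda>g. cube_cocycle (A g)"]
  have "cube_cocycle (A (1\<^sub>m 2)) = 0\<^sub>m 3 1"
    unfolding A_one by (intro eq_matI) (auto simp: cube_cocycle_def all_below_3)
  then show "is_rep (G 2 2) (4, \<lambda>g. cube_matrix (A g))"
    "K0_class (G 2 2) (4, \<lambda>g. cube_matrix (A g)) =
      K0_class (G 2 2) triv_rep \<otimes>\<^bsub>K0 (G 2 2)\<^esub> K0_class (G 2 2) (2, A) \<otimes>\<^bsub>K0 (G 2 2)\<^esub> K0_class (G 2 2) triv_rep"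
    using block' sub(2) by (simp_all add: block_carriers A_mult cube_cocycle A_in_G cube_matrix_def triv_rep_def del: One_nat_def)
qed

lemma square_poly_equivariant:
  assumes M: "M \<in> carrier (G 2 2)" and v: "v \<in> carrier_vec 3"
  shows "square_poly (square_matrix M *\<^sub>v v) = linear_subst M (square_poly v)"
  using M unfolding carrier_G_iff square_poly_def
  by (elim insertE emptyE)
    (simp_all add: linear_subst_add linear_subst_monomial square_matrix_vec[OF v] del: index_mult_mat_vec,
     simp_all add: single_expo pconst_add power2_eq_square algebra_simps poly_char_2)

lemma cube_poly_equivariant:
  assumes M: "M \<in> carrier (G 2 2)" and v: "v \<in> carrier_vec 4"
  shows "cube_poly (cube_matrix M *\<^sub>v v) = linear_subst M (cube_poly v)"
  using M unfolding carrier_G_iff cube_poly_def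
  by (elim insertE emptyE)
    (simp_all add: linear_subst_add linear_subst_monomial cube_matrix_vec[OF v] del: index_mult_mat_vec,
     simp_all add: single_expo pconst_add power2_eq_square power3_eq_cube algebra_simps poly_char_2)

lemma sym_power_class:
  "rep_class (G 2 2) (sym_power (2, A) 2) = K0_class (G 2 2) (3, \<lambda>g. square_matrix (A g))"
  "rep_class (G 2 2) (sym_power (2, A) 3) = K0_class (G 2 2) (4, \<lambda>g. cube_matrix (A g))"
proof -
  have "isomorphic_rep (G 2 2) (3, \<lambda>g. square_matrix (A g)) (sym_power (2, A) 2)"
    unfolding isomorphic_rep_def fst_conv snd_conv
    by (intro exI[of _ square_poly] conjI is_linear_iso_square) (simp_all add: square_poly_equivariant A_in_G)
  then show "rep_class (G 2 2) (sym_power (2, A) 2) = K0_class (G 2 2) (3, \<lambda>g. square_matrix (A g))"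
    by (rule rep_class_eq[OF square_class(1)])
  have "isomorphic_rep (G 2 2) (4, \<lambda>g. cube_matrix (A g)) (sym_power (2, A) 3)"
    unfolding isomorphic_rep_def fst_conv snd_conv
    by (intro exI[of _ cube_poly] conjI is_linear_iso_cube) (simp_all add: cube_poly_equivariant A_in_G)
  then show "rep_class (G 2 2) (sym_power (2, A) 3) = K0_class (G 2 2) (4, \<lambda>g. cube_matrix (A g))"
    by (rule rep_class_eq[OF cube_class(1)])
qed

text \<open>From \<open>[S\<^sup>2 h\<^sup>*] = [h\<^sup>*] + [triv]\<close> and \<open>[S\<^sup>3 h\<^sup>*] = [triv] + [h\<^sup>*] + [triv]\<close>: the second and third graded pieces of
  the coinvariant algebra, written as in the theorem.\<close>

lemma K0_relations:
  "rep_class (G 2 2) (sym_power (2, A) 2) \<otimes>\<^bsub>K0 (G 2 2)\<^esub> inv\<^bsub>K0 (G 2 2)\<^esub> K0_class (G 2 2) triv_rep = K0_class (G 2 2) (2, A)"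
  "rep_class (G 2 2) (sym_power (2, A) 3) \<otimes>\<^bsub>K0 (G 2 2)\<^esub> inv\<^bsub>K0 (G 2 2)\<^esub> K0_class (G 2 2) (2, A)
    \<otimes>\<^bsub>K0 (G 2 2)\<^esub> inv\<^bsub>K0 (G 2 2)\<^esub> K0_class (G 2 2) triv_rep = K0_class (G 2 2) triv_rep"
proof -
  interpret K: comm_group "K0 (G 2 2) :: (('k mat, 'k) mrep \<Rightarrow>\<^sub>0 int) set monoid" by (rule comm_group_K0)
  have c: "K0_class (G 2 2) (2, A) \<in> carrier (K0 (G 2 2))" "K0_class (G 2 2) triv_rep \<in> carrier (K0 (G 2 2))"
    by (rule K0_class_closed, simp add: is_rep_A is_rep_triv)+
  show "rep_class (G 2 2) (sym_power (2, A) 2) \<otimes>\<^bsub>K0 (G 2 2)\<^esub> inv\<^bsub>K0 (G 2 2)\<^esub> K0_class (G 2 2) triv_rep = K0_class (G 2 2) (2, A)"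
  proof -
    have "a \<otimes>\<^bsub>K0 (G 2 2)\<^esub> b \<otimes>\<^bsub>K0 (G 2 2)\<^esub> inv\<^bsub>K0 (G 2 2)\<^esub> b = a"
      if "a \<in> carrier (K0 (G 2 2))" "b \<in> carrier (K0 (G 2 2))" for a b :: "(('k mat, 'k) mrep \<Rightarrow>\<^sub>0 int) set"
      using that by (simp add: K.m_assoc)
    then show ?thesis unfolding sym_power_class square_class using c by blast
  qed
  show "rep_class (G 2 2) (sym_power (2, A) 3) \<otimes>\<^bsub>K0 (G 2 2)\<^esub> inv\<^bsub>K0 (G 2 2)\<^esub> K0_class (G 2 2) (2, A)
    \<otimes>\<^bsub>K0 (G 2 2)\<^esub> inv\<^bsub>K0 (G 2 2)\<^esub> K0_class (G 2 2) triv_rep = K0_class (G 2 2) triv_rep"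
  proof -
    have "a \<otimes>\<^bsub>K0 (G 2 2)\<^esub> b \<otimes>\<^bsub>K0 (G 2 2)\<^esub> a \<otimes>\<^bsub>K0 (G 2 2)\<^esub> inv\<^bsub>K0 (G 2 2)\<^esub> b \<otimes>\<^bsub>K0 (G 2 2)\<^esub> inv\<^bsub>K0 (G 2 2)\<^esub> a = a"
      if "a \<in> carrier (K0 (G 2 2))" "b \<in> carrier (K0 (G 2 2))" for a b :: "(('k mat, 'k) mrep \<Rightarrow>\<^sub>0 int) set"
    proof -
      have "a \<otimes>\<^bsub>K0 (G 2 2)\<^esub> b \<otimes>\<^bsub>K0 (G 2 2)\<^esub> a = a \<otimes>\<^bsub>K0 (G 2 2)\<^esub> a \<otimes>\<^bsub>K0 (G 2 2)\<^esub> b"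
        using that by (simp add: K.m_ac)
      then show ?thesis using that by (simp add: K.m_assoc)
    qed
    then show ?thesis unfolding sym_power_class cube_class using c by blast
  qed
qed

end

theorem theorem4p3:
  fixes p q r n :: nat
    and c :: "'k::alg_closed_field mat \<Rightarrow> 'k"
  assumes "CHAR('k) = p" and "p > 0"
    and "r \<ge> 1" and "q = p ^ r" and "n \<ge> 2"
    and "conj_invariant (GL_rca n q 0 c)"
  shows "(let D = GL_rca n q 0 c;
              G = (GL_Fq n q :: 'k mat monoid);
              zero = \<one>\<^bsub>K0 G\<^esub>;
              triv = K0_class G triv_rep;
              hdual = dual_rep G (GL_std n)
          in
            ((q, n) \<noteq> (2, 2) \<longrightarrow>
               character_L D triv_rep = poly_series zero [triv] \<and>
               hilbert_L D triv_rep = poly_series 0 [1]) \<and>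
            ((q, n) = (2, 2) \<and> (\<forall>s\<in>reflections D. c s = 0) \<longrightarrow>
               character_L D triv_rep = poly_series zero [triv] \<and>
               hilbert_L D triv_rep = poly_series 0 [1]) \<and>
            ((q, n) = (2, 2) \<and> \<not> (\<forall>s\<in>reflections D. c s = 0) \<longrightarrow>
               character_L D triv_rep = poly_series zero
                 [triv,
                  K0_class G hdual,
                  rep_class G (sym_power hdual 2) \<otimes>\<^bsub>K0 G\<^esub> inv\<^bsub>K0 G\<^esub> triv,
                  rep_class G (sym_power hdual 3) \<otimes>\<^bsub>K0 G\<^esub> inv\<^bsub>K0 G\<^esub> K0_class G hdual
                    \<otimes>\<^bsub>K0 G\<^esub> inv\<^bsub>K0 G\<^esub> triv] \<and>
               hilbert_L D triv_rep = poly_series 0 [1, 2, 2, 1]))"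
proof -
  have p: "prime p"
    using assms(1,2) prime_CHAR_semidom[where ?'a = 'k] by simp
  have q_gt_1: "q > 1"
    using one_less_power[OF prime_gt_1_nat[OF p], of r] assms(3,4) by simp
  have q_zero: "of_nat q = (0::'k)"
    using assms(1,3,4) by (simp add: of_nat_eq_0_iff_char_dvd)
  interpret GL_parameters q "TYPE('k)" n 0 c
  proof
    show "(a + b) ^ q = a ^ q + b ^ q" for a b :: 'k
      by (rule freshmans_dream'[of q r]) (use assms(1,4) p in auto)
    show "\<exists>\<mu>::'k. \<mu> ^ q = \<mu> \<and> \<mu> \<noteq> 0 \<and> \<mu> \<noteq> 1" if "q > 2"
      using ex_generic_scalar[OF q_zero that] .
  qed (use q_gt_1 assms(5,6) in auto)
  note trivial = L_triv_GL[OF refl]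
  have dual: "dual_rep (GL_Fq 2 2) (GL_std 2) = (2, contra (GL_Fq 2 2) (\<lambda>g::'k mat. g))"
    by (simp add: dual_rep_def GL_std_def)
  have coinvariant:
    "GL_2_F_2 c" "\<exists>s\<in>reflections (GL_rca 2 2 0 c). c s \<noteq> 0"
    if qn: "(q, n) = (2, 2)" and c: "\<not> (\<forall>s\<in>reflections (GL_rca n q 0 c). c s = 0)"
  proof -
    have "q = 2" "n = 2" using qn by auto
    then have "GL_parameters 2 2 0 c" "(1::'k) + 1 = 0"
      using GL_parameters_axioms q_zero by simp_all
    then show "GL_2_F_2 c"
      by (simp add: GL_2_F_2_def GL_2_F_2_axioms_def)
    show "\<exists>s\<in>reflections (GL_rca 2 2 0 c). c s \<noteq> 0"
      using c \<open>q = 2\<close> \<open>n = 2\<close> by auto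
  qed
  have special: "character_L (GL_rca 2 2 0 c) triv_rep =
      poly_series \<one>\<^bsub>K0 (GL_Fq 2 2)\<^esub> [K0_class (GL_Fq 2 2) triv_rep, K0_class (GL_Fq 2 2) V,
        rep_class (GL_Fq 2 2) (sym_power V 2) \<otimes>\<^bsub>K0 (GL_Fq 2 2)\<^esub> inv\<^bsub>K0 (GL_Fq 2 2)\<^esub> K0_class (GL_Fq 2 2) triv_rep,
        rep_class (GL_Fq 2 2) (sym_power V 3) \<otimes>\<^bsub>K0 (GL_Fq 2 2)\<^esub> inv\<^bsub>K0 (GL_Fq 2 2)\<^esub> K0_class (GL_Fq 2 2) V
          \<otimes>\<^bsub>K0 (GL_Fq 2 2)\<^esub> inv\<^bsub>K0 (GL_Fq 2 2)\<^esub> K0_class (GL_Fq 2 2) triv_rep] \<and>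
      hilbert_L (GL_rca 2 2 0 c) triv_rep = poly_series 0 [1, 2, 2, 1]"
    if V: "V = dual_rep (GL_Fq 2 2) (GL_std 2)" and qn: "(q, n) = (2, 2)"
      and c: "\<not> (\<forall>s\<in>reflections (GL_rca n q 0 c). c s = 0)" for V :: "('k mat, 'k) mrep"
  proof -
    interpret S: GL_2_F_2 "TYPE('k)" c
      using coinvariant(1)[OF qn c] .
    have "S.\<gamma> \<noteq> 0"
      using coinvariant(2)[OF qn c] S.c_const by metis
    then show ?thesis
      using S.L_coinv unfolding V dual S.K0_relations by blast
  qed
  show ?thesis
    unfolding Let_def using trivial special[OF refl] by auto
qed


end
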